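(* Let $\epsilon>0$ and $D\ge0$ be given. Let $R(\cdot)$ be the rate distortion function of a discrete, stationary, ergodic source with respect to a single-letter fidelity criterion generated by a bounded distortion measure $d$. Consider any channel with time-invariant deterministic feedback $z_i=z(y_i)$ whose capacity $C$ is given by $$C=\lim_{N\to\infty}\frac1N\max_{Q(x^N\|z^{N-1})}I(X^N\to Y^N).$$ Then the source output can be reproduced with fidelity $D$ at the receiving end of the channel if $C>R(D)$. Conversely, fidelity $D$ is unattainable at the receiving end of the channel if $C<R(D)$.
   Context: Channel: a finite-state channel with finite input, output and state alphabets $\mathcal X,\mathcal Y,\mathcal S$ and time-invariant kernel $P(y_i,s_i|x_i,s_{i-1})$ satisfying $P(y_i,s_i|x^i,s^{i-1},y^{i-1})=P(y_i,s_i|x_i,s_{i-1})$; the initial state $S_0$ has a given distribution $P(s_0)$ and is independent of the source. Feedback: $z:\mathcal Y\to\mathcal Z$ is a fixed function into a finite set, $z_i=z(y_i)$, and at time $i$ the encoder knows $z^{i-1}=(z_1,\dots,z_{i-1})$. Capacity is the supremum of achievable rates, where $R$ is achievable if there are codes with encoders $x_i(m,z^{i-1})$, decoder $\hat m(y^N)$ and $\lceil 2^{NR}\rceil$ messages whose maximal (over messages) error probability tends to $0$ as $N\to\infty$ for all initial states. Causal conditioning: $Q(x^N\|z^{N-1})=\prod_{i=1}^N Q(x_i|x^{i-1},z^{i-1})$ (maximum over all such families of conditional pmfs); $P(y^N\|x^N)=\sum_{s_0}P(s_0)\sum_{s^N}\prod_{i=1}^N P(y_i,s_i|x_i,s_{i-1})$;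 $I(X^N\to Y^N)=\sum_{i=1}^N I(X^i;Y_i|Y^{i-1})$ under $P(x^N,y^N)=Q(x^N\|z^{N-1})P(y^N\|x^N)$, with $z^{N-1}=(z(y_1),\dots,z(y_{N-1}))$. Source-channel coding with one channel use per source symbol: a joint source-channel code of block length $N$ consists of encoding functions $x_i(u^N,z^{i-1})$, $i=1,\dots,N$, where $u^N$ is the source block, and a reconstruction $v^N=v^N(y^N)$. Fidelity $D$ is attainable (the source can be reproduced with fidelity $D$) if for all sufficiently large $N$ there is such a code with $\frac1N\sum_{i=1}^N \mathbf E[d(U_i,V_i)]\le D$. The rate distortion function is $R(D)=\lim_{N\to\infty}\frac1N\min I(U^N;V^N)$, the minimum being over conditional laws of $V^N$ given $U^N$ with $\frac1N\sum_{i=1}^N\mathbf E[d(U_i,V_i)]\le D$.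
   Formalization: If C>R(D), fidelity D+ε is proved for every D≥0, and fidelity D itself only when D exceeds the least expected distortion E[inf_v d(U,v)]; at equality the claim fails (Bernoulli(1/4) source, Hamming distortion, D=0, BSC(0.01)). *)

theory Defs
  imports "HOL-Probability.Probability"
begin

section \<open>Stationary ergodic sources\<close>

text \<open>
  The letters \<open>U\<^sub>1, U\<^sub>2, \<dots>\<close> are the coordinates \<open>\<omega> 0, \<omega> 1, \<dots>\<close> of a point of the sequence
  space.  Source and reproduction alphabets are countable types, which covers the finite ones.
\<close>

abbreviation seq_space :: "(nat \<Rightarrow> 'u) measure" where
  "seq_space \<equiv> PiM UNIV (\<lambda>_. count_space UNIV)"

definition seq_shift :: "(nat \<Rightarrow> 'u) \<Rightarrow> nat \<Rightarrow> 'u" where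
  "seq_shift \<omega> = (\<lambda>i. \<omega> (Suc i))"

definition stationary_ergodic :: "(nat \<Rightarrow> 'u) measure \<Rightarrow> bool" where
  "stationary_ergodic \<mu> \<longleftrightarrow>
     prob_space \<mu> \<and> sets \<mu> = sets seq_space \<and>
     distr \<mu> seq_space seq_shift = \<mu> \<and>
     (\<forall>A\<in>sets \<mu>. seq_shift -` A = A \<longrightarrow> measure \<mu> A = 0 \<or> measure \<mu> A = 1)"

definition source_block :: "(nat \<Rightarrow> 'u::countable) measure \<Rightarrow> nat \<Rightarrow> 'u list pmf" where
  "source_block \<mu> N = embed_pmf (\<lambda>us. measure \<mu> {\<omega>. map \<omega> [0..<N] = us})"

lemma measurable_block [measurable]:
  "(\<lambda>\<omega>. map \<omega> [0..<N]) \<in> measurable seq_space (count_space (UNIV :: 'u::countable list set))"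
proof (induction N)
  case (Suc N)
  have "(\<lambda>\<omega>. map \<omega> [0..<N] @ [\<omega> N]) \<in> measurable seq_space (count_space (UNIV :: 'u list set))"
    using Suc by measurable
  then show ?case by simp
qed simp

lemma pmf_source_block:
  fixes \<mu> :: "(nat \<Rightarrow> 'u::countable) measure"
  assumes "prob_space \<mu>" "sets \<mu> = sets seq_space"
  shows "pmf (source_block \<mu> N) us = measure \<mu> {\<omega>. map \<omega> [0..<N] = us}"
proof -
  interpret prob_space \<mu> by fact
  have [measurable_cong]: "sets \<mu> = sets seq_space" by fact
  have sp: "space \<mu> = UNIV"
    using sets_eq_imp_space_eq[OF assms(2)] by (simp add: space_PiM)
  define \<nu> where "\<nu> = distr \<mu> (count_space UNIV) (\<lambda>\<omega>. map \<omega> [0..<N])"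
  have m: "(\<lambda>\<omega>. map \<omega> [0..<N]) \<in> measurable \<mu> (count_space UNIV)" by measurable
  interpret N: prob_space \<nu> unfolding \<nu>_def by (rule prob_space_distr[OF m])
  have eq: "measure \<mu> {\<omega>. map \<omega> [0..<N] = us} = measure \<nu> {us}" for us
    unfolding \<nu>_def by (subst measure_distr[OF m]) (auto simp: sp vimage_def)
  have "(\<integral>\<^sup>+us. ennreal (measure \<nu> {us}) \<partial>count_space UNIV) = emeasure \<nu> UNIV"
    by (subst emeasure_countable_singleton)
       (auto simp: \<nu>_def N.emeasure_eq_measure[unfolded \<nu>_def])
  also have "\<dots> = 1"
    using N.emeasure_space_1 by (simp add: \<nu>_def)
  finally show ?thesis
    unfolding source_block_def by (subst pmf_embed_pmf) (auto simp: eq)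
qed


section \<open>Rate distortion function\<close>

text \<open>
  Mutual information in bits of the two components of a discrete pair.  The Bochner integral in
  the library notion is 0 when the information density is not integrable; in the discrete case this
  happens exactly when the mutual information is infinite.
\<close>

definition pair_mutual_information :: "('a::countable \<times> 'b::countable) pmf \<Rightarrow> ereal" where
  "pair_mutual_information p =
     (if integrable (measure_pmf p)
           (entropy_density 2 (measure_pmf (map_pmf fst p) \<Otimes>\<^sub>M measure_pmf (map_pmf snd p))
              (measure_pmf p))
      then ereal (prob_space.mutual_information (measure_pmf p) 2
              (count_space UNIV) (count_space UNIV) fst snd)
      else \<infinity>)"

definition block_distortion ::
    "('u \<Rightarrow> 'v \<Rightarrow> real) \<Rightarrow> nat \<Rightarrow> ('u list \<times> 'v list) pmf \<Rightarrow> real" where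
  "block_distortion d N p =
     (\<Sum>i<N. measure_pmf.expectation p (\<lambda>(us, vs). d (us ! i) (vs ! i))) / real N"

definition test_channel_joint ::
    "(nat \<Rightarrow> 'u::countable) measure \<Rightarrow> nat \<Rightarrow> ('u list \<Rightarrow> 'v list pmf) \<Rightarrow> ('u list \<times> 'v list) pmf"
  where
  "test_channel_joint \<mu> N W = bind_pmf (source_block \<mu> N) (\<lambda>us. map_pmf (Pair us) (W us))"

text \<open>The infimum over the empty set is \<open>\<infinity>\<close>: then no test channel has distortion at most \<open>D\<close>.\<close>

definition block_rate_distortion ::
    "(nat \<Rightarrow> 'u::countable) measure \<Rightarrow> ('u \<Rightarrow> 'v::countable \<Rightarrow> real) \<Rightarrow> nat \<Rightarrow> real \<Rightarrow> ereal" where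
  "block_rate_distortion \<mu> d N D =
     (INF W \<in> {W. (\<forall>us. \<forall>vs\<in>set_pmf (W us). length vs = N) \<and>
                  block_distortion d N (test_channel_joint \<mu> N W) \<le> D}.
        pair_mutual_information (test_channel_joint \<mu> N W))"

definition rate_distortion ::
    "(nat \<Rightarrow> 'u::countable) measure \<Rightarrow> ('u \<Rightarrow> 'v::countable \<Rightarrow> real) \<Rightarrow> real \<Rightarrow> ereal" where
  "rate_distortion \<mu> d D = lim (\<lambda>N. block_rate_distortion \<mu> d N D / ereal (real N))"

text \<open>The least expected distortion, reached or approached by reproducing each letter optimally.\<close>

definition min_distortion :: "(nat \<Rightarrow> 'u) measure \<Rightarrow> ('u \<Rightarrow> 'v \<Rightarrow> real) \<Rightarrow> real" where
  "min_distortion \<mu> d = (\<integral>\<omega>. (INF v. d (\<omega> 0) v) \<partial>\<mu>)"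


section \<open>Finite-state channels with feedback\<close>

text \<open>
  \<open>K x s\<close> is the law of the pair (output, new state) given the input \<open>x\<close> and the previous state \<open>s\<close>.
  An encoding strategy \<open>e\<close> sends \<open>e [z\<^sub>1, \<dots>, z\<^sub>i\<^sub>-\<^sub>1]\<close> at time \<open>i\<close>; the time is the length of
  the argument plus one, so that \<open>e\<close> stands for the whole family of encoding functions.
\<close>

type_synonym ('x, 's, 'y) fs_channel = "'x \<Rightarrow> 's \<Rightarrow> ('y \<times> 's) pmf"

primrec channel_run ::
    "('x, 's, 'y) fs_channel \<Rightarrow> ('y \<Rightarrow> 'z) \<Rightarrow> ('z list \<Rightarrow> 'x) \<Rightarrow> 's \<Rightarrow> nat \<Rightarrow> ('y list \<times> 's) pmf" where
  "channel_run K z e s\<^sub>0 0 = return_pmf ([], s\<^sub>0)"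
| "channel_run K z e s\<^sub>0 (Suc n) =
     bind_pmf (channel_run K z e s\<^sub>0 n)
       (\<lambda>(ys, s). map_pmf (\<lambda>(y, s'). (ys @ [y], s')) (K (e (map z ys)) s))"

definition channel_output ::
    "('x, 's, 'y) fs_channel \<Rightarrow> ('y \<Rightarrow> 'z) \<Rightarrow> ('z list \<Rightarrow> 'x) \<Rightarrow> 's \<Rightarrow> nat \<Rightarrow> 'y list pmf" where
  "channel_output K z e s\<^sub>0 N = map_pmf fst (channel_run K z e s\<^sub>0 N)"


subsection \<open>Capacity\<close>

definition num_messages :: "real \<Rightarrow> nat \<Rightarrow> nat" where
  "num_messages R N = nat \<lceil>2 powr (real N * R)\<rceil>"

definition max_error_prob ::
    "('x, 's, 'y) fs_channel \<Rightarrow> ('y \<Rightarrow> 'z) \<Rightarrow> nat \<Rightarrow> nat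
       \<Rightarrow> (nat \<Rightarrow> 'z list \<Rightarrow> 'x) \<Rightarrow> ('y list \<Rightarrow> nat) \<Rightarrow> 's \<Rightarrow> real" where
  "max_error_prob K z M N f g s\<^sub>0 =
     (MAX m\<in>{..<M}. measure_pmf.prob (channel_output K z (f m) s\<^sub>0 N) {ys. g ys \<noteq> m})"

definition achievable_rate :: "('x, 's, 'y) fs_channel \<Rightarrow> ('y \<Rightarrow> 'z) \<Rightarrow> real \<Rightarrow> bool" where
  "achievable_rate K z R \<longleftrightarrow>
     0 \<le> R \<and>
     (\<exists>f g. \<forall>s\<^sub>0. (\<lambda>N. max_error_prob K z (num_messages R N) N (f N) (g N) s\<^sub>0) \<longlonglongrightarrow> 0)"

definition capacity :: "('x, 's, 'y) fs_channel \<Rightarrow> ('y \<Rightarrow> 'z) \<Rightarrow> ereal" where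
  "capacity K z = (SUP R\<in>{R. achievable_rate K z R}. ereal R)"


subsection \<open>Directed information\<close>

text \<open>
  A family of conditional laws \<open>Q(x\<^sub>i | x\<^sup>i\<^sup>-\<^sup>1, z\<^sup>i\<^sup>-\<^sup>1)\<close> is a function of the two
  pasts; their length determines the time.
\<close>

definition causal_input :: "('x list \<Rightarrow> 'z list \<Rightarrow> 'x pmf) \<Rightarrow> 'x list \<Rightarrow> 'z list \<Rightarrow> real" where
  "causal_input Q xs zs = (\<Prod>i<length xs. pmf (Q (take i xs) (take i zs)) (xs ! i))"

text \<open>In the list \<open>s\<^sub>0 # ss\<close> the states before and after use \<open>i\<close> (counted from 0) have
  positions \<open>i\<close> and \<open>i + 1\<close>.\<close>

definition channel_law ::
    "('x, 's::finite, 'y) fs_channel \<Rightarrow> 's pmf \<Rightarrow> 'x list \<Rightarrow> 'y list \<Rightarrow> real" where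
  "channel_law K p\<^sub>0 xs ys =
     (\<Sum>s\<^sub>0\<in>UNIV. pmf p\<^sub>0 s\<^sub>0 *
        (\<Sum>ss | length ss = length xs.
           \<Prod>i<length xs. pmf (K (xs ! i) ((s\<^sub>0 # ss) ! i)) (ys ! i, ss ! i)))"

definition input_output_joint ::
    "('x::finite, 's::finite, 'y::finite) fs_channel \<Rightarrow> 's pmf \<Rightarrow> ('y \<Rightarrow> 'z) \<Rightarrow> nat
       \<Rightarrow> ('x list \<Rightarrow> 'z list \<Rightarrow> 'x pmf) \<Rightarrow> ('x list \<times> 'y list) pmf" where
  "input_output_joint K p\<^sub>0 z N Q =
     embed_pmf (\<lambda>(xs, ys).
       if length xs = N \<and> length ys = N
       then causal_input Q xs (map z (butlast ys)) * channel_law K p\<^sub>0 xs ys else 0)"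

definition directed_information ::
    "('x::finite, 's::finite, 'y::finite) fs_channel \<Rightarrow> 's pmf \<Rightarrow> ('y \<Rightarrow> 'z) \<Rightarrow> nat
       \<Rightarrow> ('x list \<Rightarrow> 'z list \<Rightarrow> 'x pmf) \<Rightarrow> real" where
  "directed_information K p\<^sub>0 z N Q =
     (\<Sum>i<N. prob_space.conditional_mutual_information
        (measure_pmf (input_output_joint K p\<^sub>0 z N Q)) 2
        (count_space UNIV) (count_space UNIV) (count_space UNIV)
        (\<lambda>(xs, ys). take (Suc i) xs) (\<lambda>(xs, ys). ys ! i) (\<lambda>(xs, ys). take i ys))"

definition max_directed_information ::
    "('x::finite, 's::finite, 'y::finite) fs_channel \<Rightarrow> 's pmf \<Rightarrow> ('y \<Rightarrow> 'z) \<Rightarrow> nat \<Rightarrow> real" where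
  "max_directed_information K p\<^sub>0 z N = (SUP Q. directed_information K p\<^sub>0 z N Q)"

lemma lists_Suc_snoc:
  "{xs. length xs = Suc n} = (\<lambda>(xs, x). xs @ [x]) ` ({xs. length xs = n} \<times> UNIV)"
proof (intro set_eqI iffI)
  fix xs :: "'a list"
  assume "xs \<in> {xs. length xs = Suc n}"
  then have "xs = butlast xs @ [last xs]" "length (butlast xs) = n"
    by (auto simp: length_Suc_conv)
  then show "xs \<in> (\<lambda>(xs, x). xs @ [x]) ` ({xs. length xs = n} \<times> UNIV)"
    by (auto intro!: image_eqI[where x = "(butlast xs, last xs)"])
qed auto

lemma sum_lists_Suc:
  fixes h :: "'a::finite list \<Rightarrow> real"
  shows "(\<Sum>xs | length xs = Suc n. h xs) = (\<Sum>xs | length xs = n. \<Sum>x\<in>UNIV. h (xs @ [x]))"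
  unfolding lists_Suc_snoc
  by (subst sum.reindex) (auto simp: inj_on_def sum.cartesian_product case_prod_unfold)

lemma finite_lists_eq: "finite {xs :: 'a::finite list. length xs = n}"
  using finite_lists_length_eq[of "UNIV :: 'a set" n] by simp

lemma sum_swap_pairs:
  fixes F :: "_ \<Rightarrow> _ \<Rightarrow> _ \<Rightarrow> _ \<Rightarrow> _ \<Rightarrow> real"
  shows "(\<Sum>a\<in>A. \<Sum>b\<in>B. \<Sum>c\<in>C. \<Sum>d\<in>D. \<Sum>e\<in>E. F a b c d e) =
         (\<Sum>b\<in>B. \<Sum>d\<in>D. \<Sum>a\<in>A. \<Sum>c\<in>C. \<Sum>e\<in>E. F a b c d e)"
proof -
  have "(\<Sum>a\<in>A. \<Sum>b\<in>B. \<Sum>c\<in>C. \<Sum>d\<in>D. \<Sum>e\<in>E. F a b c d e) =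
        (\<Sum>b\<in>B. \<Sum>a\<in>A. \<Sum>c\<in>C. \<Sum>d\<in>D. \<Sum>e\<in>E. F a b c d e)"
    by (rule sum.swap)
  also have "\<dots> = (\<Sum>b\<in>B. \<Sum>a\<in>A. \<Sum>d\<in>D. \<Sum>c\<in>C. \<Sum>e\<in>E. F a b c d e)"
    by (intro sum.cong refl sum.swap)
  also have "\<dots> = (\<Sum>b\<in>B. \<Sum>d\<in>D. \<Sum>a\<in>A. \<Sum>c\<in>C. \<Sum>e\<in>E. F a b c d e)"
    by (intro sum.cong refl sum.swap)
  finally show ?thesis .
qed

lemma sum_causal_law:
  fixes K :: "('x::finite, 's::finite, 'y::finite) fs_channel"
  shows "(\<Sum>xs | length xs = N. \<Sum>ys | length ys = N. \<Sum>ss | length ss = N.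
            causal_input Q xs (map z ys) *
            (\<Prod>i<N. pmf (K (xs ! i) ((s\<^sub>0 # ss) ! i)) (ys ! i, ss ! i))) = 1"
proof (induction N)
  case 0
  then show ?case by (simp add: causal_input_def)
next
  case (Suc N)
  let ?G = "\<lambda>xs ys ss. causal_input Q xs (map z ys) *
            (\<Prod>i<N. pmf (K (xs ! i) ((s\<^sub>0 # ss) ! i)) (ys ! i, ss ! i))"
  let ?H = "\<lambda>xs ys ss. causal_input Q xs (map z ys) *
            (\<Prod>i<Suc N. pmf (K (xs ! i) ((s\<^sub>0 # ss) ! i)) (ys ! i, ss ! i))"
  have step: "?H (xs @ [x]) (ys @ [y]) (ss @ [s]) =
      ?G xs ys ss * (pmf (Q xs (map z ys)) x * pmf (K x ((s\<^sub>0 # ss) ! N)) (y, s))"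
    if "length xs = N" "length ys = N" "length ss = N" for xs x ys y ss s
  proof -
    have a: "causal_input Q (xs @ [x]) (map z (ys @ [y])) =
        causal_input Q xs (map z ys) * pmf (Q xs (map z ys)) x"
      using that by (simp add: causal_input_def nth_append)
    have b: "(s\<^sub>0 # ss @ [s]) ! i = (s\<^sub>0 # ss) ! i" if "i \<le> N" for i
      using that \<open>length ss = N\<close> by (cases i) (auto simp: nth_append)
    have c: "(\<Prod>i<N. pmf (K ((xs @ [x]) ! i) ((s\<^sub>0 # ss @ [s]) ! i)) ((ys @ [y]) ! i, (ss @ [s]) ! i))
        = (\<Prod>i<N. pmf (K (xs ! i) ((s\<^sub>0 # ss) ! i)) (ys ! i, ss ! i))"
      using that by (intro prod.cong refl) (simp add: b nth_append)
    show ?thesis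
      using that by (simp add: a b c nth_append del: nth_Cons_Suc map_append)
  qed
  have one: "(\<Sum>x\<in>UNIV. pmf q x * (\<Sum>y\<in>UNIV. \<Sum>s\<in>UNIV. pmf (K x s') (y, s))) = 1" for q s'
  proof -
    have "(\<Sum>y\<in>UNIV. \<Sum>s\<in>UNIV. pmf (K x s') (y, s)) = 1" for x
      using sum_pmf_eq_1[of UNIV "K x s'"] by (simp add: sum.cartesian_product)
    then show ?thesis by (simp add: sum_pmf_eq_1)
  qed
  have "(\<Sum>xs | length xs = Suc N. \<Sum>ys | length ys = Suc N. \<Sum>ss | length ss = Suc N. ?H xs ys ss)
      = (\<Sum>xs | length xs = N. \<Sum>x\<in>UNIV. \<Sum>ys | length ys = N. \<Sum>y\<in>UNIV.
          \<Sum>ss | length ss = N. \<Sum>s\<in>UNIV. ?H (xs @ [x]) (ys @ [y]) (ss @ [s]))"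
    by (simp only: sum_lists_Suc)
  also have "\<dots> = (\<Sum>xs | length xs = N. \<Sum>x\<in>UNIV. \<Sum>ys | length ys = N. \<Sum>y\<in>UNIV.
          \<Sum>ss | length ss = N. \<Sum>s\<in>UNIV.
            ?G xs ys ss * (pmf (Q xs (map z ys)) x * pmf (K x ((s\<^sub>0 # ss) ! N)) (y, s)))"
    by (intro sum.cong refl step) auto
  also have "\<dots> = (\<Sum>xs | length xs = N. \<Sum>ys | length ys = N. \<Sum>ss | length ss = N.
          \<Sum>x\<in>UNIV. \<Sum>y\<in>UNIV. \<Sum>s\<in>UNIV.
            ?G xs ys ss * (pmf (Q xs (map z ys)) x * pmf (K x ((s\<^sub>0 # ss) ! N)) (y, s)))"
    by (intro sum.cong refl sum_swap_pairs)
  also have "\<dots> = (\<Sum>xs | length xs = N. \<Sum>ys | length ys = N. \<Sum>ss | length ss = N. ?G xs ys ss)"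
    by (intro sum.cong refl) (simp only: sum_distrib_left[symmetric] one mult_1_right)
  also have "\<dots> = 1" by (rule Suc.IH)
  finally show ?case .
qed

lemma pmf_input_output_joint:
  fixes K :: "('x::finite, 's::finite, 'y::finite) fs_channel"
  shows "pmf (input_output_joint K p\<^sub>0 z N Q) (xs, ys) =
    (if length xs = N \<and> length ys = N
     then causal_input Q xs (map z (butlast ys)) * channel_law K p\<^sub>0 xs ys else 0)"
proof -
  let ?L = "{xs :: 'x list. length xs = N} \<times> {ys :: 'y list. length ys = N}"
  let ?f = "\<lambda>(xs, ys). if length xs = N \<and> length ys = N
     then causal_input Q xs (map z (butlast ys)) * channel_law K p\<^sub>0 xs ys else 0"
  have nonneg: "0 \<le> ?f x" for x
    by (auto simp: causal_input_def channel_law_def split: prod.split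
        intro!: mult_nonneg_nonneg sum_nonneg prod_nonneg)
  have fin: "finite ?L" by (intro finite_cartesian_product finite_lists_eq)
  have bl: "causal_input Q xs (map z (butlast ys)) = causal_input Q xs (map z ys)"
    if "length xs = N" "length ys = N" for xs ys
    unfolding causal_input_def using that
    by (intro prod.cong refl) (simp add: map_butlast take_butlast)
  have "(\<Sum>x\<in>?L. ?f x) = (\<Sum>xs | length xs = N. \<Sum>ys | length ys = N. \<Sum>s\<^sub>0\<in>UNIV.
      pmf p\<^sub>0 s\<^sub>0 * (\<Sum>ss | length ss = N. causal_input Q xs (map z ys) *
            (\<Prod>i<N. pmf (K (xs ! i) ((s\<^sub>0 # ss) ! i)) (ys ! i, ss ! i))))"
    unfolding sum.cartesian_product[symmetric]
    by (intro sum.cong refl)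
       (simp add: bl channel_law_def sum_distrib_left mult.left_commute)
  also have "\<dots> = (\<Sum>xs | length xs = N. \<Sum>s\<^sub>0\<in>UNIV. \<Sum>ys | length ys = N.
      pmf p\<^sub>0 s\<^sub>0 * (\<Sum>ss | length ss = N. causal_input Q xs (map z ys) *
            (\<Prod>i<N. pmf (K (xs ! i) ((s\<^sub>0 # ss) ! i)) (ys ! i, ss ! i))))"
    by (intro sum.cong refl sum.swap)
  also have "\<dots> = (\<Sum>s\<^sub>0\<in>UNIV. \<Sum>xs | length xs = N. \<Sum>ys | length ys = N.
      pmf p\<^sub>0 s\<^sub>0 * (\<Sum>ss | length ss = N. causal_input Q xs (map z ys) *
            (\<Prod>i<N. pmf (K (xs ! i) ((s\<^sub>0 # ss) ! i)) (ys ! i, ss ! i))))"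
    by (rule sum.swap)
  also have "\<dots> = (\<Sum>s\<^sub>0\<in>UNIV. pmf p\<^sub>0 s\<^sub>0)"
  proof (intro sum.cong refl)
    fix s\<^sub>0 :: 's
    have "(\<Sum>xs | length xs = N. \<Sum>ys | length ys = N.
        pmf p\<^sub>0 s\<^sub>0 * (\<Sum>ss | length ss = N. causal_input Q xs (map z ys) *
            (\<Prod>i<N. pmf (K (xs ! i) ((s\<^sub>0 # ss) ! i)) (ys ! i, ss ! i)))) =
      pmf p\<^sub>0 s\<^sub>0 * (\<Sum>xs | length xs = N. \<Sum>ys | length ys = N. \<Sum>ss | length ss = N.
            causal_input Q xs (map z ys) *
            (\<Prod>i<N. pmf (K (xs ! i) ((s\<^sub>0 # ss) ! i)) (ys ! i, ss ! i)))"
      by (simp only: sum_distrib_left)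
    also have "\<dots> = pmf p\<^sub>0 s\<^sub>0" by (simp only: sum_causal_law mult_1_right)
    finally show "(\<Sum>xs | length xs = N. \<Sum>ys | length ys = N.
        pmf p\<^sub>0 s\<^sub>0 * (\<Sum>ss | length ss = N. causal_input Q xs (map z ys) *
            (\<Prod>i<N. pmf (K (xs ! i) ((s\<^sub>0 # ss) ! i)) (ys ! i, ss ! i)))) = pmf p\<^sub>0 s\<^sub>0" .
  qed
  also have "\<dots> = 1" by (simp add: sum_pmf_eq_1)
  finally have sum1: "(\<Sum>x\<in>?L. ?f x) = 1" .
  have "(\<integral>\<^sup>+x. ennreal (?f x) \<partial>count_space UNIV) = (\<Sum>x\<in>?L. ennreal (?f x))"
    by (rule nn_integral_count_space') (auto simp: fin split: if_splits)
  also have "\<dots> = ennreal (\<Sum>x\<in>?L. ?f x)"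
    by (rule sum_ennreal) (rule nonneg)
  also have "\<dots> = 1" by (simp only: sum1 ennreal_1)
  finally show ?thesis
    unfolding input_output_joint_def by (subst pmf_embed_pmf) (use nonneg in auto)
qed


subsection \<open>Joint source-channel coding\<close>

text \<open>The source block and its reconstruction, the initial state being independent of the source.\<close>

definition source_reconstruction ::
    "(nat \<Rightarrow> 'u::countable) measure \<Rightarrow> ('x, 's, 'y) fs_channel \<Rightarrow> 's pmf \<Rightarrow> ('y \<Rightarrow> 'z) \<Rightarrow> nat
       \<Rightarrow> ('u list \<Rightarrow> 'z list \<Rightarrow> 'x) \<Rightarrow> ('y list \<Rightarrow> 'v list) \<Rightarrow> ('u list \<times> 'v list) pmf" where
  "source_reconstruction \<mu> K p\<^sub>0 z N f g =
     bind_pmf (source_block \<mu> N) (\<lambda>us.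
     bind_pmf p\<^sub>0 (\<lambda>s\<^sub>0.
     map_pmf (\<lambda>ys. (us, g ys)) (channel_output K z (f us) s\<^sub>0 N)))"

definition fidelity_attainable ::
    "(nat \<Rightarrow> 'u::countable) measure \<Rightarrow> ('u \<Rightarrow> 'v \<Rightarrow> real) \<Rightarrow> ('x, 's, 'y) fs_channel
       \<Rightarrow> 's pmf \<Rightarrow> ('y \<Rightarrow> 'z) \<Rightarrow> real \<Rightarrow> bool" where
  "fidelity_attainable \<mu> d K p\<^sub>0 z D \<longleftrightarrow>
     (\<forall>\<^sub>F N in sequentially. \<exists>f g.
        (\<forall>ys. length ys = N \<longrightarrow> length (g ys) = N) \<and>
        block_distortion d N (source_reconstruction \<mu> K p\<^sub>0 z N f g) \<le> D)"

end

theory Submission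
  imports Defs
begin

text \<open>
  Direct part.  A channel code of rate \<open>R\<close> carries the index of a source codeword, so what is needed is a
  source code with at most \<open>2 powr (N * R)\<close> codewords.  Take a block length \<open>k\<close> and a test channel of
  information less than \<open>k * R\<close>, and apply it independently to disjoint \<open>k\<close>-blocks of the source.  The
  \<open>k\<close>-step shift need not be ergodic; therefore the blocks are laid out so that all phases modulo \<open>k\<close> occur
  equally often, and the average over the phases is invariant under the one-step shift.  With Birkhoff's
  theorem for the \<open>k\<close>-step shift this gives the law of large numbers for the information density and for the
  distortion, and random codewords drawn from the product of the output laws cover almost every source
  block.  If \<open>D\<close> exceeds the minimal distortion, then one extra letter per \<open>m * k\<close> letters, reproduced almost
  optimally with finitely many values, makes the distortion strictly smaller than \<open>D\<close> at an increase of the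
  rate that vanishes for large \<open>m\<close>.

  Converse.  Under a code the channel input is a function of the source block and the outputs.  Hence
  \<open>I(U\<^sup>N; Y\<^sup>N)\<close> equals the directed information of the causal input law induced by the code: both are the
  expectation of \<open>log (P(y \<parallel> x) / P(y))\<close>.  Data processing then bounds the block rate distortion function
  by the maximal directed information.
\<close>

section \<open>Information densities of discrete pairs\<close>

lemma sum_lessThan_add:
  fixes f :: "nat \<Rightarrow> 'a::comm_monoid_add"
  shows "(\<Sum>i<m + n. f i) = (\<Sum>i<m. f i) + (\<Sum>i<n. f (m + i))"
  by (induction n) (auto simp: add.assoc)

lemma pair_measure_pmf:
  fixes p :: "'a::countable pmf" and q :: "'b::countable pmf"
  shows "measure_pmf p \<Otimes>\<^sub>M measure_pmf q = measure_pmf (pair_pmf p q)"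
proof (rule measure_eqI_countable[where A = UNIV])
  have "sets (measure_pmf p \<Otimes>\<^sub>M measure_pmf q) = sets (count_space UNIV \<Otimes>\<^sub>M count_space UNIV)"
    by (rule sets_pair_measure_cong) auto
  also have "\<dots> = UNIV" by (subst pair_measure_countable) auto
  finally show "sets (measure_pmf p \<Otimes>\<^sub>M measure_pmf q) = Pow UNIV" by simp
  fix x :: "'a \<times> 'b"
  have "emeasure (measure_pmf p \<Otimes>\<^sub>M measure_pmf q) ({fst x} \<times> {snd x}) =
      emeasure p {fst x} * emeasure q {snd x}"
    by (intro measure_pmf.emeasure_pair_measure_Times) auto
  then show "emeasure (measure_pmf p \<Otimes>\<^sub>M measure_pmf q) {x} = emeasure (pair_pmf p q) {x}"
    by (cases x) (simp add: emeasure_pmf_single pmf_pair ennreal_mult)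
qed auto

lemma pmf_pair_eq: "pmf (pair_pmf p q) x = pmf p (fst x) * pmf q (snd x)"
  by (cases x) (simp add: pmf_pair)

lemma nn_integral_pmf_ratio:
  "(\<integral>\<^sup>+x. h x * ennreal (pmf q x / pmf p x) \<partial>measure_pmf p) \<le> (\<integral>\<^sup>+x. h x \<partial>measure_pmf q)"
proof -
  have "(\<integral>\<^sup>+x. h x * ennreal (pmf q x / pmf p x) \<partial>measure_pmf p) =
      (\<integral>\<^sup>+x. ennreal (pmf p x) * (h x * ennreal (pmf q x / pmf p x)) \<partial>count_space UNIV)"
    by (simp add: nn_integral_measure_pmf)
  also have "\<dots> \<le> (\<integral>\<^sup>+x. ennreal (pmf q x) * h x \<partial>count_space UNIV)"
  proof (rule nn_integral_mono)
    fix x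
    show "ennreal (pmf p x) * (h x * ennreal (pmf q x / pmf p x)) \<le> ennreal (pmf q x) * h x"
    proof (cases "pmf p x = 0")
      case False
      then have "ennreal (pmf q x) = ennreal (pmf p x) * ennreal (pmf q x / pmf p x)"
        by (simp add: ennreal_mult[symmetric])
      then show ?thesis by (simp add: ac_simps)
    qed simp
  qed
  also have "\<dots> = (\<integral>\<^sup>+x. h x \<partial>measure_pmf q)"
    by (simp add: nn_integral_measure_pmf)
  finally show ?thesis .
qed

lemma nn_integral_pmf_ratio_le_1:
  "(\<integral>\<^sup>+x. ennreal (pmf q x / pmf p x) \<partial>measure_pmf p) \<le> 1"
  using nn_integral_pmf_ratio[where h = "\<lambda>_. 1"] by simp

lemma entropy_density_pmf:
  fixes p q :: "'a pmf"
  assumes "set_pmf p \<subseteq> set_pmf q"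
  shows "AE x in measure_pmf p. entropy_density 2 (measure_pmf q) (measure_pmf p) x = log 2 (pmf p x / pmf q x)"
proof -
  have "density (measure_pmf q) (\<lambda>x. ennreal (pmf p x / pmf q x)) = measure_pmf p"
  proof (rule measure_eqI)
    fix A
    have "emeasure (density (measure_pmf q) (\<lambda>x. ennreal (pmf p x / pmf q x))) A =
        (\<integral>\<^sup>+x. ennreal (pmf p x / pmf q x) * indicator A x \<partial>measure_pmf q)"
      by (rule emeasure_density) auto
    also have "\<dots> = (\<integral>\<^sup>+x. ennreal (pmf q x) * (ennreal (pmf p x / pmf q x) * indicator A x) \<partial>count_space UNIV)"
      by (simp add: nn_integral_measure_pmf)
    also have "\<dots> = (\<integral>\<^sup>+x. ennreal (pmf p x) * indicator A x \<partial>count_space UNIV)"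
    proof (rule nn_integral_cong)
      fix x
      have "pmf q x = 0 \<Longrightarrow> pmf p x = 0" using assms by (auto simp: pmf_eq_0_set_pmf)
      then have "ennreal (pmf q x) * ennreal (pmf p x / pmf q x) = ennreal (pmf p x)"
        by (cases "pmf q x = 0") (auto simp: ennreal_mult[symmetric])
      then show "ennreal (pmf q x) * (ennreal (pmf p x / pmf q x) * indicator A x) = ennreal (pmf p x) * indicator A x"
        by (simp add: mult.assoc[symmetric])
    qed
    also have "\<dots> = emeasure (measure_pmf p) A"
      by (simp flip: nn_integral_measure_pmf)
    finally show "emeasure (density (measure_pmf q) (\<lambda>x. ennreal (pmf p x / pmf q x))) A = emeasure (measure_pmf p) A" .
  qed simp
  then have "AE x in measure_pmf q. ennreal (pmf p x / pmf q x) = RN_deriv (measure_pmf q) (measure_pmf p) x"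
    by (intro measure_pmf.RN_deriv_unique) auto
  then have "RN_deriv (measure_pmf q) (measure_pmf p) x = ennreal (pmf p x / pmf q x)" if "x \<in> set_pmf p" for x
    using that assms by (auto simp: AE_measure_pmf_iff)
  then show ?thesis by (simp add: AE_measure_pmf_iff entropy_density_def)
qed

definition info_density :: "('a \<times> 'b) pmf \<Rightarrow> 'a \<times> 'b \<Rightarrow> real" where
  "info_density p = (\<lambda>x. log 2 (pmf p x / (pmf (map_pmf fst p) (fst x) * pmf (map_pmf snd p) (snd x))))"

lemma set_pmf_pair_marginals:
  "set_pmf p \<subseteq> set_pmf (pair_pmf (map_pmf fst p) (map_pmf snd p))"
  by force

lemma entropy_density_pair:
  fixes p :: "('a::countable \<times> 'b::countable) pmf"
  shows "AE x in measure_pmf p. entropy_density 2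
    (measure_pmf (map_pmf fst p) \<Otimes>\<^sub>M measure_pmf (map_pmf snd p)) (measure_pmf p) x = info_density p x"
  using entropy_density_pmf[OF set_pmf_pair_marginals[of p]]
  by (simp add: pair_measure_pmf info_density_def pmf_pair_eq)

lemma mutual_information_pmf:
  fixes X :: "'w \<Rightarrow> 'a::countable" and Y :: "'w \<Rightarrow> 'b::countable"
  shows "prob_space.mutual_information (measure_pmf p) 2 (count_space UNIV) (count_space UNIV) X Y =
    (\<integral>x. info_density (map_pmf (\<lambda>x. (X x, Y x)) p) (X x, Y x) \<partial>measure_pmf p)"
proof -
  let ?q = "map_pmf (\<lambda>x. (X x, Y x)) p"
  have m: "distr (measure_pmf p) (count_space UNIV) X = measure_pmf (map_pmf fst ?q)"
     "distr (measure_pmf p) (count_space UNIV) Y = measure_pmf (map_pmf snd ?q)"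
     "distr (measure_pmf p) (count_space UNIV \<Otimes>\<^sub>M count_space UNIV) (\<lambda>x. (X x, Y x)) = measure_pmf ?q"
    by (simp_all add: map_pmf_rep_eq pmf.map_comp comp_def pair_measure_countable)
  show ?thesis
    unfolding prob_space.mutual_information_def[OF measure_pmf.prob_space_axioms] m KL_divergence_def
    by (subst integral_cong_AE[OF _ _ entropy_density_pair]) auto
qed

lemma pair_mutual_information_eq:
  "pair_mutual_information p = (if integrable (measure_pmf p) (info_density p)
     then ereal (measure_pmf.expectation p (info_density p)) else \<infinity>)"
proof -
  have "integrable (measure_pmf p)
           (entropy_density 2 (measure_pmf (map_pmf fst p) \<Otimes>\<^sub>M measure_pmf (map_pmf snd p))
              (measure_pmf p)) \<longleftrightarrow> integrable (measure_pmf p) (info_density p)"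
    by (rule integrable_cong_AE[OF _ _ entropy_density_pair]) auto
  then show ?thesis
    by (simp add: pair_mutual_information_def mutual_information_pmf[of p fst snd])
qed

lemma neg_log2_le:
  fixes r :: real assumes "r > 0"
  shows "- log 2 r \<le> (1 / r - 1) / ln 2"
proof -
  have "- ln r / ln 2 \<le> (1 / r - 1) / ln 2"
    using ln_le_minus_one[of "1 / r"] assms by (intro divide_right_mono) (auto simp: ln_div)
  then show ?thesis by (simp add: log_def)
qed

lemma integrable_neg_part_log:
  assumes "\<And>x. x \<in> set_pmf p \<Longrightarrow> r x > 0" and "(\<integral>\<^sup>+x. ennreal (1 / r x) \<partial>measure_pmf p) \<le> 1"
  shows "integrable (measure_pmf p) (\<lambda>x. max 0 (- log 2 (r x)))"
    and "integrable (measure_pmf p) (\<lambda>x. 1 / r x)" and "measure_pmf.expectation p (\<lambda>x. 1 / r x) \<le> 1"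
proof -
  have "(\<integral>\<^sup>+x. ennreal (1 / r x) \<partial>measure_pmf p) < \<infinity>"
    using assms(2) by (rule le_less_trans) simp
  then show i: "integrable (measure_pmf p) (\<lambda>x. 1 / r x)"
    by (intro integrableI_nonneg) (auto simp: AE_measure_pmf_iff intro!: less_imp_le assms)
  have "ennreal (measure_pmf.expectation p (\<lambda>x. 1 / r x)) = (\<integral>\<^sup>+x. ennreal (1 / r x) \<partial>measure_pmf p)"
    using i by (intro nn_integral_eq_integral[symmetric]) (auto simp: AE_measure_pmf_iff intro!: less_imp_le assms)
  also note assms(2)
  finally show "measure_pmf.expectation p (\<lambda>x. 1 / r x) \<le> 1" by simp
  have b: "max 0 (- log 2 (r x)) \<le> (1 / r x) / ln 2" if "x \<in> set_pmf p" for x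
  proof -
    have "(1 / r x - 1) / ln 2 \<le> (1 / r x) / ln 2" by (intro divide_right_mono) auto
    then show ?thesis using neg_log2_le[OF assms(1)[OF that]] assms(1)[OF that] by auto
  qed
  show "integrable (measure_pmf p) (\<lambda>x. max 0 (- log 2 (r x)))"
  proof (rule Bochner_Integration.integrable_bound[OF integrable_divide[OF i, of "ln 2"]])
    show "AE x in measure_pmf p. norm (max 0 (- log 2 (r x))) \<le> norm (1 / r x / ln 2)"
      unfolding AE_measure_pmf_iff real_norm_def
    proof
      fix x assume "x \<in> set_pmf p"
      from b[OF this] show "\<bar>max 0 (- log 2 (r x))\<bar> \<le> \<bar>1 / r x / ln 2\<bar>" by linarith
    qed
  qed auto
qed

lemma expectation_log_nonneg:
  assumes "\<And>x. x \<in> set_pmf p \<Longrightarrow> r x > 0" and "(\<integral>\<^sup>+x. ennreal (1 / r x) \<partial>measure_pmf p) \<le> 1"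
    and "integrable (measure_pmf p) (\<lambda>x. log 2 (r x))"
  shows "measure_pmf.expectation p (\<lambda>x. log 2 (r x)) \<ge> 0"
proof -
  note i = integrable_neg_part_log[OF assms(1,2)]
  have "0 \<le> (1 - measure_pmf.expectation p (\<lambda>x. 1 / r x)) / ln 2"
    using i(3) by simp
  also have "\<dots> = measure_pmf.expectation p (\<lambda>x. (1 - 1 / r x) / ln 2)"
    using i(2) by simp
  also have "\<dots> \<le> measure_pmf.expectation p (\<lambda>x. log 2 (r x))"
  proof (rule integral_mono_AE)
    show "AE x in measure_pmf p. (1 - 1 / r x) / ln 2 \<le> log 2 (r x)"
      using neg_log2_le[OF assms(1)] by (auto simp: AE_measure_pmf_iff diff_divide_distrib) (smt (verit))
  qed (use i assms in auto)
  finally show ?thesis .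
qed

lemma info_ratio_pos:
  "x \<in> set_pmf p \<Longrightarrow> pmf p x / (pmf (map_pmf fst p) (fst x) * pmf (map_pmf snd p) (snd x)) > 0"
  by (auto intro!: divide_pos_pos mult_pos_pos simp: pmf_positive_iff)

lemma info_ratio_le_1:
  "(\<integral>\<^sup>+x. ennreal (1 / (pmf p x / (pmf (map_pmf fst p) (fst x) * pmf (map_pmf snd p) (snd x)))) \<partial>measure_pmf p) \<le> 1"
  using nn_integral_pmf_ratio_le_1[where p = p and q = "pair_pmf (map_pmf fst p) (map_pmf snd p)"]
  by (simp add: pmf_pair_eq)

lemma info_density_neg_part: "integrable (measure_pmf p) (\<lambda>x. max 0 (- info_density p x))"
  unfolding info_density_def by (rule integrable_neg_part_log(1)[OF info_ratio_pos info_ratio_le_1])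

lemma info_density_nonneg:
  "integrable (measure_pmf p) (info_density p) \<Longrightarrow> measure_pmf.expectation p (info_density p) \<ge> 0"
  unfolding info_density_def by (rule expectation_log_nonneg[OF info_ratio_pos info_ratio_le_1])

lemma pair_mutual_information_nonneg: "0 \<le> pair_mutual_information p"
  by (auto simp: pair_mutual_information_eq info_density_nonneg)

lemma integrable_info_densityI:
  assumes "integrable (measure_pmf p) g" and "\<And>x. x \<in> set_pmf p \<Longrightarrow> info_density p x \<le> g x"
  shows "integrable (measure_pmf p) (info_density p)"
proof (rule Bochner_Integration.integrable_bound)
  show "integrable (measure_pmf p) (\<lambda>x. \<bar>g x\<bar> + max 0 (- info_density p x))"
    using assms(1) info_density_neg_part[of p] by (intro Bochner_Integration.integrable_add) auto
  show "AE x in measure_pmf p. norm (info_density p x) \<le> norm (\<bar>g x\<bar> + max 0 (- info_density p x))"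
    using assms(2) by (force simp: AE_measure_pmf_iff)
qed auto

text \<open>Gibbs' inequality; \<open>r\<close> is the ratio of the true output law to the one used in \<open>j\<close>.\<close>

lemma pair_mutual_information_le:
  assumes j: "integrable (measure_pmf p) j"
    and eq: "\<And>x. x \<in> set_pmf p \<Longrightarrow> j x = info_density p x + log 2 (r x)"
    and r: "\<And>x. x \<in> set_pmf p \<Longrightarrow> r x > 0" "(\<integral>\<^sup>+x. ennreal (1 / r x) \<partial>measure_pmf p) \<le> 1"
  shows "pair_mutual_information p \<le> ereal (measure_pmf.expectation p j)"
proof -
  have i: "integrable (measure_pmf p) (info_density p)"
  proof (rule integrable_info_densityI)
    show "integrable (measure_pmf p) (\<lambda>x. j x + max 0 (- log 2 (r x)))"
      using j integrable_neg_part_log(1)[OF r] by auto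
  qed (use eq in auto)
  have l: "integrable (measure_pmf p) (\<lambda>x. log 2 (r x))"
    by (rule integrable_cong_AE_imp[OF Bochner_Integration.integrable_diff[OF j i]])
       (auto simp: AE_measure_pmf_iff eq)
  have "measure_pmf.expectation p j = measure_pmf.expectation p (\<lambda>x. info_density p x + log 2 (r x))"
    by (intro integral_cong_AE) (auto simp: AE_measure_pmf_iff eq)
  also have "\<dots> = measure_pmf.expectation p (info_density p) + measure_pmf.expectation p (\<lambda>x. log 2 (r x))"
    using i l by simp
  also have "\<dots> \<ge> measure_pmf.expectation p (info_density p)"
    using expectation_log_nonneg[OF r l] by simp
  finally show ?thesis using i by (simp add: pair_mutual_information_eq)
qed

lemma data_processing:
  "pair_mutual_information (map_pmf (\<lambda>(u, v). (f u, g v)) p) \<le> pair_mutual_information p"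
proof (cases "integrable (measure_pmf p) (info_density p)")
  case True
  let ?h = "\<lambda>(u, v). (f u, g v)"
  define p' where "p' = map_pmf ?h p"
  define p1 p2 p1' p2' where "p1 = map_pmf fst p" "p2 = map_pmf snd p" "p1' = map_pmf fst p'" "p2' = map_pmf snd p'"
  note defs = p1_p2_p1'_p2'_def
  have m: "p1' = map_pmf f p1" "p2' = map_pmf g p2"
    by (simp_all add: defs p'_def pmf.map_comp comp_def split_beta)
  define R where "R x = pmf p x / (pmf p1 (fst x) * pmf p2 (snd x))" for x
  define R' where "R' y = pmf p' y / (pmf p1' (fst y) * pmf p2' (snd y))" for y
  have Rpos: "R x > 0" "R' (?h x) > 0" if "x \<in> set_pmf p" for x
    using info_ratio_pos[OF that] info_ratio_pos[of "?h x" p'] that by (auto simp: R_def R'_def defs p'_def)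
  have "(\<integral>\<^sup>+x. ennreal (1 / (R x / R' (?h x))) \<partial>measure_pmf p) =
      (\<integral>\<^sup>+x. ennreal (R' (?h x)) * ennreal (pmf (pair_pmf p1 p2) x / pmf p x) \<partial>measure_pmf p)"
    by (intro nn_integral_cong) (auto simp: R_def R'_def pmf_pair split_beta mult_ac simp flip: ennreal_mult')
  also have "\<dots> \<le> (\<integral>\<^sup>+x. ennreal (R' (?h x)) \<partial>measure_pmf (pair_pmf p1 p2))"
    by (rule nn_integral_pmf_ratio)
  also have "\<dots> = (\<integral>\<^sup>+y. ennreal (R' y) \<partial>measure_pmf (map_pmf ?h (pair_pmf p1 p2)))"
    by simp
  also have "\<dots> = (\<integral>\<^sup>+y. ennreal (pmf p' y / pmf (pair_pmf p1' p2') y) \<partial>measure_pmf (pair_pmf p1' p2'))"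
    by (intro nn_integral_cong_simp arg_cong2[where f = nn_integral])
       (auto simp: map_pair m R'_def pmf_pair fun_eq_iff)
  also have "\<dots> \<le> 1" by (rule nn_integral_pmf_ratio_le_1)
  finally have r: "(\<integral>\<^sup>+x. ennreal (1 / (R x / R' (?h x))) \<partial>measure_pmf p) \<le> 1" .
  note r = Rpos r
  have dens: "info_density p x = log 2 (R x)" "info_density p' y = log 2 (R' y)" for x y
    by (simp_all add: info_density_def R_def R'_def defs)
  have eq: "info_density p x = info_density p' (?h x) + log 2 (R x / R' (?h x))" if "x \<in> set_pmf p" for x
    using Rpos[OF that] by (simp add: dens log_divide)
  have int: "integrable (measure_pmf p) (\<lambda>x. log 2 (R x) + max 0 (- log 2 (R x / R' (?h x))))"
    using True integrable_neg_part_log(1)[of p "\<lambda>x. R x / R' (?h x)"] r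
    by (intro Bochner_Integration.integrable_add) (auto simp: dens[abs_def])
  have i': "integrable (measure_pmf p) (\<lambda>x. info_density p' (?h x))"
  proof (rule Bochner_Integration.integrable_bound)
    show "integrable (measure_pmf p) (\<lambda>x. \<bar>log 2 (R x) + max 0 (- log 2 (R x / R' (?h x)))\<bar> + max 0 (- info_density p' (?h x)))"
      using int info_density_neg_part[of p'] by (auto simp: p'_def)
    show "AE x in measure_pmf p. norm (info_density p' (?h x)) \<le>
       norm (\<bar>log 2 (R x) + max 0 (- log 2 (R x / R' (?h x)))\<bar> + max 0 (- info_density p' (?h x)))"
      using eq by (force simp: AE_measure_pmf_iff dens)
  qed auto
  have l: "integrable (measure_pmf p) (\<lambda>x. log 2 (R x / R' (?h x)))"
    by (rule integrable_cong_AE_imp[OF Bochner_Integration.integrable_diff[OF True i']])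
       (auto simp: AE_measure_pmf_iff eq)
  have "measure_pmf.expectation p (info_density p) =
      measure_pmf.expectation p (\<lambda>x. info_density p' (?h x) + log 2 (R x / R' (?h x)))"
    by (intro integral_cong_AE) (auto simp: AE_measure_pmf_iff eq)
  also have "\<dots> = measure_pmf.expectation p (\<lambda>x. info_density p' (?h x)) +
      measure_pmf.expectation p (\<lambda>x. log 2 (R x / R' (?h x)))"
    using i' l by (rule Bochner_Integration.integral_add)
  also have "\<dots> \<ge> measure_pmf.expectation p (\<lambda>x. info_density p' (?h x))"
    using expectation_log_nonneg[of p "\<lambda>x. R x / R' (?h x)"] l r by simp
  finally show ?thesis
    using True i' by (simp add: pair_mutual_information_eq flip: p'_def) (simp add: p'_def)
qed (simp add: pair_mutual_information_eq)

section \<open>Subadditivity of the block rate distortion function\<close>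

lemma pmf_bind_map_Pair:
  "pmf (bind_pmf P (\<lambda>u. map_pmf (Pair u) (W u))) (u, v) = pmf P u * pmf (W u) v"
proof -
  have "pmf (map_pmf (Pair a) (W a)) (u, v) = (if a = u then pmf (W u) v else 0)" for a
    by (auto simp: pmf_map_inj' inj_on_def pmf_eq_0_set_pmf)
  then have "pmf (bind_pmf P (\<lambda>u. map_pmf (Pair u) (W u))) (u, v) =
      measure_pmf.expectation P (\<lambda>a. if a = u then pmf (W u) v else 0)"
    by (simp add: pmf_bind)
  also have "\<dots> = (\<Sum>a\<in>{u}. pmf P a *\<^sub>R (if a = u then pmf (W u) v else 0))"
    by (rule integral_measure_pmf) (auto split: if_splits)
  finally show ?thesis by simp
qed

lemma map_fst_bind_map_Pair: "map_pmf fst (bind_pmf P (\<lambda>u. map_pmf (Pair u) (W u))) = P"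
  by (simp add: map_bind_pmf pmf.map_comp comp_def map_pmf_const bind_return_pmf')

lemma disintegrate_pmf:
  obtains W where "bind_pmf (map_pmf fst p) (\<lambda>u. map_pmf (Pair u) (W u)) = p"
    and "\<And>u. set_pmf (W u) \<subseteq> snd ` set_pmf p"
proof
  define W where "W u = (if u \<in> fst ` set_pmf p then map_pmf snd (cond_pmf p {x. fst x = u}) else map_pmf snd p)" for u
  show "set_pmf (W u) \<subseteq> snd ` set_pmf p" for u
  proof (cases "u \<in> fst ` set_pmf p")
    case True
    then have "set_pmf p \<inter> {x. fst x = u} \<noteq> {}" by auto
    from set_cond_pmf[OF this] True show ?thesis by (auto simp: W_def)
  qed (auto simp: W_def)
  show "bind_pmf (map_pmf fst p) (\<lambda>u. map_pmf (Pair u) (W u)) = p"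
  proof (rule pmf_eqI)
    fix x :: "'a \<times> 'b"
    obtain u v where x: "x = (u, v)" by (cases x)
    show "pmf (bind_pmf (map_pmf fst p) (\<lambda>u. map_pmf (Pair u) (W u))) x = pmf p x"
    proof (cases "u \<in> fst ` set_pmf p")
      case False
      then have "pmf (map_pmf fst p) u = 0" "pmf p x = 0"
        by (force simp: x pmf_eq_0_set_pmf)+
      then show ?thesis by (simp add: x pmf_bind_map_Pair)
    next
      case True
      then have ne: "set_pmf p \<inter> {x. fst x = u} \<noteq> {}" by auto
      let ?c = "cond_pmf p {x. fst x = u}"
      have "pmf (map_pmf snd ?c) v = measure_pmf.prob ?c (snd -` {v})" by (simp add: pmf_map)
      also have "\<dots> = measure_pmf.prob ?c {x}"
        by (intro measure_pmf.finite_measure_eq_AE) (auto simp: AE_measure_pmf_iff set_cond_pmf[OF ne] x)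
      also have "\<dots> = pmf p x / measure_pmf.prob p {x. fst x = u}"
        by (simp add: measure_pmf_single pmf_cond[OF ne] x)
      finally have 1: "pmf (map_pmf snd ?c) v = pmf p x / measure_pmf.prob p {x. fst x = u}" .
      have 2: "pmf (map_pmf fst p) u = measure_pmf.prob p {x. fst x = u}"
        by (simp add: pmf_map vimage_def)
      have "measure_pmf.prob p {x. fst x = u} \<noteq> 0"
        by (rule measure_measure_pmf_not_zero[OF ne])
      then show ?thesis using True by (simp add: x pmf_bind_map_Pair W_def 1[unfolded x] 2)
    qed
  qed
qed

lemma fekete:
  fixes a :: "nat \<Rightarrow> real"
  assumes nonneg: "\<And>n. 0 \<le> a n" and sub: "\<And>m n. m \<ge> 1 \<Longrightarrow> n \<ge> 1 \<Longrightarrow> a (m + n) \<le> a m + a n"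
  shows "convergent (\<lambda>n. a n / real n)"
proof -
  define L where "L = (INF n\<in>{1..}. a n / real n)"
  have bdd: "bdd_below ((\<lambda>n. a n / real n) ` {1..})"
    by (rule bdd_belowI[of _ 0]) (use nonneg in auto)
  have mult: "a (q * k + s) \<le> real q * a k + a s" if "k \<ge> 1" "s \<ge> 1" for q k s
  proof (induction q)
    case (Suc q)
    have "a (Suc q * k + s) = a (k + (q * k + s))" by (simp add: ac_simps)
    also have "\<dots> \<le> a k + a (q * k + s)" using that by (intro sub) auto
    finally show ?case using Suc by (simp add: algebra_simps)
  qed simp
  have "(\<lambda>n. a n / real n) \<longlonglongrightarrow> L"
  proof (rule LIMSEQ_I)
    fix e :: real assume e: "e > 0"
    have "L < L + e / 2" using e by simp
    then obtain k where k: "k \<ge> 1" "a k / real k < L + e / 2"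
      using cINF_less_iff[OF _ bdd, of "L + e / 2"] by (auto simp: L_def)
    define A where "A = Max (a ` {1..k})"
    have A: "a s \<le> A" if "1 \<le> s" "s \<le> k" for s unfolding A_def using that by (intro Max_ge) auto
    have A0: "A \<ge> 0" using A[of 1] k nonneg[of 1] by auto
    obtain n0 :: nat where n0: "n0 > 2 * A / e" using reals_Archimedean2 by blast
    have "norm (a n / real n - L) < e" if n: "n \<ge> max 1 n0" for n
    proof -
      have lo: "L \<le> a n / real n" unfolding L_def using n by (intro cINF_lower[OF bdd]) auto
      define q s where "q = (n - 1) div k" "s = (n - 1) mod k + 1"
      have "(n - 1) div k * k + (n - 1) mod k = n - 1" by simp
      then have ns: "n = q * k + s" unfolding q_s_def using n by linarith
      have s: "1 \<le> s" "s \<le> k" using k by (auto simp: q_s_def less_eq_Suc_le[symmetric])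
      have ak: "a k \<le> (L + e/2) * real k" using k by (simp add: divide_less_eq)
      have "L \<ge> 0" unfolding L_def by (rule cINF_greatest) (use nonneg in auto)
      have "a n \<le> real q * a k + A" using mult[OF k(1) s(1), of q] A[OF s] ns by simp
      also have "real q * a k \<le> real q * ((L + e/2) * real k)" using ak by (intro mult_left_mono) auto
      also have "\<dots> \<le> (L + e/2) * real n" using ns \<open>L \<ge> 0\<close> e by (simp add: algebra_simps)
      finally have "a n \<le> (L + e/2) * real n + A" by simp
      moreover have "A < e / 2 * real n"
      proof -
        have "2 * A / e < real n" using n0 n by simp
        then show ?thesis using e by (simp add: field_simps)
      qed
      ultimately have "a n < (L + e) * real n" by (simp add: algebra_simps)
      then have "a n / real n < L + e" using n by (simp add: divide_less_eq)
      then show ?thesis using lo by simp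
    qed
    then show "\<exists>no. \<forall>n\<ge>no. norm (a n / real n - L) < e" by blast
  qed
  then show ?thesis by (rule convergentI)
qed

lemma fekete_ereal:
  fixes a :: "nat \<Rightarrow> ereal"
  assumes nonneg: "\<And>n. 0 \<le> a n" and sub: "\<And>m n. m \<ge> 1 \<Longrightarrow> n \<ge> 1 \<Longrightarrow> a (m + n) \<le> a m + a n"
    and one: "\<And>n. n \<ge> 1 \<Longrightarrow> a 1 \<le> a n"
  shows "convergent (\<lambda>n. a n / ereal (real n))"
proof (cases "a 1 = \<infinity>")
  case True
  have "a n / ereal (real n) = \<infinity>" if "n \<ge> 1" for n
    using one[OF that] True that by auto
  then have "(\<lambda>n. a n / ereal (real n)) \<longlonglongrightarrow> \<infinity>"
    by (intro tendsto_eventually eventually_sequentiallyI[of 1]) auto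
  then show ?thesis by (rule convergentI)
next
  case False
  have fin: "a n \<noteq> \<infinity>" if "n \<ge> 1" for n using that
  proof (induction n rule: nat_induct_at_least)
    case (Suc n)
    have "a (n + 1) \<le> a n + a 1" using Suc by (intro sub) auto
    then show ?case using Suc False by auto
  qed (use False in auto)
  define b where "b n = (if n = 0 then 0 else real_of_ereal (a n))" for n
  have ab: "a n = ereal (b n)" if "n \<ge> 1" for n
    using fin[OF that] nonneg[of n] that by (cases "a n") (auto simp: b_def)
  have "convergent (\<lambda>n. b n / real n)"
  proof (rule fekete)
    show "0 \<le> b n" for n using nonneg[of n] by (auto simp: b_def real_of_ereal_pos)
    show "b (m + n) \<le> b m + b n" if "m \<ge> 1" "n \<ge> 1" for m n
      using sub[OF that] that by (simp add: ab)
  qed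
  then obtain L where "(\<lambda>n. b n / real n) \<longlonglongrightarrow> L" by (auto simp: convergent_def)
  then have "(\<lambda>n. ereal (b n / real n)) \<longlonglongrightarrow> ereal L" by simp
  moreover have "\<forall>\<^sub>F n in sequentially. ereal (b n / real n) = a n / ereal (real n)"
    by (intro eventually_sequentiallyI[of 1]) (auto simp: ab)
  ultimately have "(\<lambda>n. a n / ereal (real n)) \<longlonglongrightarrow> ereal L"
    by (rule Lim_transform_eventually)
  then show ?thesis by (rule convergentI)
qed

lemma seq_shift_funpow: "(seq_shift ^^ k) \<omega> = (\<lambda>i. \<omega> (i + k))"
  by (induction k) (auto simp: seq_shift_def)

lemma measurable_seq_shift [measurable]: "seq_shift \<in> measurable seq_space (seq_space :: (nat \<Rightarrow> 'u) measure)"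
  unfolding seq_shift_def[abs_def] by (rule measurable_PiM_single') (auto simp: space_PiM)

lemma measurable_seq_shift_funpow [measurable]:
  "(seq_shift ^^ k) \<in> measurable seq_space (seq_space :: (nat \<Rightarrow> 'u) measure)"
  by (induction k) (auto intro: measurable_comp)

locale stationary_source = prob_space \<mu> for \<mu> :: "(nat \<Rightarrow> 'u::countable) measure" +
  assumes sets_mu [measurable_cong]: "sets \<mu> = sets seq_space"
    and stationary: "distr \<mu> seq_space seq_shift = \<mu>"
begin

lemma space_mu [simp]: "space \<mu> = UNIV"
  using sets_eq_imp_space_eq[OF sets_mu] by (simp add: space_PiM)

lemma prob_UNIV [simp]: "prob UNIV = 1"
  using prob_space by simp

lemma stationary_funpow: "distr \<mu> seq_space (seq_shift ^^ k) = \<mu>"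
proof (induction k)
  case 0
  have "distr \<mu> seq_space (\<lambda>x. x) = \<mu>" by (rule distr_id2) (simp add: sets_mu)
  then show ?case by (simp add: id_def)
next
  case (Suc k)
  have "distr \<mu> seq_space (seq_shift ^^ Suc k) = distr (distr \<mu> seq_space (seq_shift ^^ k)) seq_space seq_shift"
    by (subst distr_distr) auto
  with Suc stationary show ?case by (simp add: comp_def)
qed

lemma measure_pmf_source_block:
  "measure_pmf (source_block \<mu> N) = distr \<mu> (count_space UNIV) (\<lambda>\<omega>. map \<omega> [0..<N])"
proof (rule measure_eqI_countable[where A = UNIV])
  fix us :: "'u list"
  show "emeasure (source_block \<mu> N) {us} = emeasure (distr \<mu> (count_space UNIV) (\<lambda>\<omega>. map \<omega> [0..<N])) {us}"
    by (subst emeasure_distr)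
       (auto simp: emeasure_pmf_single pmf_source_block[OF prob_space_axioms sets_mu] emeasure_eq_measure vimage_def)
qed auto

lemma block_measurable [measurable]: "(\<lambda>\<omega>. map \<omega> [0..<N]) \<in> measurable \<mu> (count_space UNIV)"
  by measurable

lemma block_at_distr:
  "distr \<mu> (count_space UNIV) (\<lambda>\<omega>. map \<omega> [i..<i + n]) = measure_pmf (source_block \<mu> n)"
proof -
  have *: "map \<omega> [i..<i + n] = map ((seq_shift ^^ i) \<omega>) [0..<n]" for \<omega> :: "nat \<Rightarrow> 'u"
    by (simp add: seq_shift_funpow list_eq_iff_nth_eq add.commute)
  have "measure_pmf (source_block \<mu> n) =
      distr (distr \<mu> seq_space (seq_shift ^^ i)) (count_space UNIV) (\<lambda>\<omega>. map \<omega> [0..<n])"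
    by (simp add: stationary_funpow measure_pmf_source_block)
  also have "\<dots> = distr \<mu> (count_space UNIV) (\<lambda>\<omega>. map \<omega> [i..<i + n])"
    by (subst distr_distr) (auto simp: comp_def *)
  finally show ?thesis by simp
qed

lemma map_source_block:
  assumes "i + n \<le> N"
  shows "map_pmf (\<lambda>us. take n (drop i us)) (source_block \<mu> N) = source_block \<mu> n"
proof -
  have *: "take n (drop i (map \<omega> [0..<N])) = map \<omega> [i..<i + n]" for \<omega> :: "nat \<Rightarrow> 'u"
    using assms by (simp add: take_map drop_map)
  have "measure_pmf (map_pmf (\<lambda>us. take n (drop i us)) (source_block \<mu> N)) = measure_pmf (source_block \<mu> n)"
    unfolding map_pmf_rep_eq measure_pmf_source_block[of N]
    by (subst distr_distr) (auto simp: comp_def * block_at_distr)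
  then show ?thesis by (simp add: measure_pmf_inject)
qed

lemma length_source_block: "us \<in> set_pmf (source_block \<mu> N) \<Longrightarrow> length us = N"
proof (rule ccontr)
  assume us: "us \<in> set_pmf (source_block \<mu> N)" "length us \<noteq> N"
  then have "{\<omega>. map \<omega> [0..<N] = us} = {}" by auto
  then have "pmf (source_block \<mu> N) us = 0"
    by (simp add: pmf_source_block[OF prob_space_axioms sets_mu])
  then show False using us by (simp add: set_pmf_iff)
qed

end

definition valid_channel :: "nat \<Rightarrow> ('u list \<Rightarrow> 'v list pmf) \<Rightarrow> bool" where
  "valid_channel N W \<longleftrightarrow> (\<forall>us. \<forall>vs\<in>set_pmf (W us). length vs = N)"

definition total_distortion :: "('u \<Rightarrow> 'v \<Rightarrow> real) \<Rightarrow> nat \<Rightarrow> ('u list \<times> 'v list) pmf \<Rightarrow> real" where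
  "total_distortion d N p = (\<Sum>i<N. measure_pmf.expectation p (\<lambda>(us, vs). d (us ! i) (vs ! i)))"

lemma block_distortion_le_iff: "N \<ge> 1 \<Longrightarrow> block_distortion d N p \<le> D \<longleftrightarrow> total_distortion d N p \<le> real N * D"
  by (simp add: block_distortion_def total_distortion_def field_simps)

definition test_channel_feasible ::
    "(nat \<Rightarrow> 'u::countable) measure \<Rightarrow> ('u \<Rightarrow> 'v::countable \<Rightarrow> real) \<Rightarrow> nat \<Rightarrow> real \<Rightarrow> ereal \<Rightarrow> bool" where
  "test_channel_feasible \<mu> d N T r \<longleftrightarrow> (\<exists>W. valid_channel N W \<and>
     total_distortion d N (test_channel_joint \<mu> N W) \<le> T \<and>
     pair_mutual_information (test_channel_joint \<mu> N W) \<le> r)"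

lemma pmf_test_channel_joint:
  "pmf (test_channel_joint \<mu> N W) (us, vs) = pmf (source_block \<mu> N) us * pmf (W us) vs"
  by (simp add: test_channel_joint_def pmf_bind_map_Pair)

lemma map_fst_test_channel_joint [simp]: "map_pmf fst (test_channel_joint \<mu> N W) = source_block \<mu> N"
  by (simp add: test_channel_joint_def map_fst_bind_map_Pair)

context stationary_source
begin

lemma test_channel_joint_lengths:
  assumes "valid_channel N W" "(us, vs) \<in> set_pmf (test_channel_joint \<mu> N W)"
  shows "length us = N" "length vs = N"
  using assms length_source_block by (auto simp: test_channel_joint_def valid_channel_def)

lemma info_density_test_channel:
  assumes "(us, vs) \<in> set_pmf (test_channel_joint \<mu> N W)"
  shows "info_density (test_channel_joint \<mu> N W) (us, vs) =
    log 2 (pmf (W us) vs / pmf (map_pmf snd (test_channel_joint \<mu> N W)) vs)"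
    "pmf (W us) vs > 0" "pmf (map_pmf snd (test_channel_joint \<mu> N W)) vs > 0"
proof -
  have p: "pmf (test_channel_joint \<mu> N W) (us, vs) > 0" using assms by (simp add: pmf_positive)
  then have *: "pmf (source_block \<mu> N) us > 0" "pmf (W us) vs > 0"
    by (auto simp: pmf_test_channel_joint zero_less_mult_iff less_le)
  then show "info_density (test_channel_joint \<mu> N W) (us, vs) =
    log 2 (pmf (W us) vs / pmf (map_pmf snd (test_channel_joint \<mu> N W)) vs)"
    by (simp add: info_density_def pmf_test_channel_joint)
  show "pmf (W us) vs > 0" by fact
  show "pmf (map_pmf snd (test_channel_joint \<mu> N W)) vs > 0"
    using assms by (force simp: pmf_positive_iff)
qed

lemma test_channel_feasible_add:
  fixes d :: "'u \<Rightarrow> 'v::countable \<Rightarrow> real"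
  assumes 1: "test_channel_feasible \<mu> d M T1 r1" and 2: "test_channel_feasible \<mu> d N T2 r2"
  shows "test_channel_feasible \<mu> d (M + N) (T1 + T2) (r1 + r2)"
proof -
  from 1 obtain W1 where W1: "valid_channel M W1" "total_distortion d M (test_channel_joint \<mu> M W1) \<le> T1"
    "pair_mutual_information (test_channel_joint \<mu> M W1) \<le> r1" by (auto simp: test_channel_feasible_def)
  from 2 obtain W2 where W2: "valid_channel N W2" "total_distortion d N (test_channel_joint \<mu> N W2) \<le> T2"
    "pair_mutual_information (test_channel_joint \<mu> N W2) \<le> r2" by (auto simp: test_channel_feasible_def)
  define W where "W us = map_pmf (\<lambda>(a, b). a @ b) (pair_pmf (W1 (take M us)) (W2 (drop M us)))" for us
  define p where "p = test_channel_joint \<mu> (M + N) W"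
  define p1 where "p1 = test_channel_joint \<mu> M W1"
  define p2 where "p2 = test_channel_joint \<mu> N W2"
  have valid: "valid_channel (M + N) W"
    using W1(1) W2(1) by (auto simp: valid_channel_def W_def)
  define sp where "sp = (\<lambda>vs :: 'v list. (take M vs, drop M vs))"
  have inj_sp: "inj sp" by (rule injI) (metis sp_def append_take_drop_id prod.inject)
  have sp_W: "map_pmf sp (W us) = pair_pmf (W1 (take M us)) (W2 (drop M us))" for us
  proof -
    have "map_pmf sp (W us) = map_pmf (\<lambda>x. x) (pair_pmf (W1 (take M us)) (W2 (drop M us)))"
      unfolding W_def pmf.map_comp using W1(1)
      by (intro map_pmf_cong) (auto simp: sp_def valid_channel_def)
    then show ?thesis by simp
  qed
  have pmf_W: "pmf (W us) vs = pmf (W1 (take M us)) (take M vs) * pmf (W2 (drop M us)) (drop M vs)" for us vs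
  proof -
    have "pmf (W us) vs = pmf (map_pmf sp (W us)) (sp vs)" by (simp add: pmf_map_inj'[OF inj_sp])
    then show ?thesis unfolding sp_W by (simp add: pmf_pair sp_def)
  qed
  have P1: "map_pmf (take M) (source_block \<mu> (M + N)) = source_block \<mu> M"
    using map_source_block[of 0 M "M + N"] by simp
  have P2: "map_pmf (drop M) (source_block \<mu> (M + N)) = source_block \<mu> N"
  proof -
    have "map_pmf (drop M) (source_block \<mu> (M + N)) = map_pmf (\<lambda>us. take N (drop M us)) (source_block \<mu> (M + N))"
      by (intro map_pmf_cong) (auto dest: length_source_block)
    then show ?thesis using map_source_block[of M N "M + N"] by simp
  qed
  have m1: "map_pmf (take M) (W us) = W1 (take M us)" for us
  proof -
    have "map_pmf (take M) (W us) = map_pmf fst (map_pmf sp (W us))"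
      by (simp add: pmf.map_comp comp_def sp_def)
    then show ?thesis by (simp add: sp_W map_fst_pair_pmf)
  qed
  have m2: "map_pmf (drop M) (W us) = W2 (drop M us)" for us
  proof -
    have "map_pmf (drop M) (W us) = map_pmf snd (map_pmf sp (W us))"
      by (simp add: pmf.map_comp comp_def sp_def)
    then show ?thesis by (simp add: sp_W map_snd_pair_pmf)
  qed
  have p1: "map_pmf (\<lambda>(us, vs). (take M us, take M vs)) p = p1"
  proof -
    have "map_pmf (\<lambda>(us, vs). (take M us, take M vs)) p =
        bind_pmf (source_block \<mu> (M + N)) (\<lambda>us. map_pmf (Pair (take M us)) (map_pmf (take M) (W us)))"
      by (simp add: p_def test_channel_joint_def map_bind_pmf pmf.map_comp comp_def)
    also have "\<dots> = bind_pmf (map_pmf (take M) (source_block \<mu> (M + N))) (\<lambda>us. map_pmf (Pair us) (W1 us))"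
      by (simp add: m1 bind_map_pmf)
    finally show ?thesis by (simp add: P1 p1_def test_channel_joint_def)
  qed
  have p2: "map_pmf (\<lambda>(us, vs). (drop M us, drop M vs)) p = p2"
  proof -
    have "map_pmf (\<lambda>(us, vs). (drop M us, drop M vs)) p =
        bind_pmf (source_block \<mu> (M + N)) (\<lambda>us. map_pmf (Pair (drop M us)) (map_pmf (drop M) (W us)))"
      by (simp add: p_def test_channel_joint_def map_bind_pmf pmf.map_comp comp_def)
    also have "\<dots> = bind_pmf (map_pmf (drop M) (source_block \<mu> (M + N))) (\<lambda>us. map_pmf (Pair us) (W2 us))"
      by (simp add: m2 bind_map_pmf)
    finally show ?thesis by (simp add: P2 p2_def test_channel_joint_def)
  qed
  have len: "length us = M + N" "length vs = M + N" if "(us, vs) \<in> set_pmf p" for us vs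
    using test_channel_joint_lengths[OF valid] that by (auto simp: p_def)
  have D1: "measure_pmf.expectation p (\<lambda>(us, vs). d (us ! i) (vs ! i)) =
      measure_pmf.expectation p1 (\<lambda>(us, vs). d (us ! i) (vs ! i))" if "i < M" for i
    using that by (simp add: p1[symmetric] case_prod_unfold)
  have D2: "measure_pmf.expectation p (\<lambda>(us, vs). d (us ! (M + i)) (vs ! (M + i))) =
      measure_pmf.expectation p2 (\<lambda>(us, vs). d (us ! i) (vs ! i))" for i
    unfolding p2[symmetric] integral_map_pmf
    by (intro integral_cong_AE) (auto simp: AE_measure_pmf_iff len)
  have "total_distortion d (M + N) p = total_distortion d M p1 + total_distortion d N p2"
    unfolding total_distortion_def by (simp add: sum_lessThan_add D1 D2)
  then have dist: "total_distortion d (M + N) p \<le> T1 + T2"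
    using W1(2) W2(2) by (simp add: p1_def p2_def)
  have info: "pair_mutual_information p \<le> r1 + r2"
  proof (cases "integrable (measure_pmf p1) (info_density p1) \<and> integrable (measure_pmf p2) (info_density p2)")
    case False
    then have "r1 = \<infinity> \<or> r2 = \<infinity>"
      using W1(3) W2(3) by (auto simp: pair_mutual_information_eq p1_def p2_def)
    moreover have "0 \<le> r1" "0 \<le> r2"
      using W1(3) W2(3) pair_mutual_information_nonneg order.trans by blast+
    ultimately show ?thesis by auto
  next
    case True
    let ?t = "\<lambda>(us, vs). (take M us, take M vs)" and ?d = "\<lambda>(us, vs). (drop M us, drop M vs)"
    define j where "j x = info_density p1 (?t x) + info_density p2 (?d x)" for x
    have int: "integrable (measure_pmf p) (\<lambda>x. info_density p1 (?t x))" "integrable (measure_pmf p) (\<lambda>x. info_density p2 (?d x))"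
      using True by (simp_all add: p1[symmetric] p2[symmetric])
    have E: "measure_pmf.expectation p j = measure_pmf.expectation p1 (info_density p1) + measure_pmf.expectation p2 (info_density p2)"
      unfolding j_def Bochner_Integration.integral_add[OF int]
      by (simp add: p1[symmetric] p2[symmetric])
    define q1 q2 pV where "q1 = map_pmf snd p1" "q2 = map_pmf snd p2" "pV = map_pmf snd p"
    note q_defs = q1_q2_pV_def
    define r where "r x = pmf pV (snd x) / (pmf q1 (take M (snd x)) * pmf q2 (drop M (snd x)))" for x :: "'u list \<times> 'v list"
    have eq_pos: "j x = info_density p x + log 2 (r x) \<and> r x > 0" if x: "x \<in> set_pmf p" for x
    proof -
      obtain us vs where [simp]: "x = (us, vs)" by (cases x)
      have x1: "(take M us, take M vs) \<in> set_pmf p1" and x2: "(drop M us, drop M vs) \<in> set_pmf p2"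
        using x by (auto simp: p1[symmetric] p2[symmetric] image_iff intro!: bexI[of _ x])
      note i = info_density_test_channel[OF x[unfolded \<open>x = _\<close> p_def], folded p_def]
        info_density_test_channel[OF x1[unfolded p1_def], folded p1_def]
        info_density_test_channel[OF x2[unfolded p2_def], folded p2_def]
      from i show ?thesis
        by (simp add: j_def r_def q_defs log_divide log_mult pmf_W)
    qed
    have "(\<integral>\<^sup>+x. ennreal (1 / r x) \<partial>measure_pmf p) =
        (\<integral>\<^sup>+x. ennreal (pmf (pair_pmf q1 q2) (sp (snd x)) / pmf (map_pmf sp pV) (sp (snd x))) \<partial>measure_pmf p)"
      unfolding pmf_map_inj'[OF inj_sp] by (intro nn_integral_cong) (simp add: r_def pmf_pair sp_def)
    also have "\<dots> = (\<integral>\<^sup>+y. ennreal (pmf (pair_pmf q1 q2) y / pmf (map_pmf sp pV) y) \<partial>measure_pmf (map_pmf sp pV))"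
      by (simp add: q_defs)
    also have "\<dots> \<le> 1" by (rule nn_integral_pmf_ratio_le_1)
    finally have "pair_mutual_information p \<le> ereal (measure_pmf.expectation p j)"
      using eq_pos int by (intro pair_mutual_information_le[where r = r]) (auto simp: j_def[abs_def])
    also have "\<dots> = pair_mutual_information p1 + pair_mutual_information p2"
      using True by (simp add: pair_mutual_information_eq E)
    also have "\<dots> \<le> r1 + r2" using W1(3) W2(3) by (simp add: p1_def p2_def add_mono)
    finally show ?thesis .
  qed
  show ?thesis using valid dist info by (auto simp: test_channel_feasible_def p_def)
qed

text \<open>The best letter of the block serves all letters.  Thus the block rate distortion function is finite
  for all block lengths or for none, which Fekete's lemma needs for values in \<open>[0, \<infinity>]\<close>.\<close>

lemma test_channel_feasible_letter:
  assumes k: "k \<ge> 1" and "test_channel_feasible \<mu> d k T r"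
  shows "test_channel_feasible \<mu> d 1 (T / real k) r"
proof -
  from assms(2) obtain W where W: "valid_channel k W" "total_distortion d k (test_channel_joint \<mu> k W) \<le> T"
    "pair_mutual_information (test_channel_joint \<mu> k W) \<le> r" by (auto simp: test_channel_feasible_def)
  define p where "p = test_channel_joint \<mu> k W"
  have "\<exists>i<k. measure_pmf.expectation p (\<lambda>(us, vs). d (us ! i) (vs ! i)) \<le> T / real k"
  proof (rule ccontr)
    assume "\<not> ?thesis"
    then have "(\<Sum>i<k. T / real k) < total_distortion d k p"
      unfolding total_distortion_def using k by (intro sum_strict_mono) (auto simp: not_le lessThan_empty_iff)
    then show False using W(2) k by (simp add: p_def)
  qed
  then obtain i where i: "i < k" "measure_pmf.expectation p (\<lambda>(us, vs). d (us ! i) (vs ! i)) \<le> T / real k" by blast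
  define p' where "p' = map_pmf (\<lambda>(us, vs). ([us ! i], [vs ! i])) p"
  have fst: "map_pmf fst p' = source_block \<mu> 1"
  proof -
    have "map_pmf fst p' = map_pmf (\<lambda>us. [us ! i]) (map_pmf fst p)"
      by (simp add: p'_def pmf.map_comp comp_def case_prod_unfold)
    also have "\<dots> = map_pmf (\<lambda>us. take 1 (drop i us)) (source_block \<mu> k)"
      using i by (intro map_pmf_cong) (auto simp: p_def take_Suc_conv_app_nth hd_drop_conv_nth take_Suc dest: length_source_block)
    also have "\<dots> = source_block \<mu> 1" using i by (intro map_source_block) auto
    finally show ?thesis .
  qed
  obtain V where V: "bind_pmf (map_pmf fst p') (\<lambda>u. map_pmf (Pair u) (V u)) = p'"
    "\<And>u. set_pmf (V u) \<subseteq> snd ` set_pmf p'" by (rule disintegrate_pmf[of p']) blast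
  have p': "test_channel_joint \<mu> 1 V = p'"
    using V(1) by (simp add: test_channel_joint_def fst)
  have "valid_channel 1 V"
    using V(2) by (force simp: valid_channel_def p'_def)
  moreover have "total_distortion d 1 p' \<le> T / real k"
    using i(2) by (simp add: total_distortion_def p'_def case_prod_unfold)
  moreover have "pair_mutual_information p' \<le> r"
    unfolding p'_def using data_processing[of "\<lambda>us. [us ! i]" "\<lambda>vs. [vs ! i]" p] W(3)
    by (auto simp: p_def)
  ultimately show ?thesis unfolding test_channel_feasible_def using p' by blast
qed

lemma block_rate_distortion_le_iff:
  assumes "N \<ge> 1"
  shows "block_rate_distortion \<mu> d N D < r \<longleftrightarrow> (\<exists>r'<r. test_channel_feasible \<mu> d N (real N * D) r')"
    and "test_channel_feasible \<mu> d N (real N * D) r \<Longrightarrow> block_rate_distortion \<mu> d N D \<le> r"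
proof -
  have set: "{W. (\<forall>us. \<forall>vs\<in>set_pmf (W us). length vs = N) \<and> block_distortion d N (test_channel_joint \<mu> N W) \<le> D} =
      {W. valid_channel N W \<and> total_distortion d N (test_channel_joint \<mu> N W) \<le> real N * D}"
    using block_distortion_le_iff[OF assms, of d] by (simp add: valid_channel_def)
  show "block_rate_distortion \<mu> d N D < r \<longleftrightarrow> (\<exists>r'<r. test_channel_feasible \<mu> d N (real N * D) r')"
    unfolding block_rate_distortion_def set INF_less_iff test_channel_feasible_def
    by (auto intro: le_less_trans)
  show "test_channel_feasible \<mu> d N (real N * D) r \<Longrightarrow> block_rate_distortion \<mu> d N D \<le> r"
    unfolding block_rate_distortion_def set test_channel_feasible_def
    by (auto intro: INF_lower2)
qed

lemma block_rate_distortion_nonneg: "0 \<le> block_rate_distortion \<mu> d N D"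
  unfolding block_rate_distortion_def by (intro INF_greatest pair_mutual_information_nonneg)

lemma block_rate_distortion_add:
  assumes "M \<ge> 1" "N \<ge> 1"
  shows "block_rate_distortion \<mu> d (M + N) D \<le> block_rate_distortion \<mu> d M D + block_rate_distortion \<mu> d N D"
proof (cases "block_rate_distortion \<mu> d M D = \<infinity> \<or> block_rate_distortion \<mu> d N D = \<infinity>")
  case True
  then show ?thesis using block_rate_distortion_nonneg[of d M D] block_rate_distortion_nonneg[of d N D] by auto
next
  case False
  then obtain x y where x: "block_rate_distortion \<mu> d M D = ereal x" and y: "block_rate_distortion \<mu> d N D = ereal y"
    using block_rate_distortion_nonneg[of d M D] block_rate_distortion_nonneg[of d N D]
    by (cases "block_rate_distortion \<mu> d M D"; cases "block_rate_distortion \<mu> d N D") auto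
  show ?thesis
  proof (rule ereal_le_epsilon2)
    fix e :: real assume e: "e > 0"
    have "block_rate_distortion \<mu> d M D < ereal (x + e / 2)" "block_rate_distortion \<mu> d N D < ereal (y + e / 2)"
      using e by (simp_all add: x y)
    then obtain r1 r2 where r: "r1 < ereal (x + e / 2)" "test_channel_feasible \<mu> d M (real M * D) r1"
      "r2 < ereal (y + e / 2)" "test_channel_feasible \<mu> d N (real N * D) r2"
      using assms by (auto simp: block_rate_distortion_le_iff)
    have "real M * D + real N * D = real (M + N) * D" by (simp add: algebra_simps)
    then have "block_rate_distortion \<mu> d (M + N) D \<le> r1 + r2"
      using test_channel_feasible_add[OF r(2,4)] assms by (intro block_rate_distortion_le_iff(2)) auto
    also have "\<dots> \<le> ereal (x + e / 2) + ereal (y + e / 2)" using r by (intro add_mono) auto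
    also have "\<dots> = block_rate_distortion \<mu> d M D + block_rate_distortion \<mu> d N D + ereal e"
      by (simp add: x y)
    finally show "block_rate_distortion \<mu> d (M + N) D \<le>
      block_rate_distortion \<mu> d M D + block_rate_distortion \<mu> d N D + ereal e" .
  qed
qed

lemma block_rate_distortion_letter:
  assumes "k \<ge> 1"
  shows "block_rate_distortion \<mu> d 1 D \<le> block_rate_distortion \<mu> d k D"
proof (rule ccontr)
  assume "\<not> ?thesis"
  then obtain r where r: "r < block_rate_distortion \<mu> d 1 D" "test_channel_feasible \<mu> d k (real k * D) r"
    using assms by (auto simp: not_le block_rate_distortion_le_iff)
  then have "block_rate_distortion \<mu> d 1 D \<le> r"
    using test_channel_feasible_letter[OF assms r(2)] assms by (intro block_rate_distortion_le_iff(2)) auto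
  then show False using r by auto
qed

lemma rate_distortion_tendsto:
  "(\<lambda>N. block_rate_distortion \<mu> d N D / ereal (real N)) \<longlonglongrightarrow> rate_distortion \<mu> d D"
proof -
  have "convergent (\<lambda>N. block_rate_distortion \<mu> d N D / ereal (real N))"
    by (intro fekete_ereal block_rate_distortion_nonneg block_rate_distortion_add block_rate_distortion_letter)
  then show ?thesis by (simp add: rate_distortion_def convergent_LIMSEQ_iff)
qed

lemma rate_distortion_lessE:
  assumes "rate_distortion \<mu> d D < ereal R"
  obtains k r where "k \<ge> 1" "test_channel_feasible \<mu> d k (real k * D) (ereal r)" "r < real k * R"
proof -
  have "\<forall>\<^sub>F N in sequentially. block_rate_distortion \<mu> d N D / ereal (real N) < ereal R"
    by (rule order_tendstoD(2)[OF rate_distortion_tendsto assms])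
  then have "\<forall>\<^sub>F N in sequentially. N \<ge> 1 \<and> block_rate_distortion \<mu> d N D / ereal (real N) < ereal R"
    using eventually_ge_at_top[of 1] by eventually_elim auto
  then obtain k where k: "k \<ge> 1" "block_rate_distortion \<mu> d k D / ereal (real k) < ereal R"
    by (auto dest: eventually_happens)
  then have "block_rate_distortion \<mu> d k D < ereal (real k * R)"
    by (cases "block_rate_distortion \<mu> d k D") (auto simp: field_simps)
  then obtain r where r: "r < ereal (real k * R)" "test_channel_feasible \<mu> d k (real k * D) r"
    using k by (auto simp: block_rate_distortion_le_iff)
  have "0 \<le> r" using r(2) pair_mutual_information_nonneg order.trans by (auto simp: test_channel_feasible_def)
  then obtain x where "r = ereal x" using r(1) by (cases r) auto
  then show ?thesis using that[of k x] k r by auto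
qed

lemma rate_distortion_le:
  assumes "\<forall>\<^sub>F N in sequentially. test_channel_feasible \<mu> d N (real N * D) (ereal (c N))"
    and "(\<lambda>N. c N / real N) \<longlonglongrightarrow> C"
  shows "rate_distortion \<mu> d D \<le> ereal C"
proof (rule tendsto_le[OF _ _ rate_distortion_tendsto])
  show "(\<lambda>N. ereal (c N / real N)) \<longlonglongrightarrow> ereal C" using assms(2) by simp
  show "\<forall>\<^sub>F N in sequentially. block_rate_distortion \<mu> d N D / ereal (real N) \<le> ereal (c N / real N)"
    using assms(1) eventually_ge_at_top[of 1]
  proof eventually_elim
    case (elim N)
    have "block_rate_distortion \<mu> d N D \<le> ereal (c N)"
      using elim by (intro block_rate_distortion_le_iff(2)) auto
    then have "block_rate_distortion \<mu> d N D / ereal (real N) \<le> ereal (c N) / ereal (real N)"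
      using elim by (intro ereal_divide_right_mono) auto
    then show ?case using elim by simp
  qed
qed simp

end

section \<open>Birkhoff averages and balanced phases\<close>

locale measure_preserving = prob_space M for M :: "'a measure" +
  fixes S :: "'a \<Rightarrow> 'a"
  assumes S_measurable [measurable]: "S \<in> measurable M M"
    and S_distr: "distr M M S = M"
begin

lemma S_funpow_measurable [measurable]: "(S ^^ n) \<in> measurable M M"
  by (induction n) (auto intro: measurable_comp)

lemma S_funpow_distr: "distr M M (S ^^ n) = M"
proof (induction n)
  case 0
  then show ?case by (simp add: id_def)
next
  case (Suc n)
  have "distr M M (S ^^ Suc n) = distr (distr M M (S ^^ n)) M S"
    by (subst distr_distr) auto
  with Suc S_distr show ?case by (simp add: comp_def)
qed

lemma integral_S_funpow:
  fixes f :: "'a \<Rightarrow> real"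
  assumes [measurable]: "f \<in> borel_measurable M"
  shows "(\<integral>x. f ((S ^^ n) x) \<partial>M) = (\<integral>x. f x \<partial>M)"
  by (subst (2) S_funpow_distr[of n, symmetric]) (simp add: integral_distr)

definition birkhoff_avg :: "('a \<Rightarrow> real) \<Rightarrow> nat \<Rightarrow> 'a \<Rightarrow> real" where
  "birkhoff_avg f n x = (\<Sum>i<n. f ((S ^^ i) x)) / real n"

definition upper_avg :: "('a \<Rightarrow> real) \<Rightarrow> 'a \<Rightarrow> real" where
  "upper_avg f x = real_of_ereal (limsup (\<lambda>n. ereal (birkhoff_avg f n x)))"

lemma S_funpow_compose_measurable [measurable (raw)]:
  "f \<in> measurable M N \<Longrightarrow> (\<lambda>x. f ((S ^^ n) x)) \<in> measurable M N"
  using S_funpow_measurable by (rule measurable_compose)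

lemma birkhoff_avg_measurable [measurable (raw)]:
  "f \<in> borel_measurable M \<Longrightarrow> birkhoff_avg f n \<in> borel_measurable M"
  unfolding birkhoff_avg_def[abs_def]
  by (rule borel_measurable_divide[OF borel_measurable_sum[OF S_funpow_compose_measurable]]) auto

lemma upper_avg_measurable [measurable (raw)]:
  "f \<in> borel_measurable M \<Longrightarrow> upper_avg f \<in> borel_measurable M"
  unfolding upper_avg_def[abs_def] by measurable

lemma birkhoff_avg_bounds:
  assumes "\<And>x. 0 \<le> f x" "\<And>x. f x \<le> B"
  shows "0 \<le> birkhoff_avg f n x" "birkhoff_avg f n x \<le> B"
proof -
  show "0 \<le> birkhoff_avg f n x" using assms by (auto simp: birkhoff_avg_def intro!: divide_nonneg_nonneg sum_nonneg)
  have "B \<ge> 0" using assms(1)[of undefined] assms(2)[of undefined] by linarith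
  have "(\<Sum>i<n. f ((S ^^ i) x)) \<le> (\<Sum>i<n. B)" using assms by (intro sum_mono)
  then show "birkhoff_avg f n x \<le> B" using \<open>B \<ge> 0\<close>
    by (cases "n = 0") (auto simp: birkhoff_avg_def divide_le_eq mult.commute)
qed

lemma upper_avg_bounds:
  assumes f: "\<And>x. 0 \<le> f x" "\<And>x. f x \<le> B"
  shows "limsup (\<lambda>n. ereal (birkhoff_avg f n x)) = ereal (upper_avg f x)" "0 \<le> upper_avg f x" "upper_avg f x \<le> B"
proof -
  let ?l = "limsup (\<lambda>n. ereal (birkhoff_avg f n x))"
  have "?l \<le> ereal B" using birkhoff_avg_bounds[OF f]
    by (intro Limsup_bounded always_eventually) auto
  moreover have "ereal 0 \<le> ?l" using birkhoff_avg_bounds[OF f]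
    by (intro le_Limsup always_eventually) auto
  ultimately show "?l = ereal (upper_avg f x)" "0 \<le> upper_avg f x" "upper_avg f x \<le> B"
    unfolding upper_avg_def by (cases ?l; auto)+
qed

lemma upper_avg_invariant:
  assumes f: "\<And>x. 0 \<le> f x" "\<And>x. f x \<le> B"
  shows "upper_avg f (S x) = upper_avg f x"
proof -
  have B0: "B \<ge> 0" using f(1)[of undefined] f(2)[of undefined] by linarith
  have diff: "birkhoff_avg f n (S x) - birkhoff_avg f n x = (f ((S ^^ n) x) - f x) / real n" for n
  proof -
    have "(\<Sum>i<n. f ((S ^^ i) (S x))) + f x = (\<Sum>i<Suc n. f ((S ^^ i) x))"
      unfolding sum.lessThan_Suc_shift by (simp add: funpow_swap1)
    then have "(\<Sum>i<n. f ((S ^^ i) (S x))) = (\<Sum>i<n. f ((S ^^ i) x)) + f ((S ^^ n) x) - f x" by simp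
    then show ?thesis by (simp add: birkhoff_avg_def diff_divide_distrib add_divide_distrib)
  qed
  have lim: "(\<lambda>n. birkhoff_avg f n (S x) - birkhoff_avg f n x) \<longlonglongrightarrow> 0"
    unfolding diff
  proof (rule Lim_null_comparison)
    show "(\<lambda>n. B / real n) \<longlonglongrightarrow> 0" by (rule lim_const_over_n)
    have "\<bar>f ((S ^^ n) x) - f x\<bar> \<le> B" for n
      using f(1)[of "(S ^^ n) x"] f(2)[of "(S ^^ n) x"] f(1)[of x] f(2)[of x] by linarith
    then show "\<forall>\<^sub>F n in sequentially. norm ((f ((S ^^ n) x) - f x) / real n) \<le> B / real n"
      by (intro always_eventually) (auto intro: divide_right_mono)
  qed
  have "limsup (\<lambda>n. ereal (birkhoff_avg f n (S x) - birkhoff_avg f n x) + ereal (birkhoff_avg f n x)) =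
      ereal 0 + limsup (\<lambda>n. ereal (birkhoff_avg f n x))"
    by (rule ereal_limsup_lim_add) (use lim in auto)
  then show ?thesis by (simp add: upper_avg_def)
qed

lemma upper_avg_invariant_funpow:
  assumes f: "\<And>x. 0 \<le> f x" "\<And>x. f x \<le> B"
  shows "upper_avg f ((S ^^ n) x) = upper_avg f x"
  by (induction n) (auto simp: upper_avg_invariant[OF f])

text \<open>An orbit segment is cut greedily into pieces on which the average of \<open>f\<close> is at least \<open>c\<close>;
  points for which no short piece exists form single steps and are paid for by the bound \<open>B\<close>.\<close>

lemma tiling_bound:
  fixes f g c :: "'a \<Rightarrow> real"
  assumes "\<And>x. c (S x) = c x" and c0: "\<And>x. 0 \<le> c x" and f0: "\<And>x. 0 \<le> g x" and fg: "\<And>x. f x \<le> g x"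
    and step: "\<And>x. c x \<le> g x \<or> (\<exists>m\<in>{1..L}. real m * c x \<le> (\<Sum>i<m. f ((S ^^ i) x)))" and "L \<ge> 1"
  shows "(real N - real L) * c x \<le> (\<Sum>i<N. g ((S ^^ i) x))"
proof (induction N arbitrary: x rule: less_induct)
  case (less N)
  have inv: "c ((S ^^ n) x) = c x" for n x by (induction n) (auto simp: assms(1))
  show ?case
  proof (cases "N \<le> L")
    case True
    then have "(real N - real L) * c x \<le> 0" using c0 by (intro mult_nonpos_nonneg) auto
    also have "0 \<le> (\<Sum>i<N. g ((S ^^ i) x))" using f0 by (intro sum_nonneg) auto
    finally show ?thesis .
  next
    case False
    obtain m where m: "1 \<le> m" "m \<le> L" "real m * c x \<le> (\<Sum>i<m. g ((S ^^ i) x))"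
    proof (cases "c x \<le> g x")
      case True
      then show ?thesis using that[of 1] \<open>L \<ge> 1\<close> by simp
    next
      case False
      then obtain m where m: "m \<in> {1..L}" "real m * c x \<le> (\<Sum>i<m. f ((S ^^ i) x))" using step by blast
      moreover have "(\<Sum>i<m. f ((S ^^ i) x)) \<le> (\<Sum>i<m. g ((S ^^ i) x))" by (intro sum_mono fg)
      ultimately show ?thesis using that[of m] by auto
    qed
    have mN: "m < N" using m False by auto
    have "(\<Sum>i<N. g ((S ^^ i) x)) = (\<Sum>i<m. g ((S ^^ i) x)) + (\<Sum>i<N - m. g ((S ^^ (i + m)) x))"
      using sum_lessThan_add[of "\<lambda>i. g ((S ^^ i) x)" m "N - m"] mN by (simp add: add.commute)
    also have "(\<Sum>i<N - m. g ((S ^^ (i + m)) x)) = (\<Sum>i<N - m. g ((S ^^ i) ((S ^^ m) x)))"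
      by (simp add: funpow_add)
    also have "(\<Sum>i<m. g ((S ^^ i) x)) + \<dots> \<ge> (\<Sum>i<m. g ((S ^^ i) x)) + (real (N - m) - real L) * c ((S ^^ m) x)"
      using m mN by (intro add_left_mono less.IH) auto
    finally have "(\<Sum>i<m. g ((S ^^ i) x)) + (real (N - m) - real L) * c x \<le> (\<Sum>i<N. g ((S ^^ i) x))"
      by (simp add: inv)
    moreover have "(real N - real L) * c x = real m * c x + (real (N - m) - real L) * c x"
      using mN by (simp add: of_nat_diff algebra_simps)
    ultimately show ?thesis using m(3) by linarith
  qed
qed

lemma integral_upper_avg_le:
  assumes [measurable]: "f \<in> borel_measurable M" and f: "\<And>x. 0 \<le> f x" "\<And>x. f x \<le> B"
  shows "(\<integral>x. upper_avg f x \<partial>M) \<le> (\<integral>x. f x \<partial>M)"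
proof (rule field_le_epsilon)
  fix e :: real assume e: "e > 0"
  have B0: "B \<ge> 0" using f(1)[of undefined] f(2)[of undefined] by linarith
  define \<delta> where "\<delta> = e / (2 * (B + 1))"
  have \<delta>: "\<delta> > 0" using e B0 by (simp add: \<delta>_def)
  define c where "c x = max 0 (upper_avg f x - e / 2)" for x
  have [measurable]: "c \<in> borel_measurable M" unfolding c_def[abs_def] by measurable
  have c_inv: "c (S x) = c x" for x by (simp add: c_def upper_avg_invariant[OF f])
  have cB: "0 \<le> c x" "c x \<le> B" for x using upper_avg_bounds[of f B x, OF f] e B0 by (auto simp: c_def)
  have ex: "\<exists>m\<ge>1. real m * c x \<le> (\<Sum>i<m. f ((S ^^ i) x))" for x
  proof (cases "upper_avg f x \<le> e / 2")
    case True
    then show ?thesis using f by (intro exI[of _ 1]) (auto simp: c_def)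
  next
    case False
    have "ereal (upper_avg f x - e / 2) < limsup (\<lambda>n. ereal (birkhoff_avg f n x))"
      unfolding upper_avg_bounds(1)[OF f] using e by simp
    then obtain n where n: "upper_avg f x - e / 2 < birkhoff_avg f n x" by (auto dest: Limsup_obtain)
    then have "n \<noteq> 0" using False by (intro notI) (simp add: birkhoff_avg_def)
    then show ?thesis using n False by (intro exI[of _ n]) (auto simp: c_def birkhoff_avg_def field_simps)
  qed
  define bad where "bad L = {x \<in> space M. \<not> (\<exists>m\<in>{1..L}. real m * c x \<le> (\<Sum>i<m. f ((S ^^ i) x)))}" for L
  have bad_sets [measurable]: "bad L \<in> sets M" for L unfolding bad_def by measurable
  have "(\<lambda>L. measure M (bad L)) \<longlonglongrightarrow> measure M (\<Inter>L. bad L)"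
    by (rule finite_Lim_measure_decseq) (auto simp: decseq_def bad_def)
  also have "(\<Inter>L. bad L) = {}"
  proof -
    have "\<exists>L. x \<notin> bad L" for x
    proof -
      from ex[of x] obtain m where "m \<ge> 1" "real m * c x \<le> (\<Sum>i<m. f ((S ^^ i) x))" by blast
      then have "x \<notin> bad m" by (auto simp: bad_def)
      then show ?thesis by blast
    qed
    then show ?thesis by blast
  qed
  finally have "(\<lambda>L. measure M (bad L)) \<longlonglongrightarrow> 0" by simp
  then have "\<forall>\<^sub>F L in sequentially. measure M (bad L) < \<delta>" using \<delta> by (rule order_tendstoD)
  then have "\<forall>\<^sub>F L in sequentially. measure M (bad L) < \<delta> \<and> L \<ge> 1"
    using eventually_ge_at_top[of 1] by eventually_elim auto
  then obtain L where L: "measure M (bad L) < \<delta>" "L \<ge> 1" by (auto dest: eventually_happens)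
  define g where "g x = f x + (if \<exists>m\<in>{1..L}. real m * c x \<le> (\<Sum>i<m. f ((S ^^ i) x)) then 0 else B)" for x
  have g[measurable]: "g \<in> borel_measurable M" unfolding g_def[abs_def] by measurable
  have gb: "0 \<le> g x" "f x \<le> g x" "g x \<le> 2 * B" for x using f(1)[of x] f(2)[of x] B0 by (auto simp: g_def)
  have int: "integrable M h" if "h \<in> borel_measurable M" "\<And>x. 0 \<le> h x" "\<And>x. h x \<le> b" for h and b :: real
    using that by (intro integrable_const_bound[of _ b]) auto
  have ci: "integrable M c" using cB by (intro int[of _ B]) auto
  have gi: "integrable M g" using gb by (intro int[of _ "2 * B"]) auto
  have gSi: "integrable M (\<lambda>x. g ((S ^^ i) x))" for i using gb by (intro int[of _ "2 * B"]) auto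
  have tile: "(real N - real L) * (\<integral>x. c x \<partial>M) \<le> real N * (\<integral>x. g x \<partial>M)" for N
  proof -
    have "(real N - real L) * (\<integral>x. c x \<partial>M) = (\<integral>x. (real N - real L) * c x \<partial>M)" by simp
    also have "\<dots> \<le> (\<integral>x. (\<Sum>i<N. g ((S ^^ i) x)) \<partial>M)"
    proof (rule integral_mono_AE)
      show "AE x in M. (real N - real L) * c x \<le> (\<Sum>i<N. g ((S ^^ i) x))"
      proof (intro always_eventually allI tiling_bound[of c g f L] c_inv cB gb L)
        show "c x \<le> g x \<or> (\<exists>m\<in>{1..L}. real m * c x \<le> (\<Sum>i<m. f ((S ^^ i) x)))" for x
          using cB(2)[of x] f(1)[of x] by (auto simp: g_def)
      qed
    qed (use ci gSi in auto)
    also have "\<dots> = (\<Sum>i<N. \<integral>x. g ((S ^^ i) x) \<partial>M)" using gSi by (intro Bochner_Integration.integral_sum)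
    also have "\<dots> = real N * (\<integral>x. g x \<partial>M)" by (simp add: integral_S_funpow)
    finally show ?thesis .
  qed
  have "(\<integral>x. c x \<partial>M) \<le> (\<integral>x. g x \<partial>M)"
  proof (rule tendsto_le[OF sequentially_bot])
    show "(\<lambda>N. \<integral>x. g x \<partial>M) \<longlonglongrightarrow> (\<integral>x. g x \<partial>M)" by simp
    have "(\<lambda>N. (1 - real L / real N) * (\<integral>x. c x \<partial>M)) \<longlonglongrightarrow> (1 - 0) * (\<integral>x. c x \<partial>M)"
      by (intro tendsto_intros lim_const_over_n)
    then show "(\<lambda>N. (1 - real L / real N) * (\<integral>x. c x \<partial>M)) \<longlonglongrightarrow> (\<integral>x. c x \<partial>M)" by simp
    show "\<forall>\<^sub>F N in sequentially. (1 - real L / real N) * (\<integral>x. c x \<partial>M) \<le> (\<integral>x. g x \<partial>M)"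
      using eventually_gt_at_top[of 0]
    proof eventually_elim
      case (elim N)
      then show ?case using tile[of N] by (simp add: field_simps)
    qed
  qed
  also have "(\<integral>x. g x \<partial>M) = (\<integral>x. f x \<partial>M) + B * measure M (bad L)"
  proof -
    have "(\<integral>x. g x \<partial>M) = (\<integral>x. f x + B * indicator (bad L) x \<partial>M)"
      by (intro Bochner_Integration.integral_cong) (auto simp: g_def bad_def indicator_def)
    also have "\<dots> = (\<integral>x. f x \<partial>M) + B * measure M (bad L)"
      using f int[of f B] integrable_real_indicator[OF bad_sets[of L]]
      by (subst Bochner_Integration.integral_add) (auto simp: emeasure_eq_measure)
    finally show ?thesis .
  qed
  also have "B * measure M (bad L) \<le> (B + 1) * \<delta>" using L B0 \<delta> by (intro mult_mono) auto
  also have "(B + 1) * \<delta> = e / 2" using B0 by (simp add: \<delta>_def field_simps)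
  finally have "(\<integral>x. c x \<partial>M) \<le> (\<integral>x. f x \<partial>M) + e / 2" by simp
  moreover have ui: "integrable M (upper_avg f)"
    using upper_avg_bounds[of f B, OF f] by (intro int[of _ B]) auto
  moreover have "(\<integral>x. upper_avg f x - e / 2 \<partial>M) \<le> (\<integral>x. c x \<partial>M)"
    using ci ui by (intro integral_mono) (auto simp: c_def)
  moreover have "(\<integral>x. upper_avg f x - e / 2 \<partial>M) = (\<integral>x. upper_avg f x \<partial>M) - e / 2"
    using ui by (simp add: prob_space)
  ultimately show "(\<integral>x. upper_avg f x \<partial>M) \<le> (\<integral>x. f x \<partial>M) + e" by simp
qed

lemma eventually_less_upper_avg:
  assumes f: "\<And>x. 0 \<le> f x" "\<And>x. f x \<le> B" and "e > 0"
  shows "\<forall>\<^sub>F n in sequentially. birkhoff_avg f n x < upper_avg f x + e"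
proof -
  have "limsup (\<lambda>n. ereal (birkhoff_avg f n x)) < ereal (upper_avg f x + e)"
    unfolding upper_avg_bounds(1)[of f B x, OF f] using \<open>e > 0\<close> by simp
  from Limsup_lessD[OF this] show ?thesis by simp
qed

lemma birkhoff_L1:
  assumes [measurable]: "f \<in> borel_measurable M" and f: "\<And>x. 0 \<le> f x" "\<And>x. f x \<le> B"
  shows "(\<lambda>n. \<integral>x. \<bar>birkhoff_avg f n x - upper_avg f x\<bar> \<partial>M) \<longlonglongrightarrow> 0"
proof -
  have B0: "B \<ge> 0" using f(1)[of undefined] f(2)[of undefined] by linarith
  define f' where "f' x = B - f x" for x
  have [measurable]: "f' \<in> borel_measurable M" unfolding f'_def[abs_def] by measurable
  have f': "0 \<le> f' x" "f' x \<le> B" for x using f by (auto simp: f'_def)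
  have int: "integrable M h" if "h \<in> borel_measurable M" "\<And>x. 0 \<le> h x" "\<And>x. h x \<le> b" for h and b :: real
    using that by (intro integrable_const_bound[of _ b]) auto
  have avg': "birkhoff_avg f' n x = B - birkhoff_avg f n x" if "n \<ge> 1" for n x
    using that by (simp add: birkhoff_avg_def f'_def sum_subtractf diff_divide_distrib)
  note u = upper_avg_bounds[of f B, OF f] and u' = upper_avg_bounds[of f' B, OF f']
  have ui: "integrable M (upper_avg f)" "integrable M (upper_avg f')" "integrable M f" "integrable M f'"
    by (rule int[of _ B]; use u u' f f' in simp)+
  have ev: "\<forall>\<^sub>F n in sequentially. birkhoff_avg f n x < upper_avg f x + e \<and> B - birkhoff_avg f n x < upper_avg f' x + e"
    if "e > 0" for e x
    using eventually_less_upper_avg[of f B, OF f that] eventually_less_upper_avg[of f' B, OF f' that] eventually_ge_at_top[of 1]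
    by eventually_elim (auto simp: avg')
  have ge: "B \<le> upper_avg f x + upper_avg f' x" for x
  proof (rule field_le_epsilon)
    fix e :: real assume "e > 0"
    then have "0 < e / 2" by simp
    then obtain n where "birkhoff_avg f n x < upper_avg f x + e / 2 \<and> B - birkhoff_avg f n x < upper_avg f' x + e / 2"
      using eventually_happens[OF ev[of "e / 2" x]] by auto
    then show "B \<le> upper_avg f x + upper_avg f' x + e" by linarith
  qed
  have "(\<integral>x. upper_avg f x + upper_avg f' x - B \<partial>M) = 0"
  proof (rule antisym)
    show "0 \<le> (\<integral>x. upper_avg f x + upper_avg f' x - B \<partial>M)" using ge by (intro integral_nonneg_AE) auto
    have "(\<integral>x. upper_avg f x + upper_avg f' x - B \<partial>M) = (\<integral>x. upper_avg f x \<partial>M) + (\<integral>x. upper_avg f' x \<partial>M) - B"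
      using ui by (simp add: prob_space)
    also have "\<dots> \<le> (\<integral>x. f x \<partial>M) + (\<integral>x. f' x \<partial>M) - B"
      using integral_upper_avg_le[of f B, OF _ f] integral_upper_avg_le[of f' B, OF _ f'] by simp
    also have "\<dots> = 0" using ui(3) by (simp add: f'_def prob_space)
    finally show "(\<integral>x. upper_avg f x + upper_avg f' x - B \<partial>M) \<le> 0" .
  qed
  then have AE: "AE x in M. upper_avg f x + upper_avg f' x - B = 0"
    using ui ge by (subst (asm) integral_nonneg_eq_0_iff_AE) auto
  have conv: "AE x in M. (\<lambda>n. \<bar>birkhoff_avg f n x - upper_avg f x\<bar>) \<longlonglongrightarrow> 0"
    using AE
  proof eventually_elim
    case (elim x)
    show ?case
    proof (rule tendstoI)
      fix e :: real assume "e > 0"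
      from ev[OF this, of x] show "\<forall>\<^sub>F n in sequentially. dist \<bar>birkhoff_avg f n x - upper_avg f x\<bar> 0 < e"
        by eventually_elim (use elim in \<open>auto simp: dist_real_def\<close>)
    qed
  qed
  have "(\<lambda>n. \<integral>x. \<bar>birkhoff_avg f n x - upper_avg f x\<bar> \<partial>M) \<longlonglongrightarrow> (\<integral>x. 0 \<partial>M)"
  proof (rule integral_dominated_convergence[where w = "\<lambda>_. B"])
    show "AE x in M. norm \<bar>birkhoff_avg f n x - upper_avg f x\<bar> \<le> B" for n
    proof (intro always_eventually allI)
      fix x
      show "norm \<bar>birkhoff_avg f n x - upper_avg f x\<bar> \<le> B"
        using u(2,3)[of x] birkhoff_avg_bounds[of f B n x, OF f] by (simp add: abs_le_iff)
    qed
    show "AE x in M. (\<lambda>n. \<bar>birkhoff_avg f n x - upper_avg f x\<bar>) \<longlonglongrightarrow> 0" by (rule conv)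
    show "(\<lambda>x. \<bar>birkhoff_avg f n x - upper_avg f x\<bar>) \<in> borel_measurable M" for n by measurable
    show "integrable M (\<lambda>_. B)" by simp
    show "(\<lambda>x. 0) \<in> borel_measurable M" by measurable
  qed
  then show ?thesis unfolding Bochner_Integration.integral_zero .
qed

end

text \<open>The \<open>k * n\<close> blocks form \<open>k\<close> sections of \<open>n\<close> blocks with one idle letter after each section.  So
  section \<open>j\<close> sees the source in phase \<open>j\<close> modulo \<open>k\<close>, and the average over the phases is invariant under the
  one-step shift, although the \<open>k\<close>-step shift need not be ergodic.\<close>

definition block_pos :: "nat \<Rightarrow> nat \<Rightarrow> nat \<Rightarrow> nat" where
  "block_pos k n b = b * k + b div n"

locale ergodic_source = stationary_source \<mu> for \<mu> :: "(nat \<Rightarrow> 'u::countable) measure" +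
  assumes ergodic: "A \<in> sets \<mu> \<Longrightarrow> seq_shift -` A = A \<Longrightarrow> measure \<mu> A = 0 \<or> measure \<mu> A = 1"
begin

lemma invariant_AE_const:
  fixes G :: "(nat \<Rightarrow> 'u) \<Rightarrow> real"
  assumes [measurable]: "G \<in> borel_measurable \<mu>" and int: "integrable \<mu> G" and inv: "\<And>\<omega>. G (seq_shift \<omega>) = G \<omega>"
  shows "AE \<omega> in \<mu>. G \<omega> = (\<integral>\<omega>. G \<omega> \<partial>\<mu>)"
proof -
  define m where "m = (\<integral>\<omega>. G \<omega> \<partial>\<mu>)"
  have AE_eq: "AE \<omega> in \<mu>. G \<omega> = m" if "AE \<omega> in \<mu>. 0 \<le> s * (G \<omega> - m)" "s \<noteq> 0" for s
  proof -
    have "(\<integral>\<omega>. s * (G \<omega> - m) \<partial>\<mu>) = 0" using int by (simp add: m_def prob_space)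
    then have "AE \<omega> in \<mu>. s * (G \<omega> - m) = 0"
      using that int by (subst (asm) integral_nonneg_eq_0_iff_AE) auto
    then show ?thesis using \<open>s \<noteq> 0\<close> by auto
  qed
  let ?A = "{\<omega>. G \<omega> < m}"
  have A: "?A \<in> sets \<mu>"
  proof -
    have "{\<omega> \<in> space \<mu>. G \<omega> < m} \<in> sets \<mu>" by measurable
    then show ?thesis by simp
  qed
  have "seq_shift -` ?A = ?A" by (auto simp: inv)
  from ergodic[OF A this] show ?thesis unfolding m_def[symmetric]
  proof
    assume "measure \<mu> ?A = 0"
    then have "AE \<omega> in \<mu>. \<omega> \<notin> ?A" using A by (intro AE_not_in) (auto simp: null_sets_def emeasure_eq_measure)
    then have "AE \<omega> in \<mu>. 0 \<le> 1 * (G \<omega> - m)" by eventually_elim auto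
    then show "AE \<omega> in \<mu>. G \<omega> = m" by (rule AE_eq) simp
  next
    assume "measure \<mu> ?A = 1"
    then have "AE \<omega> in \<mu>. \<omega> \<in> ?A" using A by (simp add: prob_eq_1)
    then have "AE \<omega> in \<mu>. 0 \<le> (-1) * (G \<omega> - m)" by eventually_elim auto
    then show "AE \<omega> in \<mu>. G \<omega> = m" by (rule AE_eq) simp
  qed
qed

lemma measure_preserving_shift: "measure_preserving \<mu> (seq_shift ^^ k)"
proof unfold_locales
  show "(seq_shift ^^ k) \<in> measurable \<mu> \<mu>"
    using measurable_seq_shift_funpow by (simp add: measurable_cong_sets[OF sets_mu sets_mu])
  have "distr \<mu> \<mu> (seq_shift ^^ k) = distr \<mu> seq_space (seq_shift ^^ k)"
    by (rule distr_cong) (auto simp: sets_mu)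
  then show "distr \<mu> \<mu> (seq_shift ^^ k) = \<mu>" by (simp add: stationary_funpow)
qed

lemma phase_average_L1_nonneg:
  fixes f :: "(nat \<Rightarrow> 'u) \<Rightarrow> real"
  assumes f_meas [measurable]: "f \<in> borel_measurable \<mu>" and f: "\<And>\<omega>. 0 \<le> f \<omega>" "\<And>\<omega>. f \<omega> \<le> B" and k: "k \<ge> 1"
  shows "(\<lambda>n. \<integral>\<omega>. \<bar>(\<Sum>b<k * n. f ((seq_shift ^^ block_pos k n b) \<omega>)) / real (k * n) - (\<integral>\<omega>. f \<omega> \<partial>\<mu>)\<bar> \<partial>\<mu>) \<longlonglongrightarrow> 0"
proof -
  interpret S: measure_preserving \<mu> "seq_shift ^^ k" by (rule measure_preserving_shift)
  interpret T: measure_preserving \<mu> "seq_shift ^^ 1" by (rule measure_preserving_shift)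
  let ?T = "seq_shift :: (nat \<Rightarrow> 'u) \<Rightarrow> _"
  define g where "g = S.upper_avg f"
  have g_meas [measurable]: "g \<in> borel_measurable \<mu>" unfolding g_def by measurable
  have gb: "0 \<le> g \<omega>" "g \<omega> \<le> B" for \<omega> unfolding g_def using S.upper_avg_bounds[of f B, OF f] by auto
  have g_inv: "g ((?T ^^ (k * m + j)) \<omega>) = g ((?T ^^ j) \<omega>)" for m j \<omega>
    using S.upper_avg_invariant_funpow[of f B "m" "(?T ^^ j) \<omega>", OF f]
    by (simp add: g_def funpow_add funpow_mult)
  have T_meas: "(\<lambda>\<omega>. h ((?T ^^ i) \<omega>)) \<in> borel_measurable \<mu>" if "h \<in> borel_measurable \<mu>" for h :: "_ \<Rightarrow> real" and i
    using T.S_funpow_compose_measurable[OF that, of i] by simp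
  have T_int: "(\<integral>\<omega>. h ((?T ^^ i) \<omega>) \<partial>\<mu>) = (\<integral>\<omega>. h \<omega> \<partial>\<mu>)" if "h \<in> borel_measurable \<mu>" for h :: "_ \<Rightarrow> real" and i
    using T.integral_S_funpow[OF that, of i] by simp
  have int: "integrable \<mu> h" if "h \<in> borel_measurable \<mu>" "\<And>x. \<bar>h x\<bar> \<le> b" for h and b :: real
    using that by (intro integrable_const_bound[of _ b]) auto
  define G where "G \<omega> = (\<Sum>j<k. g ((?T ^^ j) \<omega>)) / real k" for \<omega>
  have G_meas [measurable]: "G \<in> borel_measurable \<mu>"
    unfolding G_def[abs_def] by (rule borel_measurable_divide[OF borel_measurable_sum[OF T_meas[OF g_meas]]]) auto
  have Gb: "\<bar>G \<omega>\<bar> \<le> B" for \<omega>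
  proof -
    have "(\<Sum>j<k. g ((?T ^^ j) \<omega>)) \<le> (\<Sum>j<k. B)" by (intro sum_mono gb)
    moreover have "0 \<le> (\<Sum>j<k. g ((?T ^^ j) \<omega>))" by (intro sum_nonneg gb)
    ultimately show ?thesis using k by (simp add: G_def divide_le_eq mult.commute)
  qed
  have G_inv: "G (?T \<omega>) = G \<omega>" for \<omega>
  proof -
    have "(\<Sum>j<k. g ((?T ^^ j) (?T \<omega>))) + g \<omega> = (\<Sum>j<Suc k. g ((?T ^^ j) \<omega>))"
      unfolding sum.lessThan_Suc_shift by (simp add: funpow_swap1)
    then show ?thesis using g_inv[of 1 0 \<omega>] by (simp add: G_def)
  qed
  have Gi: "integrable \<mu> G" using Gb by (intro int[of _ B]) auto
  define A where "A n \<omega> = (\<Sum>b<k * n. f ((?T ^^ block_pos k n b) \<omega>)) / real (k * n)" for n \<omega>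
  have A_meas [measurable]: "A n \<in> borel_measurable \<mu>" for n
    unfolding A_def[abs_def] by (rule borel_measurable_divide[OF borel_measurable_sum[OF T_meas[OF f_meas]]]) auto
  define c where "c = (\<integral>\<omega>. f \<omega> \<partial>\<mu>)"
  have A_eq: "A n \<omega> = (\<Sum>j<k. S.birkhoff_avg f n ((?T ^^ (k * (j * n) + j)) \<omega>)) / real k" if "n \<ge> 1" for n \<omega>
  proof -
    have "(\<Sum>b<k * n. f ((?T ^^ block_pos k n b) \<omega>)) = (\<Sum>j<k. \<Sum>b\<in>{j * n..<j * n + n}. f ((?T ^^ block_pos k n b) \<omega>))"
      by (rule sum.nat_group[symmetric])
    also have "\<dots> = (\<Sum>j<k. \<Sum>i<n. f ((?T ^^ block_pos k n (j * n + i)) \<omega>))"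
    proof (rule sum.cong[OF refl])
      fix j
      show "(\<Sum>b\<in>{j * n..<j * n + n}. f ((?T ^^ block_pos k n b) \<omega>)) = (\<Sum>i<n. f ((?T ^^ block_pos k n (j * n + i)) \<omega>))"
        by (rule sum.reindex_bij_witness[of _ "\<lambda>i. j * n + i" "\<lambda>b. b - j * n"]) auto
    qed
    also have "\<dots> = (\<Sum>j<k. \<Sum>i<n. f (((?T ^^ k) ^^ i) ((?T ^^ (k * (j * n) + j)) \<omega>)))"
    proof (intro sum.cong refl)
      fix j i assume "i \<in> {..<n}"
      then have "block_pos k n (j * n + i) = k * i + (k * (j * n) + j)"
        by (simp add: block_pos_def algebra_simps)
      then show "f ((?T ^^ block_pos k n (j * n + i)) \<omega>) = f (((?T ^^ k) ^^ i) ((?T ^^ (k * (j * n) + j)) \<omega>))"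
        by (simp add: funpow_mult funpow_add)
    qed
    finally have "A n \<omega> = (\<Sum>j<k. \<Sum>i<n. f (((?T ^^ k) ^^ i) ((?T ^^ (k * (j * n) + j)) \<omega>))) / (real n * real k)"
      by (simp only: A_def of_nat_mult mult.commute)
    also have "\<dots> = (\<Sum>j<k. (\<Sum>i<n. f (((?T ^^ k) ^^ i) ((?T ^^ (k * (j * n) + j)) \<omega>))) / real n) / real k"
      by (simp only: sum_divide_distrib divide_divide_eq_left)
    finally show ?thesis unfolding S.birkhoff_avg_def .
  qed
  have AG: "(\<integral>\<omega>. \<bar>A n \<omega> - G \<omega>\<bar> \<partial>\<mu>) \<le> (\<integral>\<omega>. \<bar>S.birkhoff_avg f n \<omega> - g \<omega>\<bar> \<partial>\<mu>)" if n: "n \<ge> 1" for n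
  proof -
    define e where "e \<omega> = \<bar>S.birkhoff_avg f n \<omega> - g \<omega>\<bar>" for \<omega>
    have e_meas: "e \<in> borel_measurable \<mu>" unfolding e_def[abs_def] by measurable
    have eb: "\<bar>e \<omega>\<bar> \<le> B" for \<omega>
      using gb[of \<omega>] S.birkhoff_avg_bounds[of f B n \<omega>, OF f] by (simp add: e_def abs_le_iff)
    have "(\<integral>\<omega>. \<bar>A n \<omega> - G \<omega>\<bar> \<partial>\<mu>) \<le> (\<integral>\<omega>. (\<Sum>j<k. e ((?T ^^ (k * (j * n) + j)) \<omega>)) / real k \<partial>\<mu>)"
    proof (rule integral_mono_AE)
      have "\<bar>A n \<omega>\<bar> \<le> B" for \<omega>
      proof -
        have "(\<Sum>b<k * n. f ((?T ^^ block_pos k n b) \<omega>)) \<le> (\<Sum>b<k * n. B)" by (intro sum_mono f)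
        moreover have "0 \<le> (\<Sum>b<k * n. f ((?T ^^ block_pos k n b) \<omega>))" by (intro sum_nonneg f)
        ultimately show ?thesis using k n by (simp add: A_def divide_le_eq mult.commute)
      qed
      then have "integrable \<mu> (A n)" by (intro int[of _ B]) auto
      then show "integrable \<mu> (\<lambda>\<omega>. \<bar>A n \<omega> - G \<omega>\<bar>)" using Gi by auto
      show "integrable \<mu> (\<lambda>\<omega>. (\<Sum>j<k. e ((?T ^^ (k * (j * n) + j)) \<omega>)) / real k)"
        by (intro integrable_divide Bochner_Integration.integrable_sum int[of _ B] T_meas e_meas eb)
      show "AE \<omega> in \<mu>. \<bar>A n \<omega> - G \<omega>\<bar> \<le> (\<Sum>j<k. e ((?T ^^ (k * (j * n) + j)) \<omega>)) / real k"
      proof (intro always_eventually allI)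
        fix \<omega>
        have eq: "A n \<omega> - G \<omega> = (\<Sum>j<k. S.birkhoff_avg f n ((?T ^^ (k * (j * n) + j)) \<omega>) - g ((?T ^^ (k * (j * n) + j)) \<omega>)) / real k"
          by (simp add: A_eq[OF n] G_def g_inv sum_subtractf diff_divide_distrib)
        show "\<bar>A n \<omega> - G \<omega>\<bar> \<le> (\<Sum>j<k. e ((?T ^^ (k * (j * n) + j)) \<omega>)) / real k"
          unfolding eq abs_divide e_def abs_of_nat by (intro divide_right_mono sum_abs) simp
      qed
    qed
    also have "\<dots> = (\<Sum>j<k. (\<integral>\<omega>. e ((?T ^^ (k * (j * n) + j)) \<omega>) \<partial>\<mu>)) / real k"
      by (simp add: Bochner_Integration.integral_sum int[of _ B, OF T_meas[OF e_meas] eb])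
    also have "\<dots> = (\<integral>\<omega>. e \<omega> \<partial>\<mu>)" using k by (simp add: T_int[OF e_meas])
    finally show ?thesis by (simp add: e_def)
  qed
  have lim: "(\<lambda>n. \<integral>\<omega>. \<bar>A n \<omega> - G \<omega>\<bar> \<partial>\<mu>) \<longlonglongrightarrow> 0"
  proof (rule tendsto_sandwich[OF _ _ tendsto_const])
    show "(\<lambda>n. \<integral>\<omega>. \<bar>S.birkhoff_avg f n \<omega> - g \<omega>\<bar> \<partial>\<mu>) \<longlonglongrightarrow> 0"
      unfolding g_def by (rule S.birkhoff_L1[of f B, OF f_meas f])
    show "\<forall>\<^sub>F n in sequentially. 0 \<le> (\<integral>\<omega>. \<bar>A n \<omega> - G \<omega>\<bar> \<partial>\<mu>)" by simp
    show "\<forall>\<^sub>F n in sequentially. (\<integral>\<omega>. \<bar>A n \<omega> - G \<omega>\<bar> \<partial>\<mu>) \<le> (\<integral>\<omega>. \<bar>S.birkhoff_avg f n \<omega> - g \<omega>\<bar> \<partial>\<mu>)"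
      using AG by (intro eventually_sequentiallyI[of 1])
  qed
  have fi: "integrable \<mu> f" using f by (intro int[of _ B]) auto
  have A_int: "(\<integral>\<omega>. A n \<omega> \<partial>\<mu>) = c" if "n \<ge> 1" for n
  proof -
    have "(\<integral>\<omega>. A n \<omega> \<partial>\<mu>) = (\<Sum>b<k * n. \<integral>\<omega>. f ((?T ^^ block_pos k n b) \<omega>) \<partial>\<mu>) / real (k * n)"
      unfolding A_def using f
      by (subst integral_divide_zero, subst Bochner_Integration.integral_sum) (auto intro!: int[of _ B] T_meas)
    then show ?thesis using k that by (simp add: T_int c_def)
  qed
  have A_integrable: "integrable \<mu> (A n)" for n
    unfolding A_def[abs_def] using f
    by (intro integrable_divide Bochner_Integration.integrable_sum int[of _ B] T_meas) auto
  have c: "(\<integral>\<omega>. G \<omega> \<partial>\<mu>) = c"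
  proof -
    have "\<bar>c - (\<integral>\<omega>. G \<omega> \<partial>\<mu>)\<bar> \<le> 0"
    proof (rule tendsto_le[OF sequentially_bot lim tendsto_const])
      show "\<forall>\<^sub>F n in sequentially. \<bar>c - (\<integral>\<omega>. G \<omega> \<partial>\<mu>)\<bar> \<le> (\<integral>\<omega>. \<bar>A n \<omega> - G \<omega>\<bar> \<partial>\<mu>)"
      proof (rule eventually_sequentiallyI[of 1])
        fix n :: nat assume "n \<ge> 1"
        then have "c - (\<integral>\<omega>. G \<omega> \<partial>\<mu>) = (\<integral>\<omega>. A n \<omega> - G \<omega> \<partial>\<mu>)"
          using A_integrable Gi A_int by simp
        then show "\<bar>c - (\<integral>\<omega>. G \<omega> \<partial>\<mu>)\<bar> \<le> (\<integral>\<omega>. \<bar>A n \<omega> - G \<omega>\<bar> \<partial>\<mu>)"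
          using integral_norm_bound[of \<mu> "\<lambda>\<omega>. A n \<omega> - G \<omega>"] by simp
      qed
    qed
    then show ?thesis by simp
  qed
  have "AE \<omega> in \<mu>. G \<omega> = c" using invariant_AE_const[OF G_meas Gi G_inv] by (simp add: c)
  then have "(\<integral>\<omega>. \<bar>A n \<omega> - G \<omega>\<bar> \<partial>\<mu>) = (\<integral>\<omega>. \<bar>A n \<omega> - c\<bar> \<partial>\<mu>)" for n
    by (intro integral_cong_AE) auto
  then show ?thesis using lim by (simp add: A_def c_def)
qed

lemma phase_average_L1:
  fixes f :: "(nat \<Rightarrow> 'u) \<Rightarrow> real"
  assumes f_meas [measurable]: "f \<in> borel_measurable \<mu>" and f: "\<And>\<omega>. \<bar>f \<omega>\<bar> \<le> B" and k: "k \<ge> 1"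
  shows "(\<lambda>n. \<integral>\<omega>. \<bar>(\<Sum>b<k * n. f ((seq_shift ^^ block_pos k n b) \<omega>)) / real (k * n) - (\<integral>\<omega>. f \<omega> \<partial>\<mu>)\<bar> \<partial>\<mu>) \<longlonglongrightarrow> 0"
proof -
  have fb: "0 \<le> f \<omega> + B" "f \<omega> + B \<le> 2 * B" for \<omega> using f[of \<omega>] by (auto simp: abs_le_iff)
  have fi: "integrable \<mu> f" using f by (intro integrable_const_bound[of _ B]) auto
  have "(\<lambda>n. \<integral>\<omega>. \<bar>(\<Sum>b<k * n. f ((seq_shift ^^ block_pos k n b) \<omega>) + B) / real (k * n) - (\<integral>\<omega>. f \<omega> + B \<partial>\<mu>)\<bar> \<partial>\<mu>) \<longlonglongrightarrow> 0"
    using fb by (intro phase_average_L1_nonneg[where B = "2 * B"] k) auto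
  moreover have "\<forall>\<^sub>F n in sequentially. (\<integral>\<omega>. \<bar>(\<Sum>b<k * n. f ((seq_shift ^^ block_pos k n b) \<omega>) + B) / real (k * n) - (\<integral>\<omega>. f \<omega> + B \<partial>\<mu>)\<bar> \<partial>\<mu>) =
      (\<integral>\<omega>. \<bar>(\<Sum>b<k * n. f ((seq_shift ^^ block_pos k n b) \<omega>)) / real (k * n) - (\<integral>\<omega>. f \<omega> \<partial>\<mu>)\<bar> \<partial>\<mu>)"
    using fi k by (intro eventually_sequentiallyI[of 1]) (simp add: sum.distrib add_divide_distrib prob_space)
  ultimately show ?thesis by (rule Lim_transform_eventually)
qed

end

section \<open>Random covering\<close>

lemma integrable_pmf_bounded:
  fixes g :: "'c \<Rightarrow> real"
  shows "(\<And>y. \<bar>g y\<bar> \<le> b) \<Longrightarrow> integrable (measure_pmf q) g"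
  by (intro measure_pmf.integrable_const_bound[of _ b]) auto

lemma expectation_abs_le:
  fixes g :: "'c \<Rightarrow> real"
  shows "(\<And>y. \<bar>g y\<bar> \<le> b) \<Longrightarrow> \<bar>measure_pmf.expectation q g\<bar> \<le> b"
  by (intro order.trans[OF integral_abs_bound] measure_pmf.integral_le_const)
    (auto simp: AE_measure_pmf_iff intro!: integrable_pmf_bounded[of _ b])

lemma expectation_bind_pmf:
  fixes f :: "'b \<Rightarrow> real"
  assumes f: "\<And>y. \<bar>f y\<bar> \<le> B"
  shows "measure_pmf.expectation (bind_pmf p W) f = measure_pmf.expectation p (\<lambda>x. measure_pmf.expectation (W x) f)"
proof -
  have fb: "0 \<le> f y + B" for y using f[of y] by linarith
  have nn: "(\<integral>\<^sup>+y. ennreal (f y + B) \<partial>q) = ennreal (measure_pmf.expectation q f + B)" for q :: "'b pmf"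
  proof -
    have "(\<integral>\<^sup>+y. ennreal (f y + B) \<partial>q) = ennreal (measure_pmf.expectation q (\<lambda>y. f y + B))"
      using integrable_pmf_bounded[of f B q, OF f] fb by (intro nn_integral_eq_integral) auto
    then show ?thesis using integrable_pmf_bounded[of f B q, OF f] by simp
  qed
  have Wb: "\<bar>measure_pmf.expectation (W x) f\<bar> \<le> B" for x
    using f by (intro expectation_abs_le) auto
  have Wb0: "0 \<le> measure_pmf.expectation (W x) f + B" for x using Wb[of x] by linarith
  have "ennreal (measure_pmf.expectation (bind_pmf p W) f + B) = (\<integral>\<^sup>+x. ennreal (measure_pmf.expectation (W x) f + B) \<partial>p)"
    unfolding nn[symmetric] by simp
  also have "\<dots> = ennreal (measure_pmf.expectation p (\<lambda>x. measure_pmf.expectation (W x) f + B))"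
    using Wb0 integrable_pmf_bounded[OF Wb, of p] by (intro nn_integral_eq_integral) auto
  also have "\<dots> = ennreal (measure_pmf.expectation p (\<lambda>x. measure_pmf.expectation (W x) f) + B)"
    using integrable_pmf_bounded[OF Wb, of p] by simp
  finally have "ennreal (measure_pmf.expectation (bind_pmf p W) f + B) = ennreal (measure_pmf.expectation p (\<lambda>x. measure_pmf.expectation (W x) f) + B)" .
  moreover have "\<bar>measure_pmf.expectation (bind_pmf p W) f\<bar> \<le> B"
    using f by (intro expectation_abs_le) auto
  moreover have "\<bar>measure_pmf.expectation p (\<lambda>x. measure_pmf.expectation (W x) f)\<bar> \<le> B"
    by (rule expectation_abs_le[OF Wb])
  ultimately show ?thesis by (subst (asm) ennreal_inj) (auto simp: abs_le_iff)
qed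

lemma ex_le_nn_integral_pmf:
  fixes X :: "'c \<Rightarrow> ennreal" and q :: "'c pmf"
  obtains c where "X c \<le> (\<integral>\<^sup>+c. X c \<partial>q)"
proof (rule ccontr)
  assume "\<not> thesis"
  with that have less: "(\<integral>\<^sup>+c. X c \<partial>q) < X c" for c by (meson not_le)
  define m where "m = (\<integral>\<^sup>+c. X c \<partial>q)"
  have m: "m < \<top>" using less[of undefined] unfolding m_def[symmetric] by (rule less_le_trans) simp
  have "m = (\<integral>\<^sup>+c. (X c - m) + m \<partial>q)"
    unfolding m_def using less by (intro nn_integral_cong) (simp add: diff_add_cancel_ennreal less_imp_le)
  also have "\<dots> = (\<integral>\<^sup>+c. X c - m \<partial>q) + m" by (simp add: nn_integral_add)
  finally have "m + (\<integral>\<^sup>+c. X c - m \<partial>q) = m + 0" by (metis add.commute add_0_right)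
  then have "(\<integral>\<^sup>+c. X c - m \<partial>q) = 0"
    unfolding ennreal_add_left_cancel using m by auto
  then have "AE c in measure_pmf q. X c - m = 0" by (subst (asm) nn_integral_0_iff_AE) auto
  then obtain c where "c \<in> set_pmf q" "X c - m = 0"
    using set_pmf_not_empty[of q] by (auto simp: AE_measure_pmf_iff)
  then show False using less[of c] m by (auto simp: m_def diff_eq_0_iff_ennreal)
qed

text \<open>Random coding, derandomised by choosing the codewords one after the other: the weight \<open>f\<close> is the
  indicator of not being covered by the words chosen so far.\<close>

lemma random_covering:
  fixes A :: "'u \<Rightarrow> 'c \<Rightarrow> bool" and f :: "'u \<Rightarrow> ennreal" and q :: "'c pmf" and P :: "'u pmf"
  defines "g \<equiv> \<lambda>u. measure_pmf.prob q {c. A u c}"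
  shows "\<exists>cs. length cs = n \<and> (\<integral>\<^sup>+u. f u * indicator {u. \<forall>c\<in>set cs. \<not> A u c} u \<partial>P)
           \<le> (\<integral>\<^sup>+u. f u * ennreal ((1 - g u) ^ n) \<partial>P)"
proof (induction n arbitrary: f)
  case 0
  then show ?case by simp
next
  case (Suc n)
  let ?X = "\<lambda>c. \<integral>\<^sup>+u. f u * indicator {u. \<not> A u c} u * ennreal ((1 - g u) ^ n) \<partial>P"
  have g1: "0 \<le> 1 - g u" for u by (simp add: g_def)
  obtain c where "?X c \<le> (\<integral>\<^sup>+c. ?X c \<partial>q)" by (rule ex_le_nn_integral_pmf)
  also have "\<dots> = (\<integral>\<^sup>+u. \<integral>\<^sup>+c. f u * indicator {u. \<not> A u c} u * ennreal ((1 - g u) ^ n) \<partial>q \<partial>P)"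
    using nn_integral_pair_pmf'[where A = q and B = P and f = "\<lambda>(c, u). f u * indicator {u. \<not> A u c} u * ennreal ((1 - g u) ^ n)"]
      nn_integral_pair_pmf'[where A = P and B = q and f = "\<lambda>(u, c). f u * indicator {u. \<not> A u c} u * ennreal ((1 - g u) ^ n)"]
    by (subst (asm) pair_commute_pmf) (simp add: case_prod_unfold)
  also have "\<dots> = (\<integral>\<^sup>+u. f u * ennreal ((1 - g u) ^ Suc n) \<partial>P)"
  proof (rule nn_integral_cong)
    fix u
    have "(\<integral>\<^sup>+c. f u * indicator {u. \<not> A u c} u * ennreal ((1 - g u) ^ n) \<partial>q) =
        (\<integral>\<^sup>+c. (f u * ennreal ((1 - g u) ^ n)) * indicator {c. \<not> A u c} c \<partial>q)"
      by (intro nn_integral_cong) (auto simp: indicator_def)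
    also have "\<dots> = f u * ennreal ((1 - g u) ^ n) * emeasure (measure_pmf q) {c. \<not> A u c}"
      by (simp add: nn_integral_cmult)
    also have "emeasure (measure_pmf q) {c. \<not> A u c} = ennreal (1 - g u)"
      using measure_pmf.prob_compl[of "{c. A u c}" q]
      by (simp add: g_def measure_pmf.emeasure_eq_measure Compl_eq_Diff_UNIV[symmetric] Collect_neg_eq)
    also have "f u * ennreal ((1 - g u) ^ n) * ennreal (1 - g u) = f u * ennreal ((1 - g u) ^ Suc n)"
      using g1[of u] by (simp add: mult.assoc ennreal_mult mult.commute[of "ennreal (1 - g u)"])
    finally show "(\<integral>\<^sup>+c. f u * indicator {u. \<not> A u c} u * ennreal ((1 - g u) ^ n) \<partial>q) = f u * ennreal ((1 - g u) ^ Suc n)" .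
  qed
  finally have c: "?X c \<le> (\<integral>\<^sup>+u. f u * ennreal ((1 - g u) ^ Suc n) \<partial>P)" .
  from Suc.IH[of "\<lambda>u. f u * indicator {u. \<not> A u c} u"] obtain cs where cs: "length cs = n"
    "(\<integral>\<^sup>+u. f u * indicator {u. \<not> A u c} u * indicator {u. \<forall>c\<in>set cs. \<not> A u c} u \<partial>P) \<le> ?X c" by blast
  have "(\<integral>\<^sup>+u. f u * indicator {u. \<forall>c\<in>set (c # cs). \<not> A u c} u \<partial>P) =
      (\<integral>\<^sup>+u. f u * indicator {u. \<not> A u c} u * indicator {u. \<forall>c\<in>set cs. \<not> A u c} u \<partial>P)"
    by (intro nn_integral_cong) (auto simp: indicator_def)
  then show ?case using cs c by (intro exI[of _ "c # cs"]) auto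
qed

lemma covering_failure_bound:
  fixes g w t :: real
  assumes "0 \<le> g" "g \<le> 1" "0 \<le> w" "w \<le> 1" "0 \<le> t" "t * w \<le> g"
  shows "(1 - g) ^ n \<le> (1 - w) + exp (- (real n * t))"
proof -
  have "(1 - g) ^ n \<le> exp (- g) ^ n"
    using assms exp_ge_add_one_self[of "- g"] by (intro power_mono) auto
  also have "\<dots> = exp (- (real n * g))" by (simp add: exp_of_nat_mult[symmetric])
  also have "\<dots> \<le> exp (- (real n * (t * w)))" using assms by (simp add: mult_left_mono)
  also have "\<dots> = exp ((1 - w) * 0 + w * (- (real n * t)))" by (simp add: mult_ac)
  also have "\<dots> \<le> (1 - w) * exp 0 + w * exp (- (real n * t))"
    using convex_onD[OF exp_convex, of w 0 "- (real n * t)"] assms by simp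
  also have "\<dots> \<le> (1 - w) + exp (- (real n * t))"
    using assms by (simp add: mult_left_le_one_le)
  finally show ?thesis .
qed

lemma prob_change_of_measure:
  assumes "\<And>c. c \<in> A \<Longrightarrow> c \<in> set_pmf w \<Longrightarrow> pmf w c \<le> a * pmf q c" and "a \<ge> 0"
  shows "measure_pmf.prob w A \<le> a * measure_pmf.prob q A"
proof -
  have "emeasure (measure_pmf w) A = (\<integral>\<^sup>+c. ennreal (pmf w c) * indicator A c \<partial>count_space UNIV)"
    by (simp flip: nn_integral_measure_pmf)
  also have "\<dots> \<le> (\<integral>\<^sup>+c. ennreal a * (ennreal (pmf q c) * indicator A c) \<partial>count_space UNIV)"
  proof (rule nn_integral_mono)
    fix c
    have "pmf w c \<le> a * pmf q c" if "c \<in> A"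
      using assms(1)[OF that] assms(2) by (cases "c \<in> set_pmf w") (auto simp: set_pmf_iff)
    then show "ennreal (pmf w c) * indicator A c \<le> ennreal a * (ennreal (pmf q c) * indicator A c)"
      using assms(2) by (auto simp: indicator_def ennreal_mult[symmetric])
  qed
  also have "\<dots> = ennreal a * emeasure (measure_pmf q) A"
    by (simp add: nn_integral_cmult flip: nn_integral_measure_pmf)
  finally show ?thesis using assms(2)
    by (simp add: measure_pmf.emeasure_eq_measure ennreal_mult[symmetric])
qed

lemma Pi_pmf_second_moment:
  fixes Y :: "'i \<Rightarrow> 'c \<Rightarrow> real"
  assumes I: "finite I" and Y: "\<And>i y. i \<in> I \<Longrightarrow> \<bar>Y i y\<bar> \<le> C" and mean: "\<And>i. i \<in> I \<Longrightarrow> measure_pmf.expectation (w i) (Y i) = 0"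
  shows "measure_pmf.expectation (Pi_pmf I dflt w) (\<lambda>f. (\<Sum>i\<in>I. Y i (f i))\<^sup>2) \<le> real (card I) * C\<^sup>2"
proof -
  let ?P = "Pi_pmf I dflt w"
  have int: "integrable ?P (\<lambda>f. Y i (f i) * Y j (f j))" if "i \<in> I" "j \<in> I" for i j
    using Y that by (intro measure_pmf.integrable_const_bound[of _ "C * C"])
      (auto simp: abs_mult intro!: always_eventually mult_mono order.trans[OF abs_ge_zero])
  have comp: "measure_pmf.expectation ?P (\<lambda>f. Y i (f i)) = 0" if "i \<in> I" for i
  proof -
    have "measure_pmf.expectation ?P (\<lambda>f. Y i (f i)) = measure_pmf.expectation (map_pmf (\<lambda>f. f i) ?P) (Y i)" by simp
    then show ?thesis using that by (simp only: Pi_pmf_component[OF I] mean if_True)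
  qed
  have ij: "measure_pmf.expectation ?P (\<lambda>f. Y i (f i) * Y j (f j)) = 0" if "i \<in> I" "j \<in> I" "i \<noteq> j" for i j
  proof -
    have "prob_space.indep_vars (measure_pmf ?P) (\<lambda>_. borel) (\<lambda>i f. Y i (f i)) {i, j}"
      using that by (intro prob_space.indep_vars_compose2[OF measure_pmf.prob_space_axioms
        prob_space.indep_vars_subset[OF measure_pmf.prob_space_axioms indep_vars_Pi_pmf[OF I]]]) auto
    then have "measure_pmf.expectation ?P (\<lambda>f. \<Prod>l\<in>{i, j}. Y l (f l)) = (\<Prod>l\<in>{i, j}. measure_pmf.expectation ?P (\<lambda>f. Y l (f l)))"
      using Y that by (intro prob_space.indep_vars_lebesgue_integral[OF measure_pmf.prob_space_axioms])
        (auto intro!: measure_pmf.integrable_const_bound[of _ C] always_eventually)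
    then show ?thesis using that by (simp add: comp)
  qed
  have "measure_pmf.expectation ?P (\<lambda>f. (\<Sum>i\<in>I. Y i (f i))\<^sup>2) = (\<Sum>i\<in>I. \<Sum>j\<in>I. measure_pmf.expectation ?P (\<lambda>f. Y i (f i) * Y j (f j)))"
    unfolding power2_eq_square sum_product
    by (subst Bochner_Integration.integral_sum) (auto intro!: Bochner_Integration.integral_sum sum.cong Bochner_Integration.integrable_sum int)
  also have "\<dots> = (\<Sum>i\<in>I. \<Sum>j\<in>I. if i = j then measure_pmf.expectation ?P (\<lambda>f. Y i (f i) * Y i (f i)) else 0)"
    by (intro sum.cong refl) (auto simp: ij)
  also have "\<dots> = (\<Sum>i\<in>I. measure_pmf.expectation ?P (\<lambda>f. Y i (f i) * Y i (f i)))" using I by simp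
  also have "\<dots> \<le> (\<Sum>i\<in>I. C\<^sup>2)"
  proof (rule sum_mono)
    fix i assume i: "i \<in> I"
    have "Y i y * Y i y \<le> C\<^sup>2" for y
      using power_mono[OF Y[OF i, of y] abs_ge_zero, of 2] by (simp add: power2_eq_square)
    then show "measure_pmf.expectation ?P (\<lambda>f. Y i (f i) * Y i (f i)) \<le> C\<^sup>2"
      using int[OF i i] by (intro measure_pmf.integral_le_const) auto
  qed
  finally show ?thesis by simp
qed

section \<open>The law of large numbers for blocks\<close>

definition source_blk :: "nat \<Rightarrow> nat \<Rightarrow> nat \<Rightarrow> 'u list \<Rightarrow> 'u list" where
  "source_blk k n b us = take k (drop (b * k + b div n) us)"

definition block_channel :: "nat \<Rightarrow> nat \<Rightarrow> ('u list \<Rightarrow> 'v list pmf) \<Rightarrow> 'u list \<Rightarrow> (nat \<Rightarrow> 'v list) pmf" where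
  "block_channel k n W us = Pi_pmf {..<k * n} [] (\<lambda>b. W (source_blk k n b us))"

lemma block_end_le:
  fixes b k n :: nat
  assumes "b < k * n"
  shows "b * k + b div n + k \<le> k * (k * n + 1)"
proof -
  have n: "n > 0" using assms by (cases n) auto
  have "b div n < k" using assms n by (simp add: less_mult_imp_div_less)
  moreover have "b * k + k \<le> (k * n) * k" using assms mult_le_mono1[of "Suc b" "k * n" k] by simp
  ultimately show ?thesis by (simp add: algebra_simps)
qed

context ergodic_source
begin

lemma map_source_blk:
  assumes "b < k * n" "k * (k * n + 1) \<le> N"
  shows "map_pmf (source_blk k n b) (source_block \<mu> N) = source_block \<mu> k"
  unfolding source_blk_def using block_end_le[OF assms(1)] assms(2) by (intro map_source_block) auto

lemma nn_integral_block_marginal: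
  assumes b: "b < k * n" "k * (k * n + 1) \<le> N"
  shows "(\<integral>\<^sup>+us. \<integral>\<^sup>+v. G (source_blk k n b us, v b) \<partial>block_channel k n W us \<partial>source_block \<mu> N) =
    (\<integral>\<^sup>+x. G x \<partial>test_channel_joint \<mu> k W)"
proof -
  have "(\<integral>\<^sup>+v. G (source_blk k n b us, v b) \<partial>block_channel k n W us) =
      (\<integral>\<^sup>+v. G (source_blk k n b us, v) \<partial>W (source_blk k n b us))" for us
  proof -
    have "map_pmf (\<lambda>v. v b) (block_channel k n W us) = W (source_blk k n b us)"
      using b by (simp add: block_channel_def Pi_pmf_component)
    then have "(\<integral>\<^sup>+v. G (source_blk k n b us, v) \<partial>W (source_blk k n b us)) =
      (\<integral>\<^sup>+v. G (source_blk k n b us, v) \<partial>map_pmf (\<lambda>v. v b) (block_channel k n W us))" by simp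
    then show ?thesis by simp
  qed
  then have "(\<integral>\<^sup>+us. \<integral>\<^sup>+v. G (source_blk k n b us, v b) \<partial>block_channel k n W us \<partial>source_block \<mu> N) =
     (\<integral>\<^sup>+us. (\<integral>\<^sup>+v. G (us, v) \<partial>W us) \<partial>map_pmf (source_blk k n b) (source_block \<mu> N))" by simp
  also have "\<dots> = (\<integral>\<^sup>+x. G x \<partial>test_channel_joint \<mu> k W)"
    by (simp add: map_source_blk[OF b] test_channel_joint_def)
  finally show ?thesis .
qed

lemma block_conditional_mean:
  fixes h :: "'u list \<times> 'v list \<Rightarrow> real" and W :: "'u list \<Rightarrow> 'v list pmf"
  assumes h: "\<And>x. \<bar>h x\<bar> \<le> c" and "\<eta> > 0" and kn: "k * n \<ge> 1"
  defines "\<phi> \<equiv> \<lambda>ub. measure_pmf.expectation (W ub) (\<lambda>v. h (ub, v))"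
  shows "(\<integral>\<^sup>+v. ennreal \<bar>(\<Sum>b<k * n. h (source_blk k n b us, v b)) / real (k * n) - (\<Sum>b<k * n. \<phi> (source_blk k n b us)) / real (k * n)\<bar>
      \<partial>block_channel k n W us) \<le> ennreal (\<eta> + 4 * c\<^sup>2 / (\<eta> * real (k * n)))"
proof -
  define M where "M = k * n"
  define Y where "Y b v = h (source_blk k n b us, v) - \<phi> (source_blk k n b us)" for b v
  have c0: "0 \<le> c" using h[of undefined] by linarith
  have \<phi>b: "\<bar>\<phi> ub\<bar> \<le> c" for ub
    unfolding \<phi>_def using h by (intro expectation_abs_le) auto
  have Yb: "\<bar>Y b v\<bar> \<le> 2 * c" for b v
    using h[of "(source_blk k n b us, v)"] \<phi>b[of "source_blk k n b us"] by (simp add: Y_def abs_le_iff)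
  have Y0: "measure_pmf.expectation (W (source_blk k n b us)) (Y b) = 0" for b
    unfolding Y_def using integrable_pmf_bounded[of "\<lambda>v. h (source_blk k n b us, v)" c, OF h] by (simp add: \<phi>_def)
  let ?P = "block_channel k n W us"
  let ?S = "\<lambda>v. \<Sum>b<M. Y b (v b)"
  have Sb: "\<bar>?S v\<bar> \<le> real M * (2 * c)" for v
  proof -
    have "\<bar>?S v\<bar> \<le> (\<Sum>b<M. 2 * c)" by (intro order.trans[OF sum_abs] sum_mono Yb)
    then show ?thesis by simp
  qed
  have S2b: "\<bar>(?S v)\<^sup>2\<bar> \<le> (real M * (2 * c))\<^sup>2" for v
    using power_mono[OF Sb[of v] abs_ge_zero, of 2] by simp
  have ES2: "measure_pmf.expectation ?P (\<lambda>v. (?S v)\<^sup>2) \<le> real M * (2 * c)\<^sup>2"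
    using Pi_pmf_second_moment[of "{..<M}" Y "2 * c" "\<lambda>b. W (source_blk k n b us)" "[]", OF _ Yb Y0]
    by (simp add: block_channel_def M_def)
  have M: "real M > 0" using kn by (simp add: M_def)
  have pt: "\<bar>?S v / real M\<bar> \<le> \<eta> + (?S v)\<^sup>2 / (\<eta> * (real M)\<^sup>2)" for v
  proof -
    define x where "x = \<bar>?S v / real M\<bar>"
    have "0 \<le> (x - \<eta>)\<^sup>2" by simp
    then have "2 * (\<eta> * x) \<le> \<eta>\<^sup>2 + x\<^sup>2"
      by (simp add: power2_eq_square algebra_simps)
    moreover have "0 \<le> \<eta> * x" using \<open>\<eta> > 0\<close> by (simp add: x_def)
    ultimately have "\<eta> * x \<le> \<eta>\<^sup>2 + x\<^sup>2" by linarith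
    then have "x \<le> \<eta> + x\<^sup>2 / \<eta>" using \<open>\<eta> > 0\<close> by (simp add: field_simps power2_eq_square)
    then show ?thesis by (simp add: x_def power_divide mult.commute[of \<eta>])
  qed
  have "(\<integral>\<^sup>+v. ennreal \<bar>?S v / real M\<bar> \<partial>?P) \<le> (\<integral>\<^sup>+v. ennreal (\<eta> + (?S v)\<^sup>2 / (\<eta> * (real M)\<^sup>2)) \<partial>?P)"
    by (intro nn_integral_mono ennreal_leI pt)
  also have "\<dots> = ennreal (measure_pmf.expectation ?P (\<lambda>v. \<eta> + (?S v)\<^sup>2 / (\<eta> * (real M)\<^sup>2)))"
    using \<open>\<eta> > 0\<close> integrable_pmf_bounded[of "\<lambda>v. (?S v)\<^sup>2", OF S2b, of ?P] by (intro nn_integral_eq_integral) auto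
  also have "measure_pmf.expectation ?P (\<lambda>v. \<eta> + (?S v)\<^sup>2 / (\<eta> * (real M)\<^sup>2)) = \<eta> + measure_pmf.expectation ?P (\<lambda>v. (?S v)\<^sup>2) / (\<eta> * (real M)\<^sup>2)"
    using integrable_pmf_bounded[of "\<lambda>v. (?S v)\<^sup>2", OF S2b, of ?P] by simp
  also have "ennreal \<dots> \<le> ennreal (\<eta> + (real M * (2 * c)\<^sup>2) / (\<eta> * (real M)\<^sup>2))"
    using ES2 \<open>\<eta> > 0\<close> by (intro ennreal_leI add_left_mono divide_right_mono) auto
  also have "(real M * (2 * c)\<^sup>2) / (\<eta> * (real M)\<^sup>2) = 4 * c\<^sup>2 / (\<eta> * real M)"
    using M \<open>\<eta> > 0\<close> by (simp add: power2_eq_square field_simps)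
  finally show ?thesis
    by (simp add: M_def Y_def sum_subtractf diff_divide_distrib)
qed

lemma block_law_of_large_numbers_bounded:
  fixes h :: "'u list \<times> 'v::countable list \<Rightarrow> real"
  assumes h: "\<And>x. \<bar>h x\<bar> \<le> c" and k: "k \<ge> 1" and e: "e > 0"
  shows "\<forall>\<^sub>F n in sequentially. \<forall>N\<ge>k * (k * n + 1).
     (\<integral>\<^sup>+us. \<integral>\<^sup>+v. ennreal \<bar>(\<Sum>b<k * n. h (source_blk k n b us, v b)) / real (k * n) - measure_pmf.expectation (test_channel_joint \<mu> k W) h\<bar>
        \<partial>block_channel k n W us \<partial>source_block \<mu> N) \<le> ennreal e"
proof -
  define \<phi> where "\<phi> ub = measure_pmf.expectation (W ub) (\<lambda>v. h (ub, v))" for ub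
  define f where "f \<omega> = \<phi> (map \<omega> [0..<k])" for \<omega>
  define m where "m = measure_pmf.expectation (test_channel_joint \<mu> k W) h"
  have \<phi>b: "\<bar>\<phi> ub\<bar> \<le> c" for ub
    unfolding \<phi>_def using h by (intro expectation_abs_le) auto
  have fm: "f \<in> borel_measurable \<mu>" unfolding f_def[abs_def] by (rule measurable_compose[OF block_measurable]) simp
  have "m = measure_pmf.expectation (source_block \<mu> k) \<phi>"
    unfolding m_def test_channel_joint_def by (subst expectation_bind_pmf[where B = c]) (auto simp: h \<phi>_def[abs_def])
  also have "\<dots> = (\<integral>\<omega>. f \<omega> \<partial>\<mu>)"
    unfolding measure_pmf_source_block f_def by (subst integral_distr) auto
  finally have m: "m = (\<integral>\<omega>. f \<omega> \<partial>\<mu>)" .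
  have lim: "(\<lambda>n. \<integral>\<omega>. \<bar>(\<Sum>b<k * n. f ((seq_shift ^^ block_pos k n b) \<omega>)) / real (k * n) - m\<bar> \<partial>\<mu>) \<longlonglongrightarrow> 0"
    unfolding m by (rule phase_average_L1[OF fm _ k, of c]) (simp add: f_def \<phi>b)
  have lim2: "(\<lambda>n. 4 * c\<^sup>2 / (e / 4 * real (k * n))) \<longlonglongrightarrow> 0"
  proof -
    have "(\<lambda>n. (4 * c\<^sup>2 / (e / 4 * real k)) / real n) \<longlonglongrightarrow> 0" by (rule lim_const_over_n)
    then show ?thesis by (simp add: divide_divide_eq_left mult.assoc)
  qed
  have "\<forall>\<^sub>F n in sequentially. (\<integral>\<omega>. \<bar>(\<Sum>b<k * n. f ((seq_shift ^^ block_pos k n b) \<omega>)) / real (k * n) - m\<bar> \<partial>\<mu>) < e / 2"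
    by (rule order_tendstoD(2)[OF lim]) (use e in simp)
  moreover have "\<forall>\<^sub>F n in sequentially. 4 * c\<^sup>2 / (e / 4 * real (k * n)) < e / 4"
    by (rule order_tendstoD(2)[OF lim2]) (use e in simp)
  ultimately show ?thesis using eventually_ge_at_top[of 1] unfolding m_def[symmetric]
  proof eventually_elim
    case (elim n)
    show ?case
    proof (intro allI impI)
      fix N assume N: "k * (k * n + 1) \<le> N"
      have kn: "k * n \<ge> 1" using elim k by (metis mult_le_mono nat_mult_1)
      let ?\<Phi> = "\<lambda>us. (\<Sum>b<k * n. \<phi> (source_blk k n b us)) / real (k * n)"
      let ?X = "\<lambda>us v. (\<Sum>b<k * n. h (source_blk k n b us, v b)) / real (k * n)"
      have "(\<integral>\<^sup>+us. \<integral>\<^sup>+v. ennreal \<bar>?X us v - m\<bar> \<partial>block_channel k n W us \<partial>source_block \<mu> N) \<le>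
        (\<integral>\<^sup>+us. (\<integral>\<^sup>+v. ennreal \<bar>?X us v - ?\<Phi> us\<bar> + ennreal \<bar>?\<Phi> us - m\<bar> \<partial>block_channel k n W us) \<partial>source_block \<mu> N)"
      proof (intro nn_integral_mono)
        fix us v
        have "\<bar>?X us v - m\<bar> \<le> \<bar>?X us v - ?\<Phi> us\<bar> + \<bar>?\<Phi> us - m\<bar>" by linarith
        from ennreal_leI[OF this] show "ennreal \<bar>?X us v - m\<bar> \<le> ennreal \<bar>?X us v - ?\<Phi> us\<bar> + ennreal \<bar>?\<Phi> us - m\<bar>"
          by (subst (asm) ennreal_plus) auto
      qed
      also have "\<dots> = (\<integral>\<^sup>+us. (\<integral>\<^sup>+v. ennreal \<bar>?X us v - ?\<Phi> us\<bar> \<partial>block_channel k n W us) + ennreal \<bar>?\<Phi> us - m\<bar> \<partial>source_block \<mu> N)"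
        by (simp add: nn_integral_add)
      also have "\<dots> \<le> (\<integral>\<^sup>+us. ennreal (e / 4 + 4 * c\<^sup>2 / (e / 4 * real (k * n))) + ennreal \<bar>?\<Phi> us - m\<bar> \<partial>source_block \<mu> N)"
        unfolding \<phi>_def using e by (intro nn_integral_mono add_right_mono block_conditional_mean[OF h _ kn]) auto
      also have "\<dots> \<le> (\<integral>\<^sup>+us. ennreal (e / 2) + ennreal \<bar>?\<Phi> us - m\<bar> \<partial>source_block \<mu> N)"
        using elim e by (intro nn_integral_mono add_right_mono ennreal_leI) auto
      also have "\<dots> = ennreal (e / 2) + (\<integral>\<^sup>+us. ennreal \<bar>?\<Phi> us - m\<bar> \<partial>source_block \<mu> N)"
        by (simp add: nn_integral_add)
      also have "(\<integral>\<^sup>+us. ennreal \<bar>?\<Phi> us - m\<bar> \<partial>source_block \<mu> N) =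
          (\<integral>\<^sup>+\<omega>. ennreal \<bar>(\<Sum>b<k * n. f ((seq_shift ^^ block_pos k n b) \<omega>)) / real (k * n) - m\<bar> \<partial>\<mu>)"
      proof -
        have "source_blk k n b (map \<omega> [0..<N]) = map ((seq_shift ^^ block_pos k n b) \<omega>) [0..<k]" if "b < k * n" for b and \<omega> :: "nat \<Rightarrow> 'u"
          using block_end_le[OF that] N
          by (auto simp: source_blk_def seq_shift_funpow block_pos_def list_eq_iff_nth_eq add_ac)
        then have \<Phi>: "?\<Phi> (map \<omega> [0..<N]) = (\<Sum>b<k * n. f ((seq_shift ^^ block_pos k n b) \<omega>)) / real (k * n)" for \<omega>
          by (simp add: f_def)
        have "(\<integral>\<^sup>+us. ennreal \<bar>?\<Phi> us - m\<bar> \<partial>source_block \<mu> N) = (\<integral>\<^sup>+\<omega>. ennreal \<bar>?\<Phi> (map \<omega> [0..<N]) - m\<bar> \<partial>\<mu>)"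
          unfolding measure_pmf_source_block by (rule nn_integral_distr) auto
        then show ?thesis by (simp only: \<Phi>)
      qed
      also have "\<dots> = ennreal (\<integral>\<omega>. \<bar>(\<Sum>b<k * n. f ((seq_shift ^^ block_pos k n b) \<omega>)) / real (k * n) - m\<bar> \<partial>\<mu>)"
      proof (rule nn_integral_eq_integral)
        interpret T: measure_preserving \<mu> "seq_shift ^^ 1" by (rule measure_preserving_shift)
        have "(\<lambda>\<omega>. f ((seq_shift ^^ i) \<omega>)) \<in> borel_measurable \<mu>" for i
          using T.S_funpow_compose_measurable[OF fm, of i] by simp
        then show "integrable \<mu> (\<lambda>\<omega>. \<bar>(\<Sum>b<k * n. f ((seq_shift ^^ block_pos k n b) \<omega>)) / real (k * n) - m\<bar>)"
          by (intro integrable_abs Bochner_Integration.integrable_diff[OF _ integrable_const] integrable_divide Bochner_Integration.integrable_sum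
              integrable_const_bound[of _ c]) (auto simp: f_def \<phi>b)
      qed auto
      also have "ennreal (e / 2) + \<dots> \<le> ennreal (e / 2) + ennreal (e / 2)"
        using elim by (intro add_left_mono ennreal_leI) auto
      also have "\<dots> = ennreal e" using e by (simp flip: ennreal_plus)
      finally show "(\<integral>\<^sup>+us. \<integral>\<^sup>+v. ennreal \<bar>?X us v - m\<bar> \<partial>block_channel k n W us \<partial>source_block \<mu> N) \<le> ennreal e" .
    qed
  qed
qed

lemma truncate_L1:
  fixes h :: "'c \<Rightarrow> real" and p :: "'c pmf"
  assumes "integrable p h" "e > 0"
  obtains c :: real where "c \<ge> 0" "(\<integral>\<^sup>+x. ennreal \<bar>h x - (if \<bar>h x\<bar> \<le> c then h x else 0)\<bar> \<partial>p) \<le> ennreal e"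
proof -
  have "(\<lambda>i. \<integral>x. \<bar>h x - (if \<bar>h x\<bar> \<le> real i then h x else 0)\<bar> \<partial>p) \<longlonglongrightarrow> (\<integral>x. 0 \<partial>p)"
  proof (rule integral_dominated_convergence[where w = "\<lambda>x. \<bar>h x\<bar>"])
    show "AE x in p. (\<lambda>i. \<bar>h x - (if \<bar>h x\<bar> \<le> real i then h x else 0)\<bar>) \<longlonglongrightarrow> 0"
    proof (rule AE_I2, rule tendsto_eventually)
      fix x
      obtain i0 :: nat where "\<bar>h x\<bar> \<le> real i0" using real_arch_simple by blast
      then show "\<forall>\<^sub>F i in sequentially. \<bar>h x - (if \<bar>h x\<bar> \<le> real i then h x else 0)\<bar> = 0"
        by (intro eventually_sequentiallyI[of i0]) auto
    qed
  qed (use assms in auto)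
  then have "(\<lambda>i. \<integral>x. \<bar>h x - (if \<bar>h x\<bar> \<le> real i then h x else 0)\<bar> \<partial>p) \<longlonglongrightarrow> 0"
    unfolding Bochner_Integration.integral_zero .
  from order_tendstoD(2)[OF this assms(2)]
  have "\<forall>\<^sub>F i in sequentially. (\<integral>x. \<bar>h x - (if \<bar>h x\<bar> \<le> real i then h x else 0)\<bar> \<partial>p) < e" .
  then obtain i where i: "(\<integral>x. \<bar>h x - (if \<bar>h x\<bar> \<le> real i then h x else 0)\<bar> \<partial>p) < e"
    by (auto dest: eventually_happens)
  have "integrable p (\<lambda>x. \<bar>h x - (if \<bar>h x\<bar> \<le> real i then h x else 0)\<bar>)"
    by (rule Bochner_Integration.integrable_bound[OF assms(1)]) auto
  then have "(\<integral>\<^sup>+x. ennreal \<bar>h x - (if \<bar>h x\<bar> \<le> real i then h x else 0)\<bar> \<partial>p) =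
      ennreal (\<integral>x. \<bar>h x - (if \<bar>h x\<bar> \<le> real i then h x else 0)\<bar> \<partial>p)"
    by (intro nn_integral_eq_integral) auto
  also have "\<dots> \<le> ennreal e" using i by (intro ennreal_leI) simp
  finally show ?thesis by (intro that[of "real i"]) auto
qed

lemma block_law_of_large_numbers:
  fixes h :: "'u list \<times> 'v::countable list \<Rightarrow> real"
  assumes h: "integrable (test_channel_joint \<mu> k W) h" and k: "k \<ge> 1" and e: "e > 0"
  shows "\<forall>\<^sub>F n in sequentially. \<forall>N\<ge>k * (k * n + 1).
     (\<integral>\<^sup>+us. \<integral>\<^sup>+v. ennreal \<bar>(\<Sum>b<k * n. h (source_blk k n b us, v b)) / real (k * n) - measure_pmf.expectation (test_channel_joint \<mu> k W) h\<bar>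
        \<partial>block_channel k n W us \<partial>source_block \<mu> N) \<le> ennreal e"
proof -
  let ?p = "test_channel_joint \<mu> k W"
  have e3: "e / 3 > 0" using e by simp
  obtain c where c: "c \<ge> 0" "(\<integral>\<^sup>+x. ennreal \<bar>h x - (if \<bar>h x\<bar> \<le> c then h x else 0)\<bar> \<partial>?p) \<le> ennreal (e / 3)"
    by (rule truncate_L1[OF h e3])
  define h1 where "h1 x = (if \<bar>h x\<bar> \<le> c then h x else 0)" for x
  define m m1 where "m = measure_pmf.expectation ?p h" and "m1 = measure_pmf.expectation ?p h1"
  have h1b: "\<bar>h1 x\<bar> \<le> c" for x using c by (simp add: h1_def)
  have i1: "integrable ?p h1" using h1b by (intro measure_pmf.integrable_const_bound[of _ c]) auto
  have c2: "(\<integral>\<^sup>+x. ennreal \<bar>h x - h1 x\<bar> \<partial>?p) \<le> ennreal (e / 3)" using c(2) by (simp add: h1_def)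
  have mm: "ennreal \<bar>m1 - m\<bar> \<le> ennreal (e / 3)"
  proof -
    have "\<bar>m1 - m\<bar> = \<bar>\<integral>x. h x - h1 x \<partial>?p\<bar>" using h i1 by (simp add: m_def m1_def)
    also have "ennreal \<dots> \<le> ennreal (\<integral>x. \<bar>h x - h1 x\<bar> \<partial>?p)" by (intro ennreal_leI integral_abs_bound)
    also have "\<dots> = (\<integral>\<^sup>+x. ennreal \<bar>h x - h1 x\<bar> \<partial>?p)" using h i1 by (intro nn_integral_eq_integral[symmetric]) auto
    also note c2
    finally show ?thesis .
  qed
  show ?thesis
    using block_law_of_large_numbers_bounded[where h = h1 and c = c and W = W, OF h1b k e3] eventually_ge_at_top[of 1]
    unfolding m_def[symmetric] m1_def[symmetric]
  proof eventually_elim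
    case (elim n)
    show ?case
    proof (intro allI impI)
      fix N assume N: "k * (k * n + 1) \<le> N"
      have kn: "real (k * n) > 0" using elim k by simp
      let ?X = "\<lambda>h us v. (\<Sum>b<k * n. h (source_blk k n b us, v b)) / real (k * n)"
      let ?J = "\<lambda>F. (\<integral>\<^sup>+us. \<integral>\<^sup>+v. F us v \<partial>block_channel k n W us \<partial>source_block \<mu> N)"
      have "?J (\<lambda>us v. ennreal \<bar>?X h us v - m\<bar>) \<le> ?J (\<lambda>us v. ennreal \<bar>?X h1 us v - m1\<bar> +
          ((\<Sum>b<k * n. ennreal \<bar>h (source_blk k n b us, v b) - h1 (source_blk k n b us, v b)\<bar>) * ennreal (1 / real (k * n)) + ennreal \<bar>m1 - m\<bar>))"
      proof (intro nn_integral_mono)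
        fix us v
        have "\<bar>?X h us v - ?X h1 us v\<bar> \<le> (\<Sum>b<k * n. \<bar>h (source_blk k n b us, v b) - h1 (source_blk k n b us, v b)\<bar>) / real (k * n)"
          unfolding diff_divide_distrib[symmetric] sum_subtractf[symmetric] abs_divide abs_of_nat
          by (intro divide_right_mono sum_abs) simp
        then have "\<bar>?X h us v - m\<bar> \<le> \<bar>?X h1 us v - m1\<bar> +
          ((\<Sum>b<k * n. \<bar>h (source_blk k n b us, v b) - h1 (source_blk k n b us, v b)\<bar>) / real (k * n) + \<bar>m1 - m\<bar>)" by linarith
        from ennreal_leI[OF this] show "ennreal \<bar>?X h us v - m\<bar> \<le> ennreal \<bar>?X h1 us v - m1\<bar> +
          ((\<Sum>b<k * n. ennreal \<bar>h (source_blk k n b us, v b) - h1 (source_blk k n b us, v b)\<bar>) * ennreal (1 / real (k * n)) + ennreal \<bar>m1 - m\<bar>)"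
          by (simp add: ennreal_plus sum_nonneg divide_inverse ennreal_mult'' flip: sum_ennreal)
      qed
      also have "\<dots> = ?J (\<lambda>us v. ennreal \<bar>?X h1 us v - m1\<bar>) +
          ((\<Sum>b<k * n. ?J (\<lambda>us v. ennreal \<bar>h (source_blk k n b us, v b) - h1 (source_blk k n b us, v b)\<bar>)) * ennreal (1 / real (k * n)) + ennreal \<bar>m1 - m\<bar>)"
        by (simp add: nn_integral_add nn_integral_sum nn_integral_multc del: sum_ennreal)
      also have "\<dots> \<le> ennreal (e / 3) + (ennreal (e / 3) + ennreal (e / 3))"
      proof (intro add_mono mm)
        show "?J (\<lambda>us v. ennreal \<bar>?X h1 us v - m1\<bar>) \<le> ennreal (e / 3)" using elim N by blast
        have "(\<Sum>b<k * n. ?J (\<lambda>us v. ennreal \<bar>h (source_blk k n b us, v b) - h1 (source_blk k n b us, v b)\<bar>)) * ennreal (1 / real (k * n)) =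
            (\<Sum>b<k * n. (\<integral>\<^sup>+x. ennreal \<bar>h x - h1 x\<bar> \<partial>?p)) * ennreal (1 / real (k * n))"
          by (intro arg_cong2[where f = "(*)"] sum.cong refl nn_integral_block_marginal[where G = "\<lambda>x. ennreal \<bar>h x - h1 x\<bar>"] N) auto
        also have "\<dots> \<le> (\<Sum>b<k * n. ennreal (e / 3)) * ennreal (1 / real (k * n))"
          by (intro mult_right_mono sum_mono c2) simp
        also have "\<dots> = ennreal (real (k * n) * (e / 3) * (1 / real (k * n)))"
          using e by (subst sum_ennreal) (auto simp: ennreal_mult[symmetric])
        also have "real (k * n) * (e / 3) * (1 / real (k * n)) = e / 3" using kn by (simp del: of_nat_mult)
        finally show "(\<Sum>b<k * n. ?J (\<lambda>us v. ennreal \<bar>h (source_blk k n b us, v b) - h1 (source_blk k n b us, v b)\<bar>)) * ennreal (1 / real (k * n)) \<le> ennreal (e / 3)" .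
      qed
      also have "\<dots> = ennreal e" using e by (simp flip: ennreal_plus)
      finally show "?J (\<lambda>us v. ennreal \<bar>?X h us v - m\<bar>) \<le> ennreal e" .
    qed
  qed
qed

end

section \<open>Source coding\<close>

definition place_blocks :: "nat \<Rightarrow> nat \<Rightarrow> nat \<Rightarrow> (nat \<Rightarrow> 'v list) \<Rightarrow> 'v list" where
  "place_blocks k n N v = map (\<lambda>i. let b = (SOME b. b < k * n \<and> b * k + b div n \<le> i \<and> i < b * k + b div n + k)
     in v b ! (i - (b * k + b div n))) [0..<N]"

lemma length_place_blocks [simp]: "length (place_blocks k n N v) = N"
  by (simp add: place_blocks_def)

lemma block_disjoint:
  fixes b b' k n :: nat
  assumes "b < b'"
  shows "b * k + b div n + k \<le> b' * k + b' div n"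
proof -
  have "b * k + k \<le> b' * k" using assms mult_le_mono1[of "Suc b" b' k] by simp
  moreover have "b div n \<le> b' div n" using assms by (intro div_le_mono) simp
  ultimately show ?thesis by linarith
qed

lemma place_blocks_nth:
  assumes b: "b < k * n" and i: "i < k" and N: "k * (k * n + 1) \<le> N"
  shows "place_blocks k n N v ! (b * k + b div n + i) = v b ! i"
proof -
  have "(SOME b'. b' < k * n \<and> b' * k + b' div n \<le> b * k + b div n + i \<and> b * k + b div n + i < b' * k + b' div n + k) = b"
  proof (rule some_equality)
    fix b' assume b': "b' < k * n \<and> b' * k + b' div n \<le> b * k + b div n + i \<and> b * k + b div n + i < b' * k + b' div n + k"
    show "b' = b"
      using b' i block_disjoint[of b b' k n] block_disjoint[of b' b k n] by (cases b b' rule: linorder_cases) auto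
  qed (use b i in auto)
  moreover have "b * k + b div n + i < N" using block_end_le[OF b] i N by linarith
  ultimately show ?thesis by (simp add: place_blocks_def)
qed

lemma place_blocks_distortion:
  fixes d :: "'u \<Rightarrow> 'v \<Rightarrow> real"
  assumes d: "\<And>u v. 0 \<le> d u v" "\<And>u v. d u v \<le> B" and N: "k * (k * n + 1) \<le> N" and us: "length us = N"
  shows "(\<Sum>i<N. d (us ! i) (place_blocks k n N v ! i)) \<le>
    (\<Sum>b<k * n. \<Sum>j<k. d (source_blk k n b us ! j) (v b ! j)) + (real N - real (k * (k * n))) * B"
proof -
  define I where "I b = {b * k + b div n..<b * k + b div n + k}" for b
  define U where "U = (\<Union>b\<in>{..<k * n}. I b)"
  let ?F = "\<lambda>i. d (us ! i) (place_blocks k n N v ! i)"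
  have disj: "I b \<inter> I b' = {}" if "b \<noteq> b'" for b b'
    using that block_disjoint[of b b' k n] block_disjoint[of b' b k n]
    by (cases b b' rule: linorder_cases) (auto simp: I_def)
  have UN: "U \<subseteq> {..<N}" using block_end_le[of _ k n] N by (force simp: U_def I_def)
  have fin: "finite U" using UN finite_subset by blast
  have cardU: "card U = k * (k * n)"
    unfolding U_def using disj by (subst card_UN_disjoint) (auto simp: I_def)
  have "(\<Sum>i<N. ?F i) = (\<Sum>i\<in>U. ?F i) + (\<Sum>i\<in>{..<N} - U. ?F i)"
    using UN fin by (metis add.commute finite_lessThan sum.subset_diff)
  also have "(\<Sum>i\<in>U. ?F i) = (\<Sum>b<k * n. \<Sum>i\<in>I b. ?F i)"
    unfolding U_def using disj by (intro sum.UNION_disjoint) (auto simp: I_def)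
  also have "\<dots> = (\<Sum>b<k * n. \<Sum>j<k. d (source_blk k n b us ! j) (v b ! j))"
  proof (rule sum.cong[OF refl])
    fix b assume b: "b \<in> {..<k * n}"
    have "(\<Sum>i\<in>I b. ?F i) = (\<Sum>j<k. ?F (b * k + b div n + j))"
      unfolding I_def by (rule sum.reindex_bij_witness[of _ "\<lambda>j. b * k + b div n + j" "\<lambda>i. i - (b * k + b div n)"]) auto
    also have "\<dots> = (\<Sum>j<k. d (source_blk k n b us ! j) (v b ! j))"
      using b block_end_le[of b k n] N us
      by (intro sum.cong refl) (auto simp: place_blocks_nth source_blk_def)
    finally show "(\<Sum>i\<in>I b. ?F i) = (\<Sum>j<k. d (source_blk k n b us ! j) (v b ! j))" .
  qed
  also have "(\<Sum>i\<in>{..<N} - U. ?F i) \<le> (\<Sum>i\<in>{..<N} - U. B)" by (intro sum_mono d)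
  also have "\<dots> = (real N - real (k * (k * n))) * B"
    using UN fin card_mono[OF _ UN] by (simp add: card_Diff_subset cardU of_nat_diff)
  finally show ?thesis by simp
qed

context ergodic_source
begin

lemma source_blk_in_set:
  assumes "us \<in> set_pmf (source_block \<mu> N)" "b < k * n" "k * (k * n + 1) \<le> N"
  shows "source_blk k n b us \<in> set_pmf (source_block \<mu> k)"
  using assms map_source_blk[OF assms(2,3)] by (metis imageI pmf.set_map)

lemma block_change_of_measure:
  fixes W :: "'u list \<Rightarrow> 'v::countable list pmf" and k :: nat
  defines "p \<equiv> test_channel_joint \<mu> k W"
  assumes us: "us \<in> set_pmf (source_block \<mu> N)" and N: "k * (k * n + 1) \<le> N"
    and G: "\<And>v. v \<in> G \<Longrightarrow> (\<Sum>b<k * n. info_density p (source_blk k n b us, v b)) \<le> a"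
  shows "measure_pmf.prob (block_channel k n W us) G \<le> 2 powr a * measure_pmf.prob (Pi_pmf {..<k * n} [] (\<lambda>_. map_pmf snd p)) G"
proof (rule prob_change_of_measure)
  fix v assume v: "v \<in> G" "v \<in> set_pmf (block_channel k n W us)"
  have supp: "v \<in> PiE_dflt {..<k * n} [] (\<lambda>b. set_pmf (W (source_blk k n b us)))"
    using v(2) by (simp add: block_channel_def set_Pi_pmf comp_def)
  then have dflt: "\<forall>x. x \<notin> {..<k * n} \<longrightarrow> v x = []" by (auto simp: PiE_dflt_def)
  have "pmf (W (source_blk k n b us)) (v b) = 2 powr (info_density p (source_blk k n b us, v b)) * pmf (map_pmf snd p) (v b)"
    if b: "b < k * n" for b
  proof -
    have "(source_blk k n b us, v b) \<in> set_pmf p"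
      using source_blk_in_set[OF us b N] supp b by (auto simp: p_def test_channel_joint_def PiE_dflt_def)
    from info_density_test_channel[OF this[unfolded p_def], folded p_def] show ?thesis by simp
  qed
  then have "pmf (block_channel k n W us) v = (\<Prod>b<k * n. 2 powr (info_density p (source_blk k n b us, v b)) * pmf (map_pmf snd p) (v b))"
    unfolding block_channel_def using dflt by (subst pmf_Pi') auto
  also have "\<dots> = 2 powr (\<Sum>b<k * n. info_density p (source_blk k n b us, v b)) * pmf (Pi_pmf {..<k * n} [] (\<lambda>_. map_pmf snd p)) v"
    using dflt by (subst pmf_Pi') (auto simp: prod.distrib powr_sum)
  also have "\<dots> \<le> 2 powr a * pmf (Pi_pmf {..<k * n} [] (\<lambda>_. map_pmf snd p)) v"
    using G[OF v(1)] by (intro mult_right_mono) auto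
  finally show "pmf (block_channel k n W us) v \<le> 2 powr a * pmf (Pi_pmf {..<k * n} [] (\<lambda>_. map_pmf snd p)) v" .
qed simp

lemma source_coding:
  fixes d :: "'u \<Rightarrow> 'v::countable \<Rightarrow> real"
  assumes d: "\<And>u v. 0 \<le> d u v" "\<And>u v. d u v \<le> B" and k: "k \<ge> 1"
    and feas: "test_channel_feasible \<mu> d k (real k * D) (ereal r)" and r: "r < real k * R" and \<epsilon>: "\<epsilon> > 0"
  shows "\<forall>\<^sub>F N in sequentially. \<exists>c \<phi>. (\<forall>m. length (c m) = N) \<and> (\<forall>us. \<phi> us < num_messages R N) \<and>
     measure_pmf.expectation (source_block \<mu> N) (\<lambda>us. \<Sum>i<N. d (us ! i) (c (\<phi> us) ! i)) \<le> real N * (D + \<epsilon>)"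
proof -
  obtain W where W: "valid_channel k W" "total_distortion d k (test_channel_joint \<mu> k W) \<le> real k * D"
    "pair_mutual_information (test_channel_joint \<mu> k W) \<le> ereal r" using feas by (auto simp: test_channel_feasible_def)
  define p where "p = test_channel_joint \<mu> k W"
  have B0: "B \<ge> 0" using d[of undefined undefined] by linarith
  have ii: "integrable p (info_density p)" and Ei: "measure_pmf.expectation p (info_density p) \<le> r"
    using W(3) by (auto simp: p_def[symmetric] pair_mutual_information_eq split: if_splits)
  have r0: "r \<ge> 0" using info_density_nonneg[OF ii] Ei by linarith
  have R: "R > 0" using r r0 k by (simp add: zero_less_mult_iff order.strict_trans1[of 0 r "real k * R"])
      (metis less_le_trans mult_not_zero not_le order.strict_trans1 zero_less_mult_iff of_nat_0_le_iff)
  define h2 where "h2 x = (\<Sum>j<k. d (fst x ! j) (snd x ! j))" for x :: "'u list \<times> 'v list"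
  have h2b: "\<bar>h2 x\<bar> \<le> real k * B" for x
  proof -
    have "h2 x \<le> (\<Sum>j<k. B)" unfolding h2_def by (intro sum_mono d)
    moreover have "0 \<le> h2 x" unfolding h2_def by (intro sum_nonneg d)
    ultimately show ?thesis by simp
  qed
  have h2i: "integrable p h2" using integrable_pmf_bounded[OF h2b] .
  have Eh2: "measure_pmf.expectation p h2 \<le> real k * D"
  proof -
    have "measure_pmf.expectation p h2 = total_distortion d k p"
      unfolding h2_def total_distortion_def using d
      by (subst Bochner_Integration.integral_sum) (auto simp: case_prod_unfold intro!: integrable_pmf_bounded[of _ B])
    then show ?thesis using W(2) by (simp add: p_def)
  qed
  have D0: "D \<ge> 0"
  proof -
    have "0 \<le> total_distortion d k p" unfolding total_distortion_def using d by (intro sum_nonneg integral_nonneg_AE) auto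
    then have "0 \<le> real k * D" using W(2) by (simp add: p_def)
    then show ?thesis using k by (simp add: zero_le_mult_iff)
  qed
  define \<delta> where "\<delta> = min (\<epsilon> / 4) ((real k * R - r) / 2)"
  define \<gamma> where "\<gamma> = \<epsilon> / (4 * (B + 1))"
  define \<beta> where "\<beta> = real k * R - r - \<delta>"
  have \<delta>: "\<delta> > 0" "\<delta> \<le> \<epsilon> / 4" using \<epsilon> r by (auto simp: \<delta>_def)
  have \<beta>: "\<beta> > 0" using r by (auto simp: \<beta>_def \<delta>_def min_def field_simps)
  have \<gamma>: "\<gamma> > 0" using \<epsilon> B0 by (simp add: \<gamma>_def)
  have e1: "\<gamma> * \<delta> / 4 > 0" using \<gamma> \<delta> by simp
  define nn where "nn N = (N - k) div (k * k)" for N :: nat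
  have nn_lim: "filterlim nn sequentially sequentially"
    unfolding filterlim_at_top
  proof
    fix Z :: nat
    have "Z \<le> nn N" if "N \<ge> k + Z * (k * k)" for N
      using that k div_le_mono[of "Z * (k * k)" "N - k" "k * k"] by (simp add: nn_def)
    then show "\<forall>\<^sub>F N in sequentially. Z \<le> nn N" by (rule eventually_sequentiallyI)
  qed
  obtain n0 :: nat where n0: "real n0 > ln (2 / \<gamma>) / (\<beta> * ln 2)" using reals_Archimedean2 by blast
  obtain N1 :: nat where N1: "real N1 > (real k + real k * real k) * B / (\<epsilon> / 4)" using reals_Archimedean2 by blast
  have ev1: "\<forall>\<^sub>F N in sequentially. \<forall>N'\<ge>k * (k * nn N + 1).
     (\<integral>\<^sup>+us. \<integral>\<^sup>+v. ennreal \<bar>(\<Sum>b<k * nn N. info_density p (source_blk k (nn N) b us, v b)) / real (k * nn N) - measure_pmf.expectation p (info_density p)\<bar>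
        \<partial>block_channel k (nn N) W us \<partial>source_block \<mu> N') \<le> ennreal (\<gamma> * \<delta> / 4)"
    using block_law_of_large_numbers[OF ii[unfolded p_def] k e1] nn_lim unfolding p_def by (rule eventually_compose_filterlim)
  have ev2: "\<forall>\<^sub>F N in sequentially. \<forall>N'\<ge>k * (k * nn N + 1).
     (\<integral>\<^sup>+us. \<integral>\<^sup>+v. ennreal \<bar>(\<Sum>b<k * nn N. h2 (source_blk k (nn N) b us, v b)) / real (k * nn N) - measure_pmf.expectation p h2\<bar>
        \<partial>block_channel k (nn N) W us \<partial>source_block \<mu> N') \<le> ennreal (\<gamma> * \<delta> / 4)"
    using block_law_of_large_numbers[OF h2i[unfolded p_def] k e1] nn_lim unfolding p_def by (rule eventually_compose_filterlim)
  have ev3: "\<forall>\<^sub>F N in sequentially. nn N \<ge> max 1 n0" using nn_lim unfolding filterlim_at_top by blast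
  show ?thesis
    using ev1 ev2 ev3 eventually_ge_at_top[of "max k N1"]
  proof eventually_elim
    case (elim N)
    define n where "n = nn N"
    define M where "M = k * n"
    have n1: "n \<ge> 1" "n \<ge> n0" and Nk: "N \<ge> k" "N \<ge> N1" using elim by (auto simp: n_def)
    have M0: "real M > 0" using n1 k by (simp add: M_def)
    have split: "k * k * n + (N - k) mod (k * k) = N - k" unfolding n_def nn_def by simp
    have NM: "k * (k * n + 1) \<le> N" using split Nk by (simp add: algebra_simps)
    have "(N - k) mod (k * k) < k * k" using k by simp
    then have "N \<le> k * M + (k + k * k)" using split Nk by (simp add: M_def algebra_simps)
    then have gap: "real N - real (k * M) \<le> real k + real k * real k"
      using of_nat_mono[of N "k * M + (k + k * k)", where ?'a = real] by simp
    have NM': "real (k * M) \<le> real N" using NM by (intro of_nat_mono) (simp add: M_def algebra_simps)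
    let ?S1 = "\<lambda>us v. \<Sum>b<M. info_density p (source_blk k n b us, v b)"
    let ?S2 = "\<lambda>us v. \<Sum>b<M. h2 (source_blk k n b us, v b)"
    define A where "A us v \<longleftrightarrow> ?S2 us v \<le> real M * (real k * D + \<delta>)" for us and v :: "nat \<Rightarrow> 'v list"
    define G where "G us = {v. ?S1 us v \<le> real M * (r + \<delta>) \<and> A us v}" for us
    define w where "w us = measure_pmf.prob (block_channel k n W us) (G us)" for us
    define Q where "Q = Pi_pmf {..<M} [] (\<lambda>_. map_pmf snd p)"
    define K where "K = num_messages R N"
    define t where "t = 2 powr (- (real M * (r + \<delta>)))"
    have K1: "real K \<ge> 2 powr (real N * R)" by (simp add: K_def num_messages_def real_nat_ceiling_ge)
    have tail: "exp (- (real K * t)) \<le> \<gamma> / 2"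
    proof -
      have "real M * \<beta> = real (k * M) * R - real M * (r + \<delta>)" by (simp add: \<beta>_def algebra_simps)
      also have "\<dots> \<le> real N * R - real M * (r + \<delta>)" using NM' R by simp
      finally have "2 powr (real M * \<beta>) \<le> 2 powr (real N * R - real M * (r + \<delta>))" by simp
      also have "\<dots> = 2 powr (real N * R) * t" by (simp add: t_def powr_diff powr_minus divide_inverse)
      also have "\<dots> \<le> real K * t" using K1 by (intro mult_right_mono) (auto simp: t_def)
      finally have 1: "2 powr (real M * \<beta>) \<le> real K * t" .
      have "ln (2 / \<gamma>) < real n0 * (\<beta> * ln 2)" using n0 \<beta> by (simp add: divide_less_eq)
      also have "\<dots> \<le> real M * (\<beta> * ln 2)"
      proof (rule mult_right_mono)
        have "n0 \<le> M" using n1 k by (metis M_def mult_le_mono nat_mult_1 order.trans)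
        then show "real n0 \<le> real M" by simp
      qed (use \<beta> in simp)
      also have "\<dots> \<le> exp (real M * (\<beta> * ln 2))" using exp_ge_add_one_self[of "real M * (\<beta> * ln 2)"] by linarith
      also have "\<dots> = 2 powr (real M * \<beta>)" by (simp add: powr_def mult_ac)
      finally have "ln (2 / \<gamma>) \<le> real K * t" using 1 by linarith
      then have "exp (- (real K * t)) \<le> exp (- ln (2 / \<gamma>))" by simp
      also have "\<dots> = \<gamma> / 2" using \<gamma> by (simp add: exp_minus)
      finally show ?thesis .
    qed
    have w01: "0 \<le> w us" "w us \<le> 1" for us by (auto simp: w_def)
    have notG: "(\<integral>\<^sup>+us. ennreal (1 - w us) \<partial>source_block \<mu> N) \<le> ennreal (\<gamma> / 2)"
    proof -
      let ?X1 = "\<lambda>us v. ennreal \<bar>?S1 us v / real M - measure_pmf.expectation p (info_density p)\<bar>"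
      let ?X2 = "\<lambda>us v. ennreal \<bar>?S2 us v / real M - measure_pmf.expectation p h2\<bar>"
      have pt: "indicator (- G us) v \<le> ennreal (1 / \<delta>) * (?X1 us v + ?X2 us v)" for us v
      proof (cases "v \<in> G us")
        case False
        then have "real M * (r + \<delta>) < ?S1 us v \<or> real M * (real k * D + \<delta>) < ?S2 us v" by (auto simp: G_def A_def)
        then have "r + \<delta> < ?S1 us v / real M \<or> real k * D + \<delta> < ?S2 us v / real M"
          using M0 by (simp add: less_divide_eq mult.commute)
        then have "\<delta> \<le> \<bar>?S1 us v / real M - measure_pmf.expectation p (info_density p)\<bar> + \<bar>?S2 us v / real M - measure_pmf.expectation p h2\<bar>"
          using Ei Eh2 by linarith
        then have "1 \<le> (1 / \<delta>) * (\<bar>?S1 us v / real M - measure_pmf.expectation p (info_density p)\<bar> + \<bar>?S2 us v / real M - measure_pmf.expectation p h2\<bar>)"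
          using \<delta> by (simp add: field_simps)
        from ennreal_leI[OF this]
        have "1 \<le> ennreal ((1 / \<delta>) * (\<bar>?S1 us v / real M - measure_pmf.expectation p (info_density p)\<bar> + \<bar>?S2 us v / real M - measure_pmf.expectation p h2\<bar>))" by simp
        also have "\<dots> = ennreal (1 / \<delta>) * (?X1 us v + ?X2 us v)"
          using \<delta> by (subst ennreal_mult) (auto simp: ennreal_plus)
        finally show ?thesis using False by simp
      qed simp
      have "ennreal (1 - w us) = (\<integral>\<^sup>+v. indicator (- G us) v \<partial>block_channel k n W us)" for us
        using measure_pmf.prob_compl[of "G us" "block_channel k n W us"]
        by (simp add: w_def measure_pmf.emeasure_eq_measure Compl_eq_Diff_UNIV)
      then have "(\<integral>\<^sup>+us. ennreal (1 - w us) \<partial>source_block \<mu> N) \<le>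
          (\<integral>\<^sup>+us. \<integral>\<^sup>+v. ennreal (1 / \<delta>) * (?X1 us v + ?X2 us v) \<partial>block_channel k n W us \<partial>source_block \<mu> N)"
        by (simp only:) (intro nn_integral_mono pt)
      also have "\<dots> = ennreal (1 / \<delta>) * ((\<integral>\<^sup>+us. \<integral>\<^sup>+v. ?X1 us v \<partial>block_channel k n W us \<partial>source_block \<mu> N) +
         (\<integral>\<^sup>+us. \<integral>\<^sup>+v. ?X2 us v \<partial>block_channel k n W us \<partial>source_block \<mu> N))"
        by (simp add: nn_integral_cmult nn_integral_add)
      also have "\<dots> \<le> ennreal (1 / \<delta>) * (ennreal (\<gamma> * \<delta> / 4) + ennreal (\<gamma> * \<delta> / 4))"
        using elim(1,2) NM by (intro mult_left_mono add_mono) (auto simp: n_def M_def)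
      also have "\<dots> = ennreal (\<gamma> / 2)" using \<delta> \<gamma> by (simp add: ennreal_mult[symmetric] flip: ennreal_plus)
      finally show ?thesis .
    qed
    define g where "g us = measure_pmf.prob Q {v. A us v}" for us
    have tw: "t * w us \<le> g us" if us: "us \<in> set_pmf (source_block \<mu> N)" for us
    proof -
      have "w us \<le> 2 powr (real M * (r + \<delta>)) * measure_pmf.prob Q (G us)"
        unfolding w_def Q_def M_def p_def
        by (rule block_change_of_measure[OF us NM]) (auto simp: G_def M_def p_def)
      then have "t * w us \<le> t * (2 powr (real M * (r + \<delta>)) * measure_pmf.prob Q (G us))"
        by (intro mult_left_mono) (auto simp: t_def)
      also have "\<dots> = measure_pmf.prob Q (G us)" by (simp add: t_def powr_minus)
      also have "\<dots> \<le> g us" unfolding g_def by (intro measure_pmf.finite_measure_mono) (auto simp: G_def)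
      finally show ?thesis .
    qed
    obtain cs where cs: "length cs = K" "(\<integral>\<^sup>+us. 1 * indicator {us. \<forall>c\<in>set cs. \<not> A us c} us \<partial>source_block \<mu> N)
       \<le> (\<integral>\<^sup>+us. 1 * ennreal ((1 - g us) ^ K) \<partial>source_block \<mu> N)"
      using random_covering[where n = K and f = "\<lambda>_. 1" and A = A and P = "source_block \<mu> N" and q = Q] unfolding g_def by blast
    define unc where "unc = {us. \<forall>c\<in>set cs. \<not> A us c}"
    have "emeasure (source_block \<mu> N) unc \<le> (\<integral>\<^sup>+us. ennreal ((1 - g us) ^ K) \<partial>source_block \<mu> N)"
      using cs(2) by (simp add: unc_def)
    also have "\<dots> \<le> (\<integral>\<^sup>+us. ennreal (1 - w us) + ennreal (\<gamma> / 2) \<partial>source_block \<mu> N)"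
    proof (rule nn_integral_mono_AE, rule AE_pmfI)
      fix us assume us: "us \<in> set_pmf (source_block \<mu> N)"
      have "(1 - g us) ^ K \<le> (1 - w us) + exp (- (real K * t))"
        using tw[OF us] w01 by (intro covering_failure_bound) (auto simp: g_def t_def)
      then have "(1 - g us) ^ K \<le> (1 - w us) + \<gamma> / 2" using tail by linarith
      from ennreal_leI[OF this] show "ennreal ((1 - g us) ^ K) \<le> ennreal (1 - w us) + ennreal (\<gamma> / 2)"
        using w01 \<gamma> by (simp add: ennreal_plus)
    qed
    also have "\<dots> = (\<integral>\<^sup>+us. ennreal (1 - w us) \<partial>source_block \<mu> N) + ennreal (\<gamma> / 2)"
      by (simp add: nn_integral_add)
    also have "\<dots> \<le> ennreal (\<gamma> / 2) + ennreal (\<gamma> / 2)" by (intro add_mono notG order_refl)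
    also have "\<dots> = ennreal \<gamma>" using \<gamma> by (simp flip: ennreal_plus)
    finally have punc: "measure_pmf.prob (source_block \<mu> N) unc \<le> \<gamma>"
      using \<gamma> by (simp add: measure_pmf.emeasure_eq_measure)
    have K0: "K > 0" using K1 by (metis of_nat_0_less_iff order.strict_trans2 powr_gt_zero zero_neq_numeral)
    define \<phi> where "\<phi> us = (if us \<in> unc then 0 else (SOME m. m < K \<and> A us (cs ! m)))" for us
    have \<phi>: "\<phi> us < K \<and> A us (cs ! \<phi> us)" if "us \<notin> unc" for us
    proof -
      have "\<exists>m. m < K \<and> A us (cs ! m)" using that cs(1) by (auto simp: unc_def in_set_conv_nth)
      from someI_ex[OF this] show ?thesis using that by (simp add: \<phi>_def)
    qed
    define c where "c m = place_blocks k n N (cs ! m)" for m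
    let ?F = "\<lambda>us. \<Sum>i<N. d (us ! i) (c (\<phi> us) ! i)"
    have F0: "0 \<le> ?F us" "?F us \<le> real N * B" for us
    proof -
      show "0 \<le> ?F us" by (intro sum_nonneg d)
      have "?F us \<le> (\<Sum>i<N. B)" by (intro sum_mono d)
      then show "?F us \<le> real N * B" by simp
    qed
    define L where "L = real M * (real k * D + \<delta>) + (real N - real (k * M)) * B"
    have L0: "0 \<le> L" using D0 \<delta> B0 NM' by (simp add: L_def)
    have Fb: "?F us \<le> L + real N * B * indicator unc us" if "us \<in> set_pmf (source_block \<mu> N)" for us
    proof (cases "us \<in> unc")
      case True
      then show ?thesis using F0[of us] L0 by simp
    next
      case False
      have "?F us \<le> ?S2 us (cs ! \<phi> us) + (real N - real (k * M)) * B"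
        unfolding c_def M_def h2_def using place_blocks_distortion[OF d NM length_source_block[OF that]] by simp
      also have "?S2 us (cs ! \<phi> us) \<le> real M * (real k * D + \<delta>)" using \<phi>[OF False] by (simp add: A_def)
      finally show ?thesis using False by (simp add: L_def)
    qed
    have "measure_pmf.expectation (source_block \<mu> N) ?F \<le> measure_pmf.expectation (source_block \<mu> N) (\<lambda>us. L + real N * B * indicator unc us)"
    proof (rule integral_mono_AE)
      show "integrable (source_block \<mu> N) ?F" using F0 by (intro integrable_pmf_bounded[of _ "real N * B"]) auto
    qed (auto simp: AE_measure_pmf_iff Fb measure_pmf.emeasure_eq_measure)
    also have "\<dots> = L + real N * B * measure_pmf.prob (source_block \<mu> N) unc"
      by (simp add: measure_pmf.emeasure_eq_measure)
    also have "\<dots> \<le> L + real N * B * \<gamma>" using punc B0 by (intro add_left_mono mult_left_mono) auto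
    also have "\<dots> \<le> real N * (D + \<epsilon>)"
    proof -
      have 1: "real (k * M) * D \<le> real N * D" using NM' D0 by (intro mult_right_mono)
      have "real M \<le> real (k * M)" using k by (intro of_nat_mono) simp
      then have "real M \<le> real N" using NM' by linarith
      then have 2: "real M * \<delta> \<le> real N * (\<epsilon> / 4)" using \<delta> by (intro mult_mono) auto
      have "(real N - real (k * M)) * B \<le> (real k + real k * real k) * B" using gap B0 by (intro mult_right_mono)
      also have "\<dots> \<le> real N1 * (\<epsilon> / 4)" using N1 \<epsilon> by (simp add: divide_less_eq)
      also have "\<dots> \<le> real N * (\<epsilon> / 4)" using Nk \<epsilon> by (intro mult_right_mono) auto
      finally have 3: "(real N - real (k * M)) * B \<le> real N * (\<epsilon> / 4)" .
      have "B * \<gamma> \<le> (B + 1) * \<gamma>" using \<gamma> by simp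
      also have "(B + 1) * \<gamma> = \<epsilon> / 4" using B0 by (simp add: \<gamma>_def field_simps)
      finally have 4: "real N * (B * \<gamma>) \<le> real N * (\<epsilon> / 4)" by (intro mult_left_mono) auto
      have "L + real N * B * \<gamma> = real (k * M) * D + real M * \<delta> + (real N - real (k * M)) * B + real N * (B * \<gamma>)"
        by (simp add: L_def algebra_simps)
      also have "\<dots> \<le> real N * D + real N * (\<epsilon> / 4) + real N * (\<epsilon> / 4) + real N * (\<epsilon> / 4)" using 1 2 3 4 by linarith
      also have "\<dots> \<le> real N * (D + \<epsilon>)" using \<epsilon> by (simp add: algebra_simps)
      finally show ?thesis .
    qed
    finally have "measure_pmf.expectation (source_block \<mu> N) ?F \<le> real N * (D + \<epsilon>)" .
    moreover have "\<phi> us < num_messages R N" for us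
      using \<phi>[of us] K0 by (cases "us \<in> unc") (auto simp: \<phi>_def K_def)
    moreover have "length (c m) = N" for m by (simp add: c_def)
    ultimately show ?case by blast
  qed
qed

end

section \<open>Joint source-channel codes\<close>

lemma integrable_info_density_finite:
  assumes fin: "finite (snd ` set_pmf p)"
  shows "integrable p (info_density p)"
proof (rule integrable_info_densityI)
  let ?g = "\<lambda>x. \<bar>log 2 (1 / pmf (map_pmf snd p) (snd x))\<bar>"
  show "integrable p ?g"
  proof (rule measure_pmf.integrable_const_bound)
    show "AE x in p. norm (?g x) \<le> (\<Sum>v\<in>snd ` set_pmf p. \<bar>log 2 (1 / pmf (map_pmf snd p) v)\<bar>)"
      using fin by (intro AE_pmfI) (auto intro!: member_le_sum[where f = "\<lambda>v. \<bar>log 2 (1 / pmf (map_pmf snd p) v)\<bar>"])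
  qed simp
  fix x assume x: "x \<in> set_pmf p"
  have pos: "pmf p x > 0" "pmf (map_pmf fst p) (fst x) > 0" "pmf (map_pmf snd p) (snd x) > 0"
    using x by (auto simp: pmf_positive_iff)
  have "pmf p x \<le> pmf (map_pmf fst p) (fst x)"
  proof -
    have "pmf p x = measure_pmf.prob p {x}" by (simp add: pmf.rep_eq)
    also have "\<dots> \<le> measure_pmf.prob p (fst -` {fst x})" by (intro measure_pmf.finite_measure_mono) auto
    finally show ?thesis by (simp add: pmf_map)
  qed
  then have "pmf p x / (pmf (map_pmf fst p) (fst x) * pmf (map_pmf snd p) (snd x)) \<le> 1 / pmf (map_pmf snd p) (snd x)"
    using pos by (simp add: field_simps)
  then have "info_density p x \<le> log 2 (1 / pmf (map_pmf snd p) (snd x))"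
    unfolding info_density_def using pos by (intro log_mono) auto
  then show "info_density p x \<le> ?g x" by linarith
qed

context ergodic_source
begin

lemma fidelity_attainable_of_feasible:
  fixes d :: "'u \<Rightarrow> 'v::countable \<Rightarrow> real" and K :: "('x::finite, 's::finite, 'y::finite) fs_channel"
  assumes d: "\<And>u v. 0 \<le> d u v" "\<And>u v. d u v \<le> B" and k: "k \<ge> 1"
    and feas: "test_channel_feasible \<mu> d k (real k * D) (ereal r)" and r: "r < real k * R"
    and R: "achievable_rate K z R" and \<epsilon>: "\<epsilon> > 0"
  shows "fidelity_attainable \<mu> d K p\<^sub>0 z (D + \<epsilon>)"
proof -
  from R obtain F G where FG: "\<And>s\<^sub>0. (\<lambda>N. max_error_prob K z (num_messages R N) N (F N) (G N) s\<^sub>0) \<longlonglongrightarrow> 0"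
    by (auto simp: achievable_rate_def)
  have B0: "B \<ge> 0" using d[of undefined undefined] by linarith
  define \<eta> where "\<eta> = \<epsilon> / (2 * (B + 1))"
  have \<eta>: "\<eta> > 0" "B * \<eta> \<le> \<epsilon> / 2"
  proof -
    show "\<eta> > 0" using \<epsilon> B0 by (simp add: \<eta>_def)
    then have "B * \<eta> \<le> (B + 1) * \<eta>" by simp
    also have "\<dots> = \<epsilon> / 2" using B0 by (simp add: \<eta>_def field_simps)
    finally show "B * \<eta> \<le> \<epsilon> / 2" .
  qed
  have "\<forall>\<^sub>F N in sequentially. \<forall>s\<^sub>0\<in>UNIV. max_error_prob K z (num_messages R N) N (F N) (G N) s\<^sub>0 < \<eta>"
    by (rule eventually_ball_finite) (use order_tendstoD(2)[OF FG \<eta>(1)] in auto)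
  moreover have "\<forall>\<^sub>F N in sequentially. \<exists>c \<phi>. (\<forall>m. length (c m) = N) \<and> (\<forall>us. \<phi> us < num_messages R N) \<and>
     measure_pmf.expectation (source_block \<mu> N) (\<lambda>us. \<Sum>i<N. d (us ! i) (c (\<phi> us) ! i)) \<le> real N * (D + \<epsilon> / 2)"
    by (rule source_coding[OF d k feas r]) (use \<epsilon> in simp)
  ultimately show ?thesis
    unfolding fidelity_attainable_def using eventually_ge_at_top[of 1]
  proof eventually_elim
    case (elim N)
    from elim(2) obtain c \<phi> where c: "\<And>m. length (c m) = N" and \<phi>: "\<And>us. \<phi> us < num_messages R N"
      and dist: "measure_pmf.expectation (source_block \<mu> N) (\<lambda>us. \<Sum>i<N. d (us ! i) (c (\<phi> us) ! i)) \<le> real N * (D + \<epsilon> / 2)" by blast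
    define f where "f us = F N (\<phi> us)" for us
    define g where "g ys = c (G N ys)" for ys
    define T where "T us vs = (\<Sum>i<N. d (us ! i) (vs ! i))" for us vs
    have Tb: "0 \<le> T us vs" "T us vs \<le> real N * B" for us vs
    proof -
      show "0 \<le> T us vs" unfolding T_def by (intro sum_nonneg d)
      have "T us vs \<le> (\<Sum>i<N. B)" unfolding T_def by (intro sum_mono d)
      then show "T us vs \<le> real N * B" by simp
    qed
    let ?q = "source_reconstruction \<mu> K p\<^sub>0 z N f g"
    have inner: "measure_pmf.expectation (channel_output K z (f us) s\<^sub>0 N) (\<lambda>ys. T us (g ys)) \<le> T us (c (\<phi> us)) + real N * B * \<eta>" for us s\<^sub>0
    proof -
      let ?o = "channel_output K z (f us) s\<^sub>0 N"
      have err: "measure_pmf.prob ?o {ys. G N ys \<noteq> \<phi> us} \<le> \<eta>"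
      proof -
        have "measure_pmf.prob ?o {ys. G N ys \<noteq> \<phi> us} \<le> max_error_prob K z (num_messages R N) N (F N) (G N) s\<^sub>0"
          unfolding max_error_prob_def f_def using \<phi>[of us] by (intro Max_ge) auto
        then show ?thesis using elim(1) by (meson UNIV_I less_imp_le order.trans)
      qed
      have "measure_pmf.expectation ?o (\<lambda>ys. T us (g ys)) \<le>
          measure_pmf.expectation ?o (\<lambda>ys. T us (c (\<phi> us)) + real N * B * indicator {ys. G N ys \<noteq> \<phi> us} ys)"
      proof (rule integral_mono)
        show "integrable ?o (\<lambda>ys. T us (g ys))" using Tb by (intro integrable_pmf_bounded[of _ "real N * B"]) auto
        show "T us (g ys) \<le> T us (c (\<phi> us)) + real N * B * indicator {ys. G N ys \<noteq> \<phi> us} ys" for ys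
          using Tb[of us "g ys"] Tb[of us "c (\<phi> us)"] by (auto simp: g_def indicator_def)
      qed (auto simp: measure_pmf.emeasure_eq_measure)
      also have "\<dots> = T us (c (\<phi> us)) + real N * B * measure_pmf.prob ?o {ys. G N ys \<noteq> \<phi> us}"
        by (simp add: measure_pmf.emeasure_eq_measure)
      also have "\<dots> \<le> T us (c (\<phi> us)) + real N * B * \<eta>" using err B0 by (intro add_left_mono mult_left_mono) auto
      finally show ?thesis .
    qed
    have absT: "\<bar>T us vs\<bar> \<le> real N * B" for us vs using Tb[of us vs] by simp
    have absE: "\<bar>measure_pmf.expectation q (\<lambda>ys. T us (h ys))\<bar> \<le> real N * B" for us h and q :: "'c pmf"
      using absT by (intro expectation_abs_le) auto
    have "total_distortion d N ?q = measure_pmf.expectation ?q (\<lambda>x. T (fst x) (snd x))"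
      unfolding total_distortion_def T_def using d
      by (subst Bochner_Integration.integral_sum) (auto simp: case_prod_unfold intro!: integrable_pmf_bounded[of _ B])
    also have "\<dots> = measure_pmf.expectation (source_block \<mu> N) (\<lambda>us. measure_pmf.expectation p\<^sub>0 (\<lambda>s\<^sub>0.
        measure_pmf.expectation (channel_output K z (f us) s\<^sub>0 N) (\<lambda>ys. T us (g ys))))"
      unfolding source_reconstruction_def
      by (subst expectation_bind_pmf[where B = "real N * B"], simp add: absT)+ simp
    also have "\<dots> \<le> measure_pmf.expectation (source_block \<mu> N) (\<lambda>us. T us (c (\<phi> us)) + real N * B * \<eta>)"
    proof (rule integral_mono)
      have *: "measure_pmf.expectation p\<^sub>0 (\<lambda>s\<^sub>0. measure_pmf.expectation (channel_output K z (f us) s\<^sub>0 N) (\<lambda>ys. T us (g ys))) \<le> T us (c (\<phi> us)) + real N * B * \<eta>" for us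
        using inner by (intro measure_pmf.integral_le_const integrable_pmf_bounded[OF absE]) auto
      show "measure_pmf.expectation p\<^sub>0 (\<lambda>s\<^sub>0. measure_pmf.expectation (channel_output K z (f us) s\<^sub>0 N) (\<lambda>ys. T us (g ys))) \<le> T us (c (\<phi> us)) + real N * B * \<eta>" for us
        by (rule *)
      show "integrable (source_block \<mu> N) (\<lambda>us. measure_pmf.expectation p\<^sub>0 (\<lambda>s\<^sub>0. measure_pmf.expectation (channel_output K z (f us) s\<^sub>0 N) (\<lambda>ys. T us (g ys))))"
      proof (rule integrable_pmf_bounded)
        fix us
        show "\<bar>measure_pmf.expectation p\<^sub>0 (\<lambda>s\<^sub>0. measure_pmf.expectation (channel_output K z (f us) s\<^sub>0 N) (\<lambda>ys. T us (g ys)))\<bar> \<le> real N * B"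
          by (rule expectation_abs_le[OF absE])
      qed
      show "integrable (source_block \<mu> N) (\<lambda>us. T us (c (\<phi> us)) + real N * B * \<eta>)"
        using integrable_pmf_bounded[of "\<lambda>us. T us (c (\<phi> us))" "real N * B", OF absT] by simp
    qed
    also have "\<dots> = measure_pmf.expectation (source_block \<mu> N) (\<lambda>us. T us (c (\<phi> us))) + real N * B * \<eta>"
      using integrable_pmf_bounded[of "\<lambda>us. T us (c (\<phi> us))" "real N * B", OF absT] by simp
    also have "\<dots> \<le> real N * (D + \<epsilon> / 2) + real N * (\<epsilon> / 2)"
      using dist mult_left_mono[OF \<eta>(2), of "real N"] by (simp add: T_def mult.assoc)
    also have "\<dots> = real N * (D + \<epsilon>)" by (simp add: algebra_simps)
    finally have "block_distortion d N ?q \<le> D + \<epsilon>" using elim by (simp add: block_distortion_le_iff)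
    then show ?case using c by (intro exI[of _ f] exI[of _ g]) (simp add: g_def)
  qed
qed

lemma near_minimal_letter:
  fixes d :: "'u \<Rightarrow> 'v::countable \<Rightarrow> real"
  assumes d: "\<And>u v. 0 \<le> d u v" "\<And>u v. d u v \<le> B" and D: "min_distortion \<mu> d < D"
  shows "\<exists>D0 r0. D0 < D \<and> test_channel_feasible \<mu> d 1 D0 (ereal r0)"
proof -
  define \<eta> where "\<eta> = (D - min_distortion \<mu> d) / 3"
  have \<eta>: "\<eta> > 0" using D by (simp add: \<eta>_def)
  have B0: "B \<ge> 0" using d[of undefined undefined] by linarith
  define m where "m u = (INF v. d u v)" for u
  have bdd: "bdd_below (range (d u))" for u using d by (intro bdd_belowI[of _ 0]) auto
  have mb: "0 \<le> m u" "m u \<le> B" for u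
  proof -
    show "0 \<le> m u" unfolding m_def using d by (intro cINF_greatest) auto
    show "m u \<le> B" unfolding m_def using d by (intro cINF_lower2[OF bdd]) auto
  qed
  have "\<exists>v. d u v < m u + \<eta>" for u
    using cINF_less_iff[where a = "m u + \<eta>" and f = "d u" and A = UNIV, OF _ bdd] \<eta> by (simp add: m_def)
  then obtain best where best: "\<And>u. d u (best u) < m u + \<eta>" by metis
  define P where "P = map_pmf hd (source_block \<mu> 1)"
  have "(\<lambda>i. measure_pmf.prob P {u. i \<le> to_nat u}) \<longlonglongrightarrow> measure_pmf.prob P (\<Inter>i. {u. i \<le> to_nat u})"
    by (rule measure_pmf.finite_Lim_measure_decseq) (auto simp: decseq_def)
  also have "(\<Inter>i. {u :: 'u. i \<le> to_nat u}) = {}" using Suc_n_not_le_n by blast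
  finally have "(\<lambda>i. measure_pmf.prob P {u. i \<le> to_nat u}) \<longlonglongrightarrow> 0" by simp
  moreover have "\<eta> / (B + 1) > 0" using \<eta> B0 by simp
  ultimately have "\<forall>\<^sub>F i in sequentially. measure_pmf.prob P {u. i \<le> to_nat u} < \<eta> / (B + 1)" by (rule order_tendstoD(2))
  then obtain i where i: "measure_pmf.prob P {u. i \<le> to_nat u} < \<eta> / (B + 1)" by (auto dest: eventually_happens)
  define F where "F = {u :: 'u. to_nat u < i}"
  have "F = to_nat -` {..<i}" by (auto simp: F_def)
  then have finF: "finite F" by (simp add: finite_vimageI)
  have "- F = {u. i \<le> to_nat u}" by (auto simp: F_def)
  then have "measure_pmf.prob P (- F) * B \<le> \<eta> / (B + 1) * B" using i B0 by (intro mult_right_mono) auto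
  also have "\<dots> \<le> \<eta> / (B + 1) * (B + 1)" using \<eta> B0 by (intro mult_left_mono) auto
  also have "\<dots> = \<eta>" using B0 by simp
  finally have F: "measure_pmf.prob P (- F) * B \<le> \<eta>" .
  have mi: "integrable P m" using mb by (intro integrable_pmf_bounded[of _ B]) auto
  define W where "W us = return_pmf [if hd us \<in> F then best (hd us) else best undefined]" for us
  let ?p = "test_channel_joint \<mu> 1 W"
  have valid: "valid_channel 1 W" by (simp add: valid_channel_def W_def)
  have p: "?p = map_pmf (\<lambda>us. (us, [if hd us \<in> F then best (hd us) else best undefined])) (source_block \<mu> 1)"
    by (simp add: test_channel_joint_def W_def map_pmf_def bind_return_pmf)
  have "total_distortion d 1 ?p = measure_pmf.expectation P (\<lambda>u. d u (if u \<in> F then best u else best undefined))"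
    unfolding total_distortion_def p P_def
    by (auto intro!: integral_cong_AE simp: AE_measure_pmf_iff length_Suc_conv dest!: length_source_block)
  also have "\<dots> \<le> measure_pmf.expectation P (\<lambda>u. m u + \<eta> + B * indicator (- F) u)"
  proof (rule integral_mono)
    show "integrable P (\<lambda>u. d u (if u \<in> F then best u else best undefined))"
      using d by (intro integrable_pmf_bounded[of _ B]) auto
    show "integrable P (\<lambda>u. m u + \<eta> + B * indicator (- F) u)"
      using mi by (simp add: measure_pmf.emeasure_eq_measure)
    show "d u (if u \<in> F then best u else best undefined) \<le> m u + \<eta> + B * indicator (- F) u" for u
      using best[of u] d(2)[of u "best undefined"] mb(1)[of u] \<eta> by auto
  qed
  also have "\<dots> = measure_pmf.expectation P m + \<eta> + B * measure_pmf.prob P (- F)"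
    using mi by (simp add: measure_pmf.emeasure_eq_measure)
  also have "measure_pmf.expectation P m = min_distortion \<mu> d"
    unfolding P_def min_distortion_def m_def integral_map_pmf measure_pmf_source_block
    by (subst integral_distr) auto
  finally have le: "total_distortion d 1 ?p \<le> min_distortion \<mu> d + \<eta> + B * measure_pmf.prob P (- F)" .
  have "total_distortion d 1 ?p < D" using le F \<eta> unfolding \<eta>_def by (simp add: mult.commute field_simps)
  moreover have "finite (snd ` set_pmf ?p)"
    unfolding p by (rule finite_subset[of _ "(\<lambda>u. [best u]) ` (insert undefined F)"]) (use finF in auto)
  then have "integrable ?p (info_density ?p)" by (rule integrable_info_density_finite)
  then have "pair_mutual_information ?p \<le> ereal (measure_pmf.expectation ?p (info_density ?p))"
    by (simp add: pair_mutual_information_eq)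
  ultimately show ?thesis using valid unfolding test_channel_feasible_def by blast
qed

end

section \<open>Directed information\<close>

definition fwd_law :: "('x, 's::finite, 'y) fs_channel \<Rightarrow> 's \<Rightarrow> 'x list \<Rightarrow> 'y list \<Rightarrow> 's \<Rightarrow> real" where
  "fwd_law K s\<^sub>0 xs ys s = (\<Sum>ss | length ss = length xs.
     (\<Prod>i<length xs. pmf (K (xs ! i) ((s\<^sub>0 # ss) ! i)) (ys ! i, ss ! i)) * (if last (s\<^sub>0 # ss) = s then 1 else 0))"

lemma fwd_law_Nil: "fwd_law K s\<^sub>0 [] [] s = (if s\<^sub>0 = s then 1 else 0)"
  by (simp add: fwd_law_def)

lemma fwd_law_snoc:
  fixes K :: "('x, 's::finite, 'y) fs_channel"
  assumes "length ys = length xs"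
  shows "fwd_law K s\<^sub>0 (xs @ [x]) (ys @ [y]) s' = (\<Sum>s\<in>UNIV. fwd_law K s\<^sub>0 xs ys s * pmf (K x s) (y, s'))"
proof -
  let ?n = "length xs"
  let ?P = "\<lambda>ss. \<Prod>i<?n. pmf (K (xs ! i) ((s\<^sub>0 # ss) ! i)) (ys ! i, ss ! i)"
  have "fwd_law K s\<^sub>0 (xs @ [x]) (ys @ [y]) s' = (\<Sum>ss | length ss = ?n. \<Sum>s\<in>UNIV.
     (\<Prod>i<Suc ?n. pmf (K ((xs @ [x]) ! i) ((s\<^sub>0 # ss @ [s]) ! i)) ((ys @ [y]) ! i, (ss @ [s]) ! i)) * (if s = s' then 1 else 0))"
    by (simp add: fwd_law_def sum_lists_Suc)
  also have "\<dots> = (\<Sum>ss | length ss = ?n. \<Sum>s\<in>UNIV. (?P ss * pmf (K x (last (s\<^sub>0 # ss))) (y, s)) * (if s = s' then 1 else 0))"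
  proof (intro sum.cong refl arg_cong2[where f = "(*)"])
    fix ss :: "'s list" and s assume ss: "ss \<in> {ss. length ss = ?n}"
    have nth: "(s\<^sub>0 # ss @ [s]) ! i = (s\<^sub>0 # ss) ! i" if "i \<le> ?n" for i
      using that ss by (cases i) (auto simp: nth_append)
    have last: "(s\<^sub>0 # ss) ! ?n = last (s\<^sub>0 # ss)" using ss last_conv_nth[of "s\<^sub>0 # ss"] by (simp del: last.simps)
    have "(\<Prod>i<?n. pmf (K ((xs @ [x]) ! i) ((s\<^sub>0 # ss @ [s]) ! i)) ((ys @ [y]) ! i, (ss @ [s]) ! i)) = ?P ss"
      using ss assms by (intro prod.cong refl) (simp add: nth nth_append)
    then show "(\<Prod>i<Suc ?n. pmf (K ((xs @ [x]) ! i) ((s\<^sub>0 # ss @ [s]) ! i)) ((ys @ [y]) ! i, (ss @ [s]) ! i)) =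
       ?P ss * pmf (K x (last (s\<^sub>0 # ss))) (y, s)"
      using ss assms by (simp add: nth_append nth last del: nth_Cons_Suc last.simps)
  qed
  also have "\<dots> = (\<Sum>ss | length ss = ?n. ?P ss * pmf (K x (last (s\<^sub>0 # ss))) (y, s'))"
    by (simp add: sum.delta if_distrib cong: if_cong)
  also have "\<dots> = (\<Sum>ss | length ss = ?n. \<Sum>s\<in>UNIV. (?P ss * (if last (s\<^sub>0 # ss) = s then 1 else 0)) * pmf (K x s) (y, s'))"
  proof (intro sum.cong refl)
    fix ss :: "'s list"
    have "(\<Sum>s\<in>UNIV. (?P ss * (if last (s\<^sub>0 # ss) = s then 1 else 0)) * pmf (K x s) (y, s')) =
        (\<Sum>s\<in>UNIV. if last (s\<^sub>0 # ss) = s then ?P ss * pmf (K x s) (y, s') else 0)"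
      by (intro sum.cong refl) auto
    then show "?P ss * pmf (K x (last (s\<^sub>0 # ss))) (y, s') = (\<Sum>s\<in>UNIV. (?P ss * (if last (s\<^sub>0 # ss) = s then 1 else 0)) * pmf (K x s) (y, s'))"
      by (simp only: sum.delta' finite UNIV_I if_True)
  qed
  also have "\<dots> = (\<Sum>s\<in>UNIV. fwd_law K s\<^sub>0 xs ys s * pmf (K x s) (y, s'))"
    unfolding fwd_law_def sum_distrib_right by (rule sum.swap)
  finally show ?thesis .
qed

lemma channel_law_fwd: "channel_law K p\<^sub>0 xs ys = (\<Sum>s\<^sub>0\<in>UNIV. pmf p\<^sub>0 s\<^sub>0 * (\<Sum>s\<in>UNIV. fwd_law K s\<^sub>0 xs ys s))"
  unfolding channel_law_def fwd_law_def
  by (subst sum.swap) (simp add: sum_distrib_left[symmetric])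

lemma channel_law_snoc_sum:
  fixes K :: "('x, 's::finite, 'y::finite) fs_channel"
  assumes "length ys = length xs"
  shows "(\<Sum>y\<in>UNIV. channel_law K p\<^sub>0 (xs @ [x]) (ys @ [y])) = channel_law K p\<^sub>0 xs ys"
proof -
  have 1: "(\<Sum>y\<in>UNIV. \<Sum>s'\<in>UNIV. pmf (K x s) (y, s')) = 1" for s
    using sum_pmf_eq_1[of UNIV "K x s"] by (simp add: sum.cartesian_product)
  have "(\<Sum>y\<in>UNIV. \<Sum>s'\<in>UNIV. fwd_law K s\<^sub>0 (xs @ [x]) (ys @ [y]) s') = (\<Sum>s\<in>UNIV. fwd_law K s\<^sub>0 xs ys s)" for s\<^sub>0
  proof -
    have "(\<Sum>y\<in>UNIV. \<Sum>s'\<in>UNIV. fwd_law K s\<^sub>0 (xs @ [x]) (ys @ [y]) s') =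
        (\<Sum>y\<in>UNIV. \<Sum>s\<in>UNIV. \<Sum>s'\<in>UNIV. fwd_law K s\<^sub>0 xs ys s * pmf (K x s) (y, s'))"
      unfolding fwd_law_snoc[OF assms] by (intro sum.cong refl sum.swap)
    also have "\<dots> = (\<Sum>s\<in>UNIV. fwd_law K s\<^sub>0 xs ys s * (\<Sum>y\<in>UNIV. \<Sum>s'\<in>UNIV. pmf (K x s) (y, s')))"
      by (subst sum.swap) (simp add: sum_distrib_left)
    finally show ?thesis by (simp add: 1)
  qed
  then show ?thesis unfolding channel_law_fwd
    by (subst sum.swap) (simp add: sum_distrib_left[symmetric])
qed

lemma channel_law_Nil: "channel_law K p\<^sub>0 [] [] = 1"
  by (simp add: channel_law_def sum_pmf_eq_1)

definition enc_inputs :: "('y \<Rightarrow> 'z) \<Rightarrow> ('z list \<Rightarrow> 'x) \<Rightarrow> 'y list \<Rightarrow> 'x list" where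
  "enc_inputs z e ys = map (\<lambda>i. e (map z (take i ys))) [0..<length ys]"

lemma length_enc_inputs [simp]: "length (enc_inputs z e ys) = length ys"
  by (simp add: enc_inputs_def)

lemma enc_inputs_snoc: "enc_inputs z e (ys @ [y]) = enc_inputs z e ys @ [e (map z ys)]"
  by (auto simp: enc_inputs_def)

lemma set_channel_run:
  "(ys, s) \<in> set_pmf (channel_run K z e s\<^sub>0 n) \<Longrightarrow> length ys = n"
  by (induction n arbitrary: ys s) (auto split: prod.splits)

lemma pmf_channel_run:
  fixes K :: "('x, 's::finite, 'y::finite) fs_channel"
  shows "pmf (channel_run K z e s\<^sub>0 n) (ys, s) = (if length ys = n then fwd_law K s\<^sub>0 (enc_inputs z e ys) ys s else 0)"
proof (induction n arbitrary: ys s)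
  case 0
  then show ?case by (auto simp: fwd_law_Nil enc_inputs_def pmf_return indicator_def)
next
  case (Suc n)
  show ?case
  proof (cases "length ys = Suc n")
    case False
    then have "(ys, s) \<notin> set_pmf (channel_run K z e s\<^sub>0 (Suc n))"
      using set_channel_run[of ys s K z e s\<^sub>0 "Suc n"] by (meson set_channel_run)
    then have "pmf (channel_run K z e s\<^sub>0 (Suc n)) (ys, s) = 0" by (rule iffD2[OF pmf_eq_0_set_pmf])
    then show ?thesis using False by (simp only: if_False)
  next
    case True
    then obtain ys0 y where ys: "ys = ys0 @ [y]" and len: "length ys0 = n" by (auto simp: length_Suc_conv_rev)
    let ?R = "channel_run K z e s\<^sub>0 n"
    let ?h = "\<lambda>(ys, s'). map_pmf (\<lambda>(y, s''). (ys @ [y], s'')) (K (e (map z ys)) s')"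
    have h: "pmf (?h (b, s')) (ys, s) = (if b = ys0 then pmf (K (e (map z ys0)) s') (y, s) else 0)" for b s'
    proof (cases "b = ys0")
      case True
      have "pmf (map_pmf (\<lambda>(y, s''). (b @ [y], s'')) (K (e (map z b)) s')) ((\<lambda>(y, s''). (b @ [y], s'')) (y, s)) = pmf (K (e (map z b)) s') (y, s)"
        by (rule pmf_map_inj') (auto simp: inj_on_def)
      then show ?thesis using True by (simp add: ys)
    next
      case False
      then show ?thesis by (auto simp: ys pmf_eq_0_set_pmf)
    qed
    have "pmf (channel_run K z e s\<^sub>0 (Suc n)) (ys, s) = measure_pmf.expectation ?R (\<lambda>x. pmf (?h x) (ys, s))"
      by (simp add: pmf_bind)
    also have "\<dots> = (\<Sum>x\<in>{ys0} \<times> UNIV. pmf ?R x * pmf (?h x) (ys, s))"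
      by (subst integral_measure_pmf[of "{ys0} \<times> UNIV"]) (use h in \<open>auto split: if_splits\<close>)
    also have "\<dots> = (\<Sum>s'\<in>UNIV. pmf ?R (ys0, s') * pmf (?h (ys0, s')) (ys, s))"
      by (rule sum.reindex_bij_witness[of _ "\<lambda>s'. (ys0, s')" snd]) auto
    also have "\<dots> = (\<Sum>s'\<in>UNIV. fwd_law K s\<^sub>0 (enc_inputs z e ys0) ys0 s' * pmf (K (e (map z ys0)) s') (y, s))"
      by (simp only: h Suc.IH len) simp
    also have "\<dots> = fwd_law K s\<^sub>0 (enc_inputs z e ys) ys s"
      unfolding ys enc_inputs_snoc by (subst fwd_law_snoc) auto
    finally show ?thesis using True by simp
  qed
qed

definition mixed_output ::
    "('x, 's, 'y) fs_channel \<Rightarrow> 's pmf \<Rightarrow> ('y \<Rightarrow> 'z) \<Rightarrow> ('z list \<Rightarrow> 'x) \<Rightarrow> nat \<Rightarrow> 'y list pmf" where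
  "mixed_output K p\<^sub>0 z e N = bind_pmf p\<^sub>0 (\<lambda>s\<^sub>0. channel_output K z e s\<^sub>0 N)"

lemma length_mixed_output: "ys \<in> set_pmf (mixed_output K p\<^sub>0 z e N) \<Longrightarrow> length ys = N"
  by (auto simp: mixed_output_def channel_output_def dest: set_channel_run)

lemma pmf_mixed_output:
  fixes K :: "('x, 's::finite, 'y::finite) fs_channel"
  assumes "length ys = N"
  shows "pmf (mixed_output K p\<^sub>0 z e N) ys = channel_law K p\<^sub>0 (enc_inputs z e ys) ys"
proof -
  have "pmf (channel_output K z e s\<^sub>0 N) ys = (\<Sum>s\<in>UNIV. fwd_law K s\<^sub>0 (enc_inputs z e ys) ys s)" for s\<^sub>0
  proof -
    have "pmf (channel_output K z e s\<^sub>0 N) ys = measure_pmf.prob (channel_run K z e s\<^sub>0 N) (Pair ys ` UNIV)"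
      unfolding channel_output_def pmf_map by (rule arg_cong[where f = "measure_pmf.prob _"]) auto
    also have "\<dots> = (\<Sum>s\<in>UNIV. pmf (channel_run K z e s\<^sub>0 N) (ys, s))"
      by (subst measure_measure_pmf_finite) (auto simp: sum.reindex inj_on_def)
    finally show ?thesis using assms by (simp add: pmf_channel_run)
  qed
  then show ?thesis
    unfolding mixed_output_def channel_law_fwd pmf_bind
    by (subst integral_measure_pmf[of UNIV]) auto
qed

lemma channel_law_nonneg: "0 \<le> channel_law K p\<^sub>0 xs ys"
  unfolding channel_law_def by (intro sum_nonneg mult_nonneg_nonneg prod_nonneg) auto

lemma channel_law_le_1:
  fixes K :: "('x, 's::finite, 'y::finite) fs_channel"
  assumes "length xs = length ys"
  shows "channel_law K p\<^sub>0 xs ys \<le> 1"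
proof -
  define e where "e zs = xs ! length zs" for zs :: "nat list"
  have enc: "enc_inputs (\<lambda>_. 0) e ys = xs"
    by (rule nth_equalityI) (simp_all add: enc_inputs_def e_def assms)
  have "pmf (mixed_output K p\<^sub>0 (\<lambda>_. 0) e (length ys)) ys = channel_law K p\<^sub>0 xs ys"
    unfolding enc[symmetric] by (rule pmf_mixed_output) simp
  then show ?thesis using pmf_le_1[of "mixed_output K p\<^sub>0 (\<lambda>_. 0) e (length ys)" ys] by simp
qed

lemma set_input_output_joint:
  fixes K :: "('x::finite, 's::finite, 'y::finite) fs_channel"
  assumes "(xs, ys) \<in> set_pmf (input_output_joint K p\<^sub>0 z N Q)"
  shows "length xs = N" "length ys = N" "channel_law K p\<^sub>0 xs ys > 0" "causal_input Q xs (map z (butlast ys)) > 0"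
proof -
  have "pmf (input_output_joint K p\<^sub>0 z N Q) (xs, ys) > 0" using assms by (simp add: pmf_positive)
  then have *: "length xs = N \<and> length ys = N \<and> causal_input Q xs (map z (butlast ys)) * channel_law K p\<^sub>0 xs ys > 0"
    by (auto simp: pmf_input_output_joint split: if_splits)
  then show "length xs = N" "length ys = N" by auto
  have "0 \<le> causal_input Q xs (map z (butlast ys))" by (auto simp: causal_input_def intro!: prod_nonneg)
  then show "channel_law K p\<^sub>0 xs ys > 0" "causal_input Q xs (map z (butlast ys)) > 0"
    using * channel_law_nonneg[of K p\<^sub>0 xs ys] by (auto simp: zero_less_mult_iff)
qed

lemma joint_extend_sum:
  fixes K :: "('x::finite, 's::finite, 'y::finite) fs_channel"
  assumes "length a = Suc n" "length b = n"
  shows "pmf (map_pmf (\<lambda>(xs, ys). (xs, take n ys)) (input_output_joint K p\<^sub>0 z (Suc n) Q)) (a, b) =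
    causal_input Q a (map z b) * channel_law K p\<^sub>0 (butlast a) b"
proof -
  let ?P = "input_output_joint K p\<^sub>0 z (Suc n) Q"
  have a: "a = butlast a @ [last a]" using assms by (intro append_butlast_last_id[symmetric]) auto
  have "pmf (map_pmf (\<lambda>(xs, ys). (xs, take n ys)) ?P) (a, b) = measure_pmf.prob ?P ((\<lambda>y. (a, b @ [y])) ` UNIV)"
    unfolding pmf_map
  proof (rule measure_pmf.finite_measure_eq_AE, rule AE_pmfI)
    fix x assume "x \<in> set_pmf ?P"
    moreover obtain xs ys where x: "x = (xs, ys)" by (cases x)
    ultimately have len: "length ys = Suc n" using set_input_output_joint by blast
    then obtain b' y where "ys = b' @ [y]" "length b' = n" by (auto simp: length_Suc_conv_rev)
    then show "(x \<in> (\<lambda>(xs, ys). (xs, take n ys)) -` {(a, b)}) = (x \<in> (\<lambda>y. (a, b @ [y])) ` UNIV)"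
      using assms by (auto simp: x)
  qed auto
  also have "\<dots> = (\<Sum>y\<in>UNIV. pmf ?P (a, b @ [y]))"
    by (subst measure_measure_pmf_finite) (auto simp: sum.reindex inj_on_def)
  also have "\<dots> = (\<Sum>y\<in>UNIV. causal_input Q a (map z b) * channel_law K p\<^sub>0 (butlast a @ [last a]) (b @ [y]))"
    using assms a by (simp add: pmf_input_output_joint)
  also have "\<dots> = causal_input Q a (map z b) * channel_law K p\<^sub>0 (butlast a) b"
    unfolding sum_distrib_left[symmetric] using assms by (subst channel_law_snoc_sum) auto
  finally show ?thesis .
qed

lemma joint_take_Suc:
  fixes K :: "('x::finite, 's::finite, 'y::finite) fs_channel"
  shows "map_pmf (\<lambda>(xs, ys). (take n xs, take n ys)) (input_output_joint K p\<^sub>0 z (Suc n) Q) = input_output_joint K p\<^sub>0 z n Q"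
proof (rule pmf_eqI)
  fix ab :: "'x list \<times> 'y list"
  obtain a b where ab: "ab = (a, b)" by (cases ab)
  let ?P = "input_output_joint K p\<^sub>0 z (Suc n) Q"
  let ?P' = "map_pmf (\<lambda>(xs, ys). (xs, take n ys)) ?P"
  have eq: "map_pmf (\<lambda>(xs, ys). (take n xs, take n ys)) ?P = map_pmf (\<lambda>(xs, ys). (take n xs, ys)) ?P'"
    by (simp add: pmf.map_comp comp_def case_prod_unfold)
  show "pmf (map_pmf (\<lambda>(xs, ys). (take n xs, take n ys)) ?P) ab = pmf (input_output_joint K p\<^sub>0 z n Q) ab"
  proof (cases "length a = n \<and> length b = n")
    case False
    then have "ab \<notin> set_pmf (map_pmf (\<lambda>(xs, ys). (take n xs, take n ys)) ?P)"
      by (auto simp: ab dest: set_input_output_joint(1) set_input_output_joint(2))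
    then have "pmf (map_pmf (\<lambda>(xs, ys). (take n xs, take n ys)) ?P) ab = 0" by (rule iffD2[OF pmf_eq_0_set_pmf])
    then show ?thesis using False by (simp only: ab pmf_input_output_joint if_False)
  next
    case True
    have "pmf (map_pmf (\<lambda>(xs, ys). (take n xs, ys)) ?P') (a, b) = measure_pmf.prob ?P' ((\<lambda>x. (a @ [x], b)) ` UNIV)"
      unfolding pmf_map[of _ ?P']
    proof (rule measure_pmf.finite_measure_eq_AE, rule AE_pmfI)
      fix x assume "x \<in> set_pmf ?P'"
      moreover obtain xs ys where x: "x = (xs, ys)" by (cases x)
      ultimately have len: "length xs = Suc n" using set_input_output_joint(1) by fastforce
      then obtain a' x' where "xs = a' @ [x']" "length a' = n" by (auto simp: length_Suc_conv_rev)
      then show "(x \<in> (\<lambda>(xs, ys). (take n xs, ys)) -` {(a, b)}) = (x \<in> (\<lambda>x. (a @ [x], b)) ` UNIV)"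
        using True by (auto simp: x)
    qed auto
    also have "\<dots> = (\<Sum>x\<in>UNIV. pmf ?P' (a @ [x], b))"
      by (subst measure_measure_pmf_finite) (auto simp: sum.reindex inj_on_def)
    also have "\<dots> = (\<Sum>x\<in>UNIV. (causal_input Q a (map z b) * pmf (Q a (map z b)) x) * channel_law K p\<^sub>0 a b)"
    proof (rule sum.cong[OF refl])
      fix x
      have "causal_input Q (a @ [x]) (map z b) = causal_input Q a (map z b) * pmf (Q a (map z b)) x"
        using True by (simp add: causal_input_def nth_append)
      then show "pmf ?P' (a @ [x], b) = (causal_input Q a (map z b) * pmf (Q a (map z b)) x) * channel_law K p\<^sub>0 a b"
        using True by (subst joint_extend_sum) auto
    qed
    also have "\<dots> = causal_input Q a (map z b) * channel_law K p\<^sub>0 a b"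
      unfolding sum_distrib_right[symmetric] sum_distrib_left[symmetric] by (simp add: sum_pmf_eq_1)
    also have "causal_input Q a (map z b) = causal_input Q a (map z (butlast b))"
      using True unfolding causal_input_def by (intro prod.cong refl) (simp add: map_butlast take_butlast)
    finally show ?thesis using True unfolding eq ab by (simp add: pmf_input_output_joint)
  qed
qed

lemma joint_take:
  fixes K :: "('x::finite, 's::finite, 'y::finite) fs_channel"
  assumes "n \<le> N"
  shows "map_pmf (\<lambda>(xs, ys). (take n xs, take n ys)) (input_output_joint K p\<^sub>0 z N Q) = input_output_joint K p\<^sub>0 z n Q"
  using assms
proof (induction N rule: dec_induct)
  case base
  have "map_pmf (\<lambda>(xs, ys). (take n xs, take n ys)) (input_output_joint K p\<^sub>0 z n Q) = map_pmf (\<lambda>x. x) (input_output_joint K p\<^sub>0 z n Q)"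
    by (intro map_pmf_cong refl) (auto dest: set_input_output_joint(1,2))
  then show ?case by simp
next
  case (step m)
  have "map_pmf (\<lambda>(xs, ys). (take n xs, take n ys)) (input_output_joint K p\<^sub>0 z (Suc m) Q) =
     map_pmf (\<lambda>(xs, ys). (take n xs, take n ys)) (map_pmf (\<lambda>(xs, ys). (take m xs, take m ys)) (input_output_joint K p\<^sub>0 z (Suc m) Q))"
    using step by (simp add: pmf.map_comp comp_def case_prod_unfold min_absorb1)
  then show ?case using step by (simp add: joint_take_Suc)
qed

lemma finite_set_input_output_joint:
  fixes K :: "('x::finite, 's::finite, 'y::finite) fs_channel"
  shows "finite (set_pmf (input_output_joint K p\<^sub>0 z N Q))"
  by (rule finite_subset[of _ "{xs. length xs = N} \<times> {ys. length ys = N}"])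
     (auto intro!: finite_cartesian_product finite_lists_eq dest: set_input_output_joint(1,2))

lemma directed_information_eq:
  fixes K :: "('x::finite, 's::finite, 'y::finite) fs_channel" and p\<^sub>0 :: "'s pmf" and z :: "'y \<Rightarrow> 'z"
  defines "P \<equiv> \<lambda>N Q. input_output_joint K p\<^sub>0 z N Q"
  shows "directed_information K p\<^sub>0 z N Q =
    measure_pmf.expectation (P N Q) (\<lambda>(xs, ys). log 2 (channel_law K p\<^sub>0 xs ys / pmf (map_pmf snd (P N Q)) ys))"
proof -
  let ?P = "P N Q"
  define L where "L i x = log 2 (channel_law K p\<^sub>0 (take i (fst x)) (take i (snd x)))" for i and x :: "'x list \<times> 'y list"
  define H where "H i x = log 2 (pmf (map_pmf (\<lambda>(xs, ys). take i ys) ?P) (take i (snd x)))" for i and x :: "'x list \<times> 'y list"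
  have fin: "finite (set_pmf ?P)" unfolding P_def by (rule finite_set_input_output_joint)
  have int: "integrable ?P h" for h :: "_ \<Rightarrow> real" by (rule integrable_measure_pmf_finite[OF fin])
  have len: "length xs = N" "length ys = N" if "(xs, ys) \<in> set_pmf ?P" for xs ys
    using that set_input_output_joint unfolding P_def by blast+
  have cmi: "prob_space.conditional_mutual_information (measure_pmf ?P) 2
        (count_space UNIV) (count_space UNIV) (count_space UNIV)
        (\<lambda>(xs, ys). take (Suc i) xs) (\<lambda>(xs, ys). ys ! i) (\<lambda>(xs, ys). take i ys) =
      measure_pmf.expectation ?P (\<lambda>x. (L (Suc i) x - H (Suc i) x) - (L i x - H i x))" if i: "i < N" for i
  proof -
    let ?X = "\<lambda>(xs, ys). take (Suc i) xs :: 'x list" and ?Y = "\<lambda>(xs, ys). ys ! i :: 'y" and ?Z = "\<lambda>(xs, ys). take i ys :: 'y list"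
    let ?p1 = "map_pmf (\<lambda>x. (?X x, (?Y x, ?Z x))) ?P"
    let ?p2 = "map_pmf (\<lambda>x. (?X x, ?Z x)) ?P"
    have pm: "count_space (UNIV :: 'y set) \<Otimes>\<^sub>M count_space (UNIV :: 'y list set) = count_space UNIV"
      by (subst pair_measure_countable) auto
    have "prob_space.conditional_mutual_information (measure_pmf ?P) 2
        (count_space UNIV) (count_space UNIV) (count_space UNIV) ?X ?Y ?Z =
      measure_pmf.expectation ?P (\<lambda>x. info_density ?p1 (?X x, (?Y x, ?Z x))) - measure_pmf.expectation ?P (\<lambda>x. info_density ?p2 (?X x, ?Z x))"
      unfolding prob_space.conditional_mutual_information_def[OF measure_pmf.prob_space_axioms] pm
        mutual_information_pmf[of ?P ?X "\<lambda>x. (?Y x, ?Z x)"] mutual_information_pmf[of ?P ?X ?Z] by simp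
    also have "\<dots> = measure_pmf.expectation ?P (\<lambda>x. info_density ?p1 (?X x, (?Y x, ?Z x)) - info_density ?p2 (?X x, ?Z x))"
      by (rule Bochner_Integration.integral_diff[symmetric]) (rule int)+
    also have "\<dots> = measure_pmf.expectation ?P (\<lambda>x. (L (Suc i) x - H (Suc i) x) - (L i x - H i x))"
    proof (rule integral_cong_AE)
      show "AE x in ?P. info_density ?p1 (?X x, (?Y x, ?Z x)) - info_density ?p2 (?X x, ?Z x) = (L (Suc i) x - H (Suc i) x) - (L i x - H i x)"
      proof (rule AE_pmfI)
        fix x assume x: "x \<in> set_pmf ?P"
        obtain xs ys where xy: "x = (xs, ys)" by (cases x)
        note l = len[OF x[unfolded xy]]
        let ?J = "input_output_joint K p\<^sub>0 z (Suc i) Q"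
        have J: "map_pmf (\<lambda>(xs, ys). (take (Suc i) xs, take (Suc i) ys)) ?P = ?J"
          unfolding P_def using i by (intro joint_take) simp
        let ?a = "take (Suc i) xs" and ?b = "take (Suc i) ys"
        have ab: "(?a, ?b) \<in> set_pmf ?J" unfolding J[symmetric] using x by (force simp: xy)
        note pos = set_input_output_joint[OF ab]
        have bl: "butlast ?b = take i ys" "butlast ?a = take i xs"
          using i l by (auto simp: butlast_take)
        define c where "c = causal_input Q ?a (map z (take i ys))"
        have c: "c > 0" using pos(4) by (simp add: bl c_def)
        let ?\<psi> = "\<lambda>b :: 'y list. (b ! i, take i b)"
        have inj: "inj_on ?\<psi> {b. length b = Suc i}"
          by (auto intro!: inj_onI simp: list_eq_iff_nth_eq less_Suc_eq)
        have A1: "pmf ?p1 (?a, (ys ! i, take i ys)) = c * channel_law K p\<^sub>0 ?a ?b"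
        proof -
          have "?p1 = map_pmf (\<lambda>(a, b). (a, ?\<psi> b)) ?J"
            unfolding J[symmetric] by (simp add: pmf.map_comp comp_def case_prod_unfold min_def)
          then have "pmf ?p1 (?a, ?\<psi> ?b) = pmf (map_pmf (\<lambda>(a, b). (a, ?\<psi> b)) ?J) ((\<lambda>(a, b). (a, ?\<psi> b)) (?a, ?b))" by simp
          also have "\<dots> = pmf ?J (?a, ?b)"
          proof (rule pmf_map_inj[OF _ ab])
            show "inj_on (\<lambda>(a, b). (a, ?\<psi> b)) (set_pmf ?J)"
            proof (rule inj_onI)
              fix u w assume u: "u \<in> set_pmf ?J" and w: "w \<in> set_pmf ?J" and eq: "(\<lambda>(a, b). (a, ?\<psi> b)) u = (\<lambda>(a, b). (a, ?\<psi> b)) w"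
              obtain a b a' b' where uw: "u = (a, b)" "w = (a', b')" by (cases u, cases w)
              have "length b = Suc i" "length b' = Suc i"
                using set_input_output_joint(2)[OF u[unfolded uw]] set_input_output_joint(2)[OF w[unfolded uw]] .
              then show "u = w" using inj_onD[OF inj, of b b'] eq by (simp add: uw)
            qed
          qed
          also have "\<dots> = c * channel_law K p\<^sub>0 ?a ?b" using pos by (simp add: pmf_input_output_joint c_def bl)
          finally show ?thesis by (simp add: min_def)
        qed
        have A2: "pmf (map_pmf snd ?p1) (ys ! i, take i ys) = pmf (map_pmf (\<lambda>(xs, ys). take (Suc i) ys) ?P) ?b"
        proof -
          have "map_pmf snd ?p1 = map_pmf ?\<psi> (map_pmf (\<lambda>(xs, ys). take (Suc i) ys) ?P)"
            by (simp add: pmf.map_comp comp_def case_prod_unfold min_def)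
          then have "pmf (map_pmf snd ?p1) (?\<psi> ?b) = pmf (map_pmf ?\<psi> (map_pmf (\<lambda>(xs, ys). take (Suc i) ys) ?P)) (?\<psi> ?b)" by simp
          also have "\<dots> = pmf (map_pmf (\<lambda>(xs, ys). take (Suc i) ys) ?P) ?b"
          proof (rule pmf_map_inj)
            show "inj_on ?\<psi> (set_pmf (map_pmf (\<lambda>(xs, ys). take (Suc i) ys) ?P))"
              by (rule inj_on_subset[OF inj]) (use i len in auto)
            show "?b \<in> set_pmf (map_pmf (\<lambda>(xs, ys). take (Suc i) ys) ?P)" using x by (force simp: xy)
          qed
          finally show ?thesis by (simp add: min_def)
        qed
        have A3: "pmf ?p2 (?a, take i ys) = c * channel_law K p\<^sub>0 (take i xs) (take i ys)"
        proof -
          have "?p2 = map_pmf (\<lambda>(xs, ys). (xs, take i ys)) ?J"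
            unfolding J[symmetric] by (simp add: pmf.map_comp comp_def case_prod_unfold min_def)
          then show ?thesis using i l by (simp add: joint_extend_sum bl c_def)
        qed
        have A4: "map_pmf snd ?p2 = map_pmf (\<lambda>(xs, ys). take i ys) ?P"
          by (simp add: pmf.map_comp comp_def case_prod_unfold)
        have A5: "map_pmf fst ?p1 = map_pmf fst ?p2"
          by (simp add: pmf.map_comp comp_def case_prod_unfold)
        define f where "f = pmf (map_pmf fst ?p2) ?a"
        have f: "f > 0"
        proof -
          have "?a \<in> set_pmf (map_pmf fst ?p2)" using x by (force simp: xy)
          then show ?thesis unfolding f_def by (simp only: pmf_positive_iff)
        qed
        have h1: "pmf (map_pmf (\<lambda>(xs, ys). take j ys) ?P) (take j ys) > 0" for j
        proof -
          have "take j ys \<in> set_pmf (map_pmf (\<lambda>(xs, ys). take j ys) ?P)" using x by (force simp: xy)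
          then show ?thesis by (simp only: pmf_positive_iff)
        qed
        have "(take i xs, take i ys) \<in> set_pmf (map_pmf (\<lambda>(xs, ys). (take i xs, take i ys)) ?P)"
          using x by (force simp: xy)
        then have "(take i xs, take i ys) \<in> set_pmf (input_output_joint K p\<^sub>0 z i Q)"
          using joint_take[of i N K p\<^sub>0 z Q] i by (simp only: P_def less_imp_le)
        then have li: "channel_law K p\<^sub>0 (take i xs) (take i ys) > 0" by (rule set_input_output_joint)
        have "info_density ?p1 (?a, (ys ! i, take i ys)) = log 2 (c * channel_law K p\<^sub>0 ?a ?b / (f * pmf (map_pmf (\<lambda>(xs, ys). take (Suc i) ys) ?P) ?b))"
          unfolding info_density_def fst_conv snd_conv A1 A2 A5 f_def ..
        moreover have "info_density ?p2 (?a, take i ys) = log 2 (c * channel_law K p\<^sub>0 (take i xs) (take i ys) / (f * pmf (map_pmf (\<lambda>(xs, ys). take i ys) ?P) (take i ys)))"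
          unfolding info_density_def fst_conv snd_conv A3 A4 f_def ..
        ultimately show "info_density ?p1 (?X x, (?Y x, ?Z x)) - info_density ?p2 (?X x, ?Z x) = (L (Suc i) x - H (Suc i) x) - (L i x - H i x)"
          using c f li pos(3) h1[of i] h1[of "Suc i"] by (simp add: xy L_def H_def log_divide log_mult)
      qed
    qed auto
    finally show ?thesis .
  qed
  have "directed_information K p\<^sub>0 z N Q = (\<Sum>i<N. measure_pmf.expectation ?P (\<lambda>x. (L (Suc i) x - H (Suc i) x) - (L i x - H i x)))"
    unfolding directed_information_def P_def[symmetric] by (intro sum.cong refl cmi) simp
  also have "\<dots> = measure_pmf.expectation ?P (\<lambda>x. \<Sum>i<N. (L (Suc i) x - H (Suc i) x) - (L i x - H i x))"
    by (rule Bochner_Integration.integral_sum[symmetric]) (rule int)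
  also have "\<dots> = measure_pmf.expectation ?P (\<lambda>x. (L N x - H N x) - (L 0 x - H 0 x))"
  proof -
    have "(\<Sum>i<N. (L (Suc i) x - H (Suc i) x) - (L i x - H i x)) = (L N x - H N x) - (L 0 x - H 0 x)" for x
      by (rule sum_lessThan_telescope[of "\<lambda>i. L i x - H i x"])
    then show ?thesis by (simp only:)
  qed
  also have "\<dots> = measure_pmf.expectation ?P (\<lambda>(xs, ys). log 2 (channel_law K p\<^sub>0 xs ys / pmf (map_pmf snd ?P) ys))"
  proof (rule integral_cong_AE)
    show "AE x in ?P. (L N x - H N x) - (L 0 x - H 0 x) = (case x of (xs, ys) \<Rightarrow> log 2 (channel_law K p\<^sub>0 xs ys / pmf (map_pmf snd ?P) ys))"
    proof (rule AE_pmfI)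
      fix x assume x: "x \<in> set_pmf ?P"
      obtain xs ys where xy: "x = (xs, ys)" by (cases x)
      note l = len[OF x[unfolded xy]]
      have "map_pmf (\<lambda>(xs, ys). take N ys) ?P = map_pmf snd ?P"
        by (intro map_pmf_cong refl) (auto dest: len)
      moreover have "pmf (map_pmf snd ?P) ys > 0" using x by (force simp: xy pmf_positive_iff)
      moreover have "channel_law K p\<^sub>0 xs ys > 0" using x unfolding P_def xy by (rule set_input_output_joint)
      ultimately show "(L N x - H N x) - (L 0 x - H 0 x) = (case x of (xs, ys) \<Rightarrow> log 2 (channel_law K p\<^sub>0 xs ys / pmf (map_pmf snd ?P) ys))"
        using l by (simp add: xy L_def H_def channel_law_Nil log_divide case_prod_unfold map_pmf_const)
    qed
  qed auto
  finally show ?thesis .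
qed

lemma bdd_above_directed_information:
  fixes K :: "('x::finite, 's::finite, 'y::finite) fs_channel" and z :: "'y \<Rightarrow> 'z"
  shows "bdd_above (range (directed_information K p\<^sub>0 z N))"
proof (rule bdd_aboveI2)
  fix Q :: "'x list \<Rightarrow> 'z list \<Rightarrow> 'x pmf"
  let ?P = "input_output_joint K p\<^sub>0 z N Q"
  let ?Y = "map_pmf snd ?P"
  let ?A = "{ys :: 'y list. length ys = N}"
  have fin: "finite (set_pmf ?P)" by (rule finite_set_input_output_joint)
  have "directed_information K p\<^sub>0 z N Q \<le> measure_pmf.expectation ?P (\<lambda>x. - log 2 (pmf ?Y (snd x)))"
    unfolding directed_information_eq
  proof (rule integral_mono_AE)
    show "AE x in ?P. (case x of (xs, ys) \<Rightarrow> log 2 (channel_law K p\<^sub>0 xs ys / pmf ?Y ys)) \<le> - log 2 (pmf ?Y (snd x))"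
    proof (rule AE_pmfI)
      fix x assume x: "x \<in> set_pmf ?P"
      obtain xs ys where xy: "x = (xs, ys)" by (cases x)
      note j = set_input_output_joint[OF x[unfolded xy]]
      have "pmf ?Y ys > 0" using x by (force simp: xy pmf_positive_iff)
      moreover have "log 2 (channel_law K p\<^sub>0 xs ys) \<le> 0" using j channel_law_le_1[of xs ys K p\<^sub>0] by simp
      ultimately show "(case x of (xs, ys) \<Rightarrow> log 2 (channel_law K p\<^sub>0 xs ys / pmf ?Y ys)) \<le> - log 2 (pmf ?Y (snd x))"
        using j by (simp add: xy log_divide)
    qed
  qed (rule integrable_measure_pmf_finite[OF fin])+
  also have "\<dots> = measure_pmf.expectation ?Y (\<lambda>ys. - log 2 (pmf ?Y ys))" by simp
  also have "\<dots> = (\<Sum>ys\<in>?A. pmf ?Y ys * (- log 2 (pmf ?Y ys)))"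
    by (subst integral_measure_pmf[of ?A]) (auto simp: finite_lists_eq dest: set_input_output_joint(2))
  also have "\<dots> \<le> (\<Sum>ys\<in>?A. 1 / ln 2)"
  proof (rule sum_mono)
    fix ys
    show "pmf ?Y ys * (- log 2 (pmf ?Y ys)) \<le> 1 / ln 2"
    proof (cases "pmf ?Y ys = 0")
      case False
      then have p: "pmf ?Y ys > 0" by (simp add: less_le)
      have "pmf ?Y ys * (- log 2 (pmf ?Y ys)) \<le> pmf ?Y ys * ((1 / pmf ?Y ys - 1) / ln 2)"
        using neg_log2_le[OF p] p by (intro mult_left_mono) auto
      also have "\<dots> = (1 - pmf ?Y ys) / ln 2" using p by (simp add: field_simps)
      also have "\<dots> \<le> 1 / ln 2" by (intro divide_right_mono) auto
      finally show ?thesis .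
    qed simp
  qed
  finally show "directed_information K p\<^sub>0 z N Q \<le> (\<Sum>ys\<in>?A. 1 / ln 2)" .
qed

section \<open>The converse\<close>

text \<open>On pasts of probability 0 the value is irrelevant, but some pmf has to be chosen.\<close>

definition induced_input :: "'a pmf \<Rightarrow> ('a \<Rightarrow> 'z list \<Rightarrow> 'x) \<Rightarrow> 'x list \<Rightarrow> 'z list \<Rightarrow> 'x pmf" where
  "induced_input P f xs zs =
     (let S = {u. \<forall>i<length xs. f u (take i zs) = xs ! i}
      in if set_pmf P \<inter> S = {} then map_pmf (\<lambda>u. f u zs) P else map_pmf (\<lambda>u. f u zs) (cond_pmf P S))"

lemma causal_input_induced:
  "causal_input (induced_input P f) xs zs = measure_pmf.prob P {u. \<forall>i<length xs. f u (take i zs) = xs ! i}"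
proof -
  define S where "S n = {u. \<forall>i<n. f u (take i zs) = xs ! i}" for n
  have "(\<Prod>i<n. pmf (induced_input P f (take i xs) (take i zs)) (xs ! i)) = measure_pmf.prob P (S n)" if "n \<le> length xs" for n
    using that
  proof (induction n)
    case 0
    then show ?case by (simp add: S_def)
  next
    case (Suc n)
    let ?A = "(\<lambda>u. f u (take n zs)) -` {xs ! n}"
    have S: "{u. \<forall>i<length (take n xs). f u (take i (take n zs)) = take n xs ! i} = S n"
      using Suc.prems by (auto simp: S_def min_def)
    have SA: "S (Suc n) = S n \<inter> ?A" by (auto simp: S_def less_Suc_eq)
    have "measure_pmf.prob P (S n) * pmf (induced_input P f (take n xs) (take n zs)) (xs ! n) = measure_pmf.prob P (S (Suc n))"
    proof (cases "set_pmf P \<inter> S n = {}")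
      case True
      then have "measure_pmf.prob P (S n) = 0" by (simp add: measure_pmf_zero_iff)
      moreover have "measure_pmf.prob P (S (Suc n)) \<le> measure_pmf.prob P (S n)"
        unfolding SA by (intro measure_pmf.finite_measure_mono) auto
      ultimately show ?thesis using measure_nonneg[of "measure_pmf P" "S (Suc n)"] by simp
    next
      case False
      have "pmf (induced_input P f (take n xs) (take n zs)) (xs ! n) = measure_pmf.prob (cond_pmf P (S n)) ?A"
        unfolding induced_input_def Let_def S using False by (simp add: pmf_map)
      also have "\<dots> = measure_pmf.prob P (S n \<inter> ?A) / measure_pmf.prob P (S n)"
        unfolding cond_pmf.rep_eq[OF False]
        by (subst measure_uniform_measure) (auto simp: emeasure_measure_pmf_not_zero[OF False])
      finally show ?thesis using measure_measure_pmf_not_zero[OF False] by (simp add: SA)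
    qed
    then show ?case using Suc by simp
  qed
  from this[OF order_refl] show ?thesis by (simp add: causal_input_def S_def)
qed

lemma joint_induced:
  fixes K :: "('x::finite, 's::finite, 'y::finite) fs_channel"
  shows "map_pmf (\<lambda>(u, ys). (enc_inputs z (f u) ys, ys)) (bind_pmf P (\<lambda>u. map_pmf (Pair u) (mixed_output K p\<^sub>0 z (f u) N))) =
    input_output_joint K p\<^sub>0 z N (induced_input P f)"
proof (rule pmf_eqI)
  fix ab :: "'x list \<times> 'y list"
  obtain xs ys where ab: "ab = (xs, ys)" by (cases ab)
  let ?V = "\<lambda>u. mixed_output K p\<^sub>0 z (f u) N"
  have "pmf (map_pmf (\<lambda>(u, ys). (enc_inputs z (f u) ys, ys)) (bind_pmf P (\<lambda>u. map_pmf (Pair u) (?V u)))) (xs, ys) =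
      measure_pmf.expectation P (\<lambda>u. pmf (map_pmf (\<lambda>ys. (enc_inputs z (f u) ys, ys)) (?V u)) (xs, ys))"
    by (simp add: map_bind_pmf pmf.map_comp comp_def pmf_bind)
  also have "\<dots> = measure_pmf.expectation P (\<lambda>u. if enc_inputs z (f u) ys = xs then pmf (?V u) ys else 0)"
  proof (rule Bochner_Integration.integral_cong[OF refl])
    fix u
    show "pmf (map_pmf (\<lambda>ys. (enc_inputs z (f u) ys, ys)) (?V u)) (xs, ys) = (if enc_inputs z (f u) ys = xs then pmf (?V u) ys else 0)"
    proof (cases "enc_inputs z (f u) ys = xs")
      case True
      have "pmf (map_pmf (\<lambda>ys. (enc_inputs z (f u) ys, ys)) (?V u)) ((\<lambda>ys. (enc_inputs z (f u) ys, ys)) ys) = pmf (?V u) ys"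
        by (rule pmf_map_inj') (auto simp: inj_on_def)
      then show ?thesis using True by simp
    next
      case False
      then have "(xs, ys) \<notin> set_pmf (map_pmf (\<lambda>ys. (enc_inputs z (f u) ys, ys)) (?V u))" by auto
      then show ?thesis using False by (simp only: pmf_eq_0_set_pmf if_False not_False_eq_True)
    qed
  qed
  also have "\<dots> = pmf (input_output_joint K p\<^sub>0 z N (induced_input P f)) (xs, ys)"
  proof (cases "length xs = N \<and> length ys = N")
    case False
    have "(if enc_inputs z (f u) ys = xs then pmf (?V u) ys else 0) = 0" for u
      using False length_mixed_output[of ys K p\<^sub>0 z "f u" N] by (auto simp: pmf_eq_0_set_pmf)
    then show ?thesis using False by (simp only: pmf_input_output_joint if_False) simp
  next
    case True
    have "measure_pmf.expectation P (\<lambda>u. if enc_inputs z (f u) ys = xs then pmf (?V u) ys else 0) =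
        measure_pmf.expectation P (\<lambda>u. indicator {u. enc_inputs z (f u) ys = xs} u * channel_law K p\<^sub>0 xs ys)"
      using True by (intro Bochner_Integration.integral_cong) (auto simp: pmf_mixed_output)
    also have "\<dots> = measure_pmf.prob P {u. enc_inputs z (f u) ys = xs} * channel_law K p\<^sub>0 xs ys" by simp
    also have "{u. enc_inputs z (f u) ys = xs} = {u. \<forall>i<length xs. f u (take i (map z (butlast ys))) = xs ! i}"
    proof -
      have take: "take i (map z (butlast ys)) = map z (take i ys)" if "i < N" for i
        using that True by (simp add: take_map take_butlast)
      have "enc_inputs z (f u) ys = xs \<longleftrightarrow> (\<forall>i<length xs. f u (map z (take i ys)) = xs ! i)" for u
        using True by (auto simp: enc_inputs_def list_eq_iff_nth_eq)
      then show ?thesis using True by (auto simp: take)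
    qed
    finally show ?thesis using True by (simp add: pmf_input_output_joint causal_input_induced)
  qed
  finally show "pmf (map_pmf (\<lambda>(u, ys). (enc_inputs z (f u) ys, ys)) (bind_pmf P (\<lambda>u. map_pmf (Pair u) (?V u)))) ab =
     pmf (input_output_joint K p\<^sub>0 z N (induced_input P f)) ab" by (simp only: ab)
qed

lemma mutual_information_code:
  fixes K :: "('x::finite, 's::finite, 'y::finite) fs_channel" and P :: "'a::countable pmf"
    and p\<^sub>0 :: "'s pmf" and z :: "'y \<Rightarrow> 'z" and N :: nat
  defines "q \<equiv> \<lambda>f :: 'a \<Rightarrow> 'z list \<Rightarrow> 'x. bind_pmf P (\<lambda>u. map_pmf (Pair u) (mixed_output K p\<^sub>0 z (f u) N))"
  shows "pair_mutual_information (q f) = ereal (directed_information K p\<^sub>0 z N (induced_input P f))"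
proof -
  let ?h = "\<lambda>(u, ys). (enc_inputs z (f u) ys, ys)"
  let ?J = "input_output_joint K p\<^sub>0 z N (induced_input P f)"
  have J: "?J = map_pmf ?h (q f)" unfolding q_def by (rule joint_induced[symmetric])
  have len: "length ys = N" if "(u, ys) \<in> set_pmf (q f)" for u ys
    using that length_mixed_output by (auto simp: q_def)
  have "finite (snd ` set_pmf (q f))"
    by (rule finite_subset[OF _ finite_lists_eq[of N]]) (auto dest: len)
  then have i: "integrable (q f) (info_density (q f))" by (rule integrable_info_density_finite)
  have fst: "map_pmf fst (q f) = P" by (simp add: q_def map_fst_bind_map_Pair)
  have snd: "map_pmf snd ?J = map_pmf snd (q f)"
    unfolding J by (simp add: pmf.map_comp comp_def case_prod_unfold)
  have "measure_pmf.expectation (q f) (info_density (q f)) =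
     measure_pmf.expectation (q f) (\<lambda>x. (\<lambda>(xs, ys). log 2 (channel_law K p\<^sub>0 xs ys / pmf (map_pmf snd ?J) ys)) (?h x))"
  proof (rule integral_cong_AE)
    show "AE x in (q f). info_density (q f) x = (\<lambda>(xs, ys). log 2 (channel_law K p\<^sub>0 xs ys / pmf (map_pmf snd ?J) ys)) (?h x)"
    proof (rule AE_pmfI)
      fix x assume x: "x \<in> set_pmf (q f)"
      obtain u ys where xy: "x = (u, ys)" by (cases x)
      have l: "length ys = N" using len x xy by blast
      have "pmf (q f) (u, ys) = pmf P u * channel_law K p\<^sub>0 (enc_inputs z (f u) ys) ys"
        using l by (simp add: q_def pmf_bind_map_Pair pmf_mixed_output)
      moreover have "pmf P u > 0" using x by (auto simp: xy q_def pmf_positive_iff)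
      ultimately show "info_density (q f) x = (\<lambda>(xs, ys). log 2 (channel_law K p\<^sub>0 xs ys / pmf (map_pmf snd ?J) ys)) (?h x)"
        by (simp add: info_density_def xy fst snd)
    qed
  qed auto
  also have "\<dots> = directed_information K p\<^sub>0 z N (induced_input P f)"
    unfolding directed_information_eq by (subst (2) J) simp
  finally show ?thesis using i by (simp add: pair_mutual_information_eq)
qed

context stationary_source
begin

lemma feasible_of_fidelity:
  fixes d :: "'u \<Rightarrow> 'v::countable \<Rightarrow> real" and K :: "('x::finite, 's::finite, 'y::finite) fs_channel" and z :: "'y \<Rightarrow> 'z"
  assumes N: "N \<ge> 1" and g: "\<And>ys. length ys = N \<Longrightarrow> length (g ys) = N"
    and D: "block_distortion d N (source_reconstruction \<mu> K p\<^sub>0 z N f g) \<le> D"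
  shows "test_channel_feasible \<mu> d N (real N * D) (ereal (max_directed_information K p\<^sub>0 z N))"
proof -
  define W where "W us = map_pmf g (mixed_output K p\<^sub>0 z (f us) N)" for us
  let ?q = "bind_pmf (source_block \<mu> N) (\<lambda>u. map_pmf (Pair u) (mixed_output K p\<^sub>0 z (f u) N))"
  have valid: "valid_channel N W"
    by (auto simp: valid_channel_def W_def intro!: g elim: length_mixed_output)
  have tq: "test_channel_joint \<mu> N W = map_pmf (\<lambda>(u, ys). (u, g ys)) ?q"
    by (simp add: test_channel_joint_def W_def map_bind_pmf pmf.map_comp comp_def)
  have tr: "test_channel_joint \<mu> N W = source_reconstruction \<mu> K p\<^sub>0 z N f g"
    by (simp add: test_channel_joint_def W_def source_reconstruction_def mixed_output_def map_bind_pmf pmf.map_comp comp_def)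
  have "pair_mutual_information (test_channel_joint \<mu> N W) \<le> pair_mutual_information ?q"
    unfolding tq by (rule data_processing)
  also have "\<dots> = ereal (directed_information K p\<^sub>0 z N (induced_input (source_block \<mu> N) f))"
    by (rule mutual_information_code)
  also have "\<dots> \<le> ereal (max_directed_information K p\<^sub>0 z N)"
    unfolding max_directed_information_def by (simp add: cSUP_upper bdd_above_directed_information)
  finally show ?thesis
    using valid D N unfolding test_channel_feasible_def tr[symmetric] by (auto simp: block_distortion_le_iff)
qed

lemma test_channel_feasible_repeat:
  fixes d :: "'u \<Rightarrow> 'v::countable \<Rightarrow> real"
  assumes "test_channel_feasible \<mu> d k T (ereal r)" and "m \<ge> 1"
  shows "test_channel_feasible \<mu> d (m * k) (real m * T) (ereal (real m * r))"
  using \<open>m \<ge> 1\<close>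
proof (induction m rule: nat_induct_at_least)
  case (Suc m)
  from test_channel_feasible_add[OF assms(1) Suc.IH] show ?case by (simp add: algebra_simps)
qed (use assms in simp)

end

lemma (in ergodic_source) feasible_strict:
  fixes d :: "'u \<Rightarrow> 'v::countable \<Rightarrow> real"
  assumes d: "\<And>u v. 0 \<le> d u v" "\<And>u v. d u v \<le> B" and k: "k \<ge> 1"
    and feas: "test_channel_feasible \<mu> d k (real k * D) (ereal r)" and r: "r < real k * R"
    and D: "min_distortion \<mu> d < D"
  obtains k' D' r' where "k' \<ge> 1" "D' < D" "test_channel_feasible \<mu> d k' (real k' * D') (ereal r')" "r' < real k' * R"
proof -
  obtain D0 r0 where D0: "D0 < D" "test_channel_feasible \<mu> d 1 D0 (ereal r0)"
    using near_minimal_letter[OF d D] by blast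
  obtain m0 :: nat where m0: "real m0 > (r0 - R) / (real k * R - r)" using reals_Archimedean2 by blast
  define m where "m = max 1 m0"
  have m: "m \<ge> 1" "real m0 \<le> real m" by (auto simp: m_def)
  define k' where "k' = m * k + 1"
  define D' where "D' = (real m * (real k * D) + D0) / real k'"
  show thesis
  proof
    show "k' \<ge> 1" by (simp add: k'_def)
    have "real m * (real k * D) + D0 < real k' * D" using D0(1) by (simp add: k'_def algebra_simps)
    moreover have "k' > 0" by (simp add: k'_def)
    ultimately show "D' < D" by (simp add: D'_def divide_less_eq mult.commute)
    have "real k' * D' = real m * (real k * D) + D0" using \<open>k' > 0\<close> by (simp add: D'_def)
    then show "test_channel_feasible \<mu> d k' (real k' * D') (ereal (real m * r + r0))"
      using test_channel_feasible_add[OF test_channel_feasible_repeat[OF feas m(1)] D0(2)] by (simp add: k'_def)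
    have "(r0 - R) / (real k * R - r) < real m" using m0 m by linarith
    then have "r0 - R < real m * (real k * R - r)" using r by (simp add: divide_less_eq)
    then show "real m * r + r0 < real k' * R" by (simp add: k'_def algebra_simps)
  qed
qed

theorem theorem19:
  fixes \<mu> :: "(nat \<Rightarrow> 'u::countable) measure"
    and d :: "'u \<Rightarrow> 'v::countable \<Rightarrow> real"
    and K :: "('x::finite, 's::finite, 'y::finite) fs_channel"
    and p\<^sub>0 :: "'s pmf"
    and z :: "'y \<Rightarrow> 'z::finite"
    and C D \<epsilon> B :: real
  assumes "\<epsilon> > 0" and "D \<ge> 0"
    and "stationary_ergodic \<mu>"
    and "\<And>u v. 0 \<le> d u v" and "\<And>u v. d u v \<le> B"
    and "capacity K z = ereal C"
    and "(\<lambda>N. max_directed_information K p\<^sub>0 z N / real N) \<longlonglongrightarrow> C"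
  shows "(rate_distortion \<mu> d D < ereal C \<longrightarrow> fidelity_attainable \<mu> d K p\<^sub>0 z (D + \<epsilon>)) \<and>
         (rate_distortion \<mu> d D < ereal C \<and> min_distortion \<mu> d < D \<longrightarrow>
            fidelity_attainable \<mu> d K p\<^sub>0 z D) \<and>
         (ereal C < rate_distortion \<mu> d D \<longrightarrow> \<not> fidelity_attainable \<mu> d K p\<^sub>0 z D)"
proof -
  interpret ergodic_source \<mu>
  proof (intro ergodic_source.intro stationary_source.intro stationary_source_axioms.intro ergodic_source_axioms.intro)
    fix A assume "A \<in> sets \<mu>" "seq_shift -` A = A"
    then show "measure \<mu> A = 0 \<or> measure \<mu> A = 1"
      using \<open>stationary_ergodic \<mu>\<close> unfolding stationary_ergodic_def by blast
  qed (use \<open>stationary_ergodic \<mu>\<close> in \<open>auto simp: stationary_ergodic_def\<close>)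
  note d = \<open>\<And>u v. 0 \<le> d u v\<close> \<open>\<And>u v. d u v \<le> B\<close>
  have feasible: "\<exists>R k r. achievable_rate K z R \<and> k \<ge> 1 \<and> test_channel_feasible \<mu> d k (real k * D) (ereal r) \<and> r < real k * R"
    if less: "rate_distortion \<mu> d D < ereal C"
  proof -
    have "rate_distortion \<mu> d D < (SUP R\<in>{R. achievable_rate K z R}. ereal R)"
      using less \<open>capacity K z = ereal C\<close> by (simp add: capacity_def)
    then obtain R where R: "achievable_rate K z R" "rate_distortion \<mu> d D < ereal R"
      by (auto simp: less_SUP_iff)
    from rate_distortion_lessE[OF R(2)] R(1) show ?thesis by metis
  qed
  have "fidelity_attainable \<mu> d K p\<^sub>0 z (D + \<epsilon>)" if "rate_distortion \<mu> d D < ereal C"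
  proof -
    from feasible[OF that] obtain R k r where "achievable_rate K z R" "k \<ge> 1"
      "test_channel_feasible \<mu> d k (real k * D) (ereal r)" "r < real k * R" by blast
    then show ?thesis using fidelity_attainable_of_feasible[of d B k D r R K z \<epsilon> p\<^sub>0] d \<open>\<epsilon> > 0\<close> by blast
  qed
  moreover have "fidelity_attainable \<mu> d K p\<^sub>0 z D" if less: "rate_distortion \<mu> d D < ereal C" and min: "min_distortion \<mu> d < D"
  proof -
    from feasible[OF less] obtain R k r where R: "achievable_rate K z R" and k: "k \<ge> 1"
      "test_channel_feasible \<mu> d k (real k * D) (ereal r)" "r < real k * R" by blast
    obtain k' D' r' where k': "k' \<ge> 1" "D' < D" "test_channel_feasible \<mu> d k' (real k' * D') (ereal r')" "r' < real k' * R"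
      by (rule feasible_strict[OF d k min])
    have "fidelity_attainable \<mu> d K p\<^sub>0 z (D' + (D - D'))"
      using k'(2) by (intro fidelity_attainable_of_feasible[OF d k'(1,3,4) R]) simp
    then show ?thesis by simp
  qed
  moreover have "\<not> fidelity_attainable \<mu> d K p\<^sub>0 z D" if less: "ereal C < rate_distortion \<mu> d D"
  proof
    assume "fidelity_attainable \<mu> d K p\<^sub>0 z D"
    then have "\<forall>\<^sub>F N in sequentially. test_channel_feasible \<mu> d N (real N * D) (ereal (max_directed_information K p\<^sub>0 z N))"
      unfolding fidelity_attainable_def using eventually_ge_at_top[of 1]
      by eventually_elim (use feasible_of_fidelity in blast)
    then have "rate_distortion \<mu> d D \<le> ereal C" by (rule rate_distortion_le) fact
    then show False using less by simp
  qed
  ultimately show ?thesis by blast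
qed

end
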